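(* Let $\mu\ge0$ and $\mathbf{u}_0,\mathcal{B}_0\in H^3\cap V$. For each $\alpha>0$ let $(\mathbf{u}^\alpha,\mathcal{B}^\alpha)$ be the solution, with initial data $(\mathbf{u}_0,\mathcal{B}_0)$ (the same data for all $\alpha>0$), of the MHD-Voigt system $$-\alpha^2\partial_t\triangle\mathbf{u}+\partial_t\mathbf{u}+(\mathbf{u}\cdot\nabla)\mathbf{u}+\nabla\left(p+\tfrac12|\mathcal{B}|^2\right)=(\mathcal{B}\cdot\nabla)\mathcal{B},\qquad \partial_t\mathcal{B}+(\mathbf{u}\cdot\nabla)\mathcal{B}-(\mathcal{B}\cdot\nabla)\mathbf{u}+\nabla q=\mu\triangle\mathcal{B},\qquad \nabla\cdot\mathcal{B}=\nabla\cdot\mathbf{u}=0.$$ Suppose that for some $0<T_*<\infty$, $$\sup_{t\in[0,T_* )}\ \limsup_{\alpha\to0}\ \alpha^2\|\mathbf{u}^\alpha(t)\|^2>0.$$ Then the solution $(\mathbf{u},\mathcal{B})$, with initial data $(\mathbf{u}_0,\mathcal{B}_0)$, of the inviscid ($\nu=0$) MHD system with resistivity $\mu\ge0$ (resistive if $\mu>0$, irresistive if $\mu=0$), $$\partial_t\mathbf{u}+(\mathbf{u}\cdot\nabla)\mathbf{u}+\nabla\left(p+\tfrac12|\mathcal{B}|^2\right)=(\mathcal{B}\cdot\nabla)\mathcal{B},\qquad \partial_t\mathcal{B}+(\mathbf{u}\cdot\nabla)\mathcal{B}-(\mathcal{B}\cdot\nabla)\mathbf{u}+\nabla q=\mu\triangle\mathcal{B},\qquad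 \nabla\cdot\mathcal{B}=\nabla\cdot\mathbf{u}=0,$$ becomes singular in the time interval $[0,T_* )$; that is, there is no solution of this system with these initial data satisfying $\mathbf{u},\mathcal{B}\in C([0,T_* ),H^3\cap V)$.
   Context: Setting: $\Omega=\mathbb{T}^3=[0,1]^3$ with periodic boundary conditions; $H^s$ is the usual ($L^2$-based) Sobolev space over $\Omega$. $\mathcal{V}$ is the set of $\mathbb{R}^3$-valued trigonometric polynomials $\varphi$ on $\Omega$ with $\nabla\cdot\varphi=0$ and $\int_\Omega\varphi\,d\mathbf{x}=0$; $H$ and $V$ are the closures of $\mathcal{V}$ in $L^2(\Omega)$ and $H^1(\Omega)$, with norms $|\mathbf{u}|=\|\mathbf{u}\|_{L^2}$ and $\|\mathbf{u}\|=\|\nabla\mathbf{u}\|_{L^2}$ respectively. $V'$ is the dual of $V$, with $V\hookrightarrow H\equiv H'\hookrightarrow V'$. $P_\sigma:L^2\to H$ is the Leray-Helmholtz projection, $A=-P_\sigma\triangle$ with domain $\mathcal{D}(A)=H^2\cap V$, extended to $A:V\to V'$, and $B(\mathbf{u},\mathbf{v})=P_\sigma((\mathbf{u}\cdot\nabla)\mathbf{v})$, extended to a continuous bilinear map $V\times V\to V'$. The unknowns are the velocity $\mathbf{u}$, the magnetic field $\mathcal{B}$, the fluid pressure $p$ and the magnetic pressure $q$; $\nu$ denotes the fluid viscosity (zero here) and $\mu$ the magnetic resistivity, the same in both systems. Solution of the (non-regularized) MHD system: solutions are understood in the class $\mathbf{u},\mathcal{B}\in C([0,T],H^3\cap V)$.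 For $\mu>0$ and $\mathbf{u}_0,\mathcal{B}_0\in H^3\cap V$, known short-time theory gives a time $T>0$ and a unique solution in this class. Solution of the MHD-Voigt system: the strong solution. Here the system is understood in the equivalent projected form $\frac{d}{dt}(\alpha^2A\mathbf{u}+\mathbf{u})=B(\mathcal{B},\mathcal{B})-B(\mathbf{u},\mathbf{u})$, $\frac{d}{dt}\mathcal{B}+\mu A\mathcal{B}=B(\mathcal{B},\mathbf{u})-B(\mathbf{u},\mathcal{B})$, and a strong solution on $[0,T]$ is a pair attaining the initial data with $\mathbf{u}\in C([0,T],V)$, $\frac{d\mathbf{u}}{dt}\in C([0,T],V)$, $\mathcal{B}\in L^2((0,T),\mathcal{D}(A))\cap C([0,T],V)$, $\frac{d\mathcal{B}}{dt}\in L^2((0,T),H)$, satisfying the first equation in the sense of $L^{4/3}([0,T],V')$ and the second in the sense of $L^2([0,T],V')$. For $\mu>0$ it exists and is unique on every interval $[0,T]$ for initial data in $V$; for $\mu=0$ no separate existence result is asserted here, and the existence of $(\mathbf{u}^\alpha,\mathcal{B}^\alpha)$ is part of the hypothesis. *)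

theory Defs
  imports "HOL-Analysis.Analysis"
begin

text \<open>
  Functions on the torus are represented by functions on \<open>\<real>\<^sup>3\<close>, of which only the values on the
  unit cube matter, and equality is equality almost everywhere there. Periodicity enters through
  the weak derivatives, whose test functions are periodic. Asking for Borel (rather than Lebesgue)
  measurable functions only selects representatives.
\<close>

type_synonym field = "real^3 \<Rightarrow> real^3"

definition torus :: "(real^3) measure" where
  "torus = restrict_space lborel (cbox 0 1)"

definition L2 :: "(real^3 \<Rightarrow> 'a::euclidean_space) \<Rightarrow> bool" where
  "L2 f \<longleftrightarrow> f \<in> borel_measurable torus \<and> integrable torus (\<lambda>x. (norm (f x))\<^sup>2)"

definition l2norm :: "(real^3 \<Rightarrow> 'a::euclidean_space) \<Rightarrow> real" where
  "l2norm f = sqrt (LINT x|torus. (norm (f x))\<^sup>2)"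

definition ip :: "(real^3 \<Rightarrow> 'a::euclidean_space) \<Rightarrow> (real^3 \<Rightarrow> 'a) \<Rightarrow> real" where
  "ip f g = (LINT x|torus. f x \<bullet> g x)"

definition trig_poly :: "(real^3 \<Rightarrow> 'a::euclidean_space) \<Rightarrow> bool" where
  "trig_poly \<phi> \<longleftrightarrow> (\<exists>(K :: (int^3) set) a b. finite K \<and>
     \<phi> = (\<lambda>x. \<Sum>k\<in>K. cos (2 * pi * (\<Sum>i\<in>UNIV. of_int (k $ i) * x $ i)) *\<^sub>R a k
                    + sin (2 * pi * (\<Sum>i\<in>UNIV. of_int (k $ i) * x $ i)) *\<^sub>R b k))"

definition partial :: "3 \<Rightarrow> (real^3 \<Rightarrow> 'a::euclidean_space) \<Rightarrow> real^3 \<Rightarrow> 'a" where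
  "partial i \<phi> x = frechet_derivative \<phi> (at x) (axis i 1)"

text \<open>
  Trigonometric polynomials are dense in the smooth periodic functions, so they suffice as test
  functions for distributional derivatives on the torus.
\<close>

definition weak_partial ::
  "3 \<Rightarrow> (real^3 \<Rightarrow> 'a::euclidean_space) \<Rightarrow> (real^3 \<Rightarrow> 'a) \<Rightarrow> bool" where
  "weak_partial i f g \<longleftrightarrow> (\<forall>\<psi> :: real^3 \<Rightarrow> real. trig_poly \<psi> \<longrightarrow>
     (LINT x|torus. partial i \<psi> x *\<^sub>R f x) = - (LINT x|torus. \<psi> x *\<^sub>R g x))"

text \<open>A representative of the weak derivative, which is unique almost everywhere if it exists.\<close>

definition wd :: "3 \<Rightarrow> (real^3 \<Rightarrow> 'a::euclidean_space) \<Rightarrow> real^3 \<Rightarrow> 'a" where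
  "wd i f = (SOME g. L2 g \<and> weak_partial i f g)"

primrec sobolev :: "nat \<Rightarrow> (real^3 \<Rightarrow> 'a::euclidean_space) \<Rightarrow> bool" where
  "sobolev 0 f \<longleftrightarrow> L2 f"
| "sobolev (Suc s) f \<longleftrightarrow> L2 f \<and> (\<forall>i. \<exists>g. weak_partial i f g \<and> sobolev s g)"

text \<open>
  This counts the derivative of each multi-index as often as there are orders of differentiation
  producing it; up to equivalence it is the usual norm of \<open>H\<^sup>s\<close>.
\<close>

primrec sobnorm :: "nat \<Rightarrow> (real^3 \<Rightarrow> 'a::euclidean_space) \<Rightarrow> real" where
  "sobnorm 0 f = l2norm f"
| "sobnorm (Suc s) f = sqrt ((l2norm f)\<^sup>2 + (\<Sum>i\<in>UNIV. (sobnorm s (wd i f))\<^sup>2))"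

definition grad :: "(real^3 \<Rightarrow> real) \<Rightarrow> field" where
  "grad p x = (\<chi> i. wd i p x)"

definition laplacian :: "field \<Rightarrow> field" where
  "laplacian u x = (\<Sum>i\<in>UNIV. wd i (wd i u) x)"

definition advect :: "field \<Rightarrow> field \<Rightarrow> field" where
  "advect u v x = (\<Sum>i\<in>UNIV. (u x $ i) *\<^sub>R wd i v x)"

definition solenoidal_polys :: "field set" where
  "solenoidal_polys =
     {\<phi>. trig_poly \<phi> \<and> (\<forall>x. (\<Sum>i\<in>UNIV. partial i \<phi> x $ i) = 0) \<and> (LINT x|torus. \<phi> x) = 0}"

definition Hspace :: "field set" where
  "Hspace = {u. L2 u \<and> (\<forall>e>0. \<exists>\<phi>\<in>solenoidal_polys. l2norm (\<lambda>x. u x - \<phi> x) < e)}"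

definition Vspace :: "field set" where
  "Vspace = {u. sobolev 1 u \<and> (\<forall>e>0. \<exists>\<phi>\<in>solenoidal_polys. sobnorm 1 (\<lambda>x. u x - \<phi> x) < e)}"

definition Vnorm :: "field \<Rightarrow> real" where
  "Vnorm u = sqrt (\<Sum>i\<in>UNIV. (l2norm (wd i u))\<^sup>2)"

text \<open>
  An element of \<open>V'\<close> is represented by a functional on vector fields, of which only the values on
  \<open>V\<close> matter. The element given by \<open>f \<in> H\<close> is \<open>ip f\<close>.
\<close>

definition dual :: "(field \<Rightarrow> real) \<Rightarrow> bool" where
  "dual F \<longleftrightarrow>
     (\<forall>v\<in>Vspace. \<forall>w\<in>Vspace. F (\<lambda>x. v x + w x) = F v + F w) \<and>
     (\<forall>c. \<forall>v\<in>Vspace. F (\<lambda>x. c *\<^sub>R v x) = c * F v) \<and>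
     (\<exists>C. \<forall>v\<in>Vspace. \<bar>F v\<bar> \<le> C * Vnorm v)"

definition dual_norm :: "(field \<Rightarrow> real) \<Rightarrow> real" where
  "dual_norm F = (SUP v\<in>{v \<in> Vspace. Vnorm v \<le> 1}. \<bar>F v\<bar>)"

text \<open>
  The operator \<open>A : V \<rightarrow> V'\<close>, that is \<open>\<langle>Au, w\<rangle> = (\<nabla>u, \<nabla>w)\<close>. For \<open>u \<in> H\<^sup>2 \<inter> V\<close> this is
  \<open>(-P\<^sub>\<sigma>\<triangle>u, w) = (-\<triangle>u, w)\<close> integrated by parts, since the projection \<open>P\<^sub>\<sigma>\<close> is orthogonal and
  \<open>w \<in> H\<close>.
\<close>

definition stokes :: "field \<Rightarrow> field \<Rightarrow> real" where
  "stokes u w = (\<Sum>i\<in>UNIV. ip (wd i u) (wd i w))"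

text \<open>
  The bilinear map \<open>B : V \<times> V \<rightarrow> V'\<close>, that is \<open>\<langle>B(u,v), w\<rangle> = \<integral> ((u \<cdot> \<nabla>)v) \<cdot> w\<close>. The integrand is
  integrable because \<open>V\<close> embeds into \<open>L\<^sup>4\<close>, and the projection \<open>P\<^sub>\<sigma>\<close> disappears from the pairing
  because \<open>w \<in> H\<close>.
\<close>

definition convect :: "field \<Rightarrow> field \<Rightarrow> field \<Rightarrow> real" where
  "convect u v w = ip (advect u v) w"

definition continuous_in_norm :: "(field \<Rightarrow> real) \<Rightarrow> real set \<Rightarrow> (real \<Rightarrow> field) \<Rightarrow> bool" where
  "continuous_in_norm N I u \<longleftrightarrow>
     (\<forall>t\<in>I. ((\<lambda>s. N (\<lambda>x. u s x - u t x)) \<longlongrightarrow> 0) (at t within I))"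

definition C_into :: "field set \<Rightarrow> (field \<Rightarrow> real) \<Rightarrow> real set \<Rightarrow> (real \<Rightarrow> field) \<Rightarrow> bool" where
  "C_into X N I u \<longleftrightarrow> (\<forall>t\<in>I. u t \<in> X) \<and> continuous_in_norm N I u"

definition deriv_in_norm ::
  "(field \<Rightarrow> real) \<Rightarrow> real set \<Rightarrow> (real \<Rightarrow> field) \<Rightarrow> (real \<Rightarrow> field) \<Rightarrow> bool" where
  "deriv_in_norm N I u u' \<longleftrightarrow>
     (\<forall>t\<in>I. ((\<lambda>s. N (\<lambda>x. (u s x - u t x) /\<^sub>R (s - t) - u' t x)) \<longlongrightarrow> 0) (at t within I))"

text \<open>
  \<open>L\<^sup>2((0,T), X)\<close>, where \<open>N\<close> is the norm of \<open>X\<close>. Measurability is weak measurability, which is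
  equivalent to strong measurability because the spaces used are separable.
\<close>

definition L2_into :: "field set \<Rightarrow> (field \<Rightarrow> real) \<Rightarrow> real \<Rightarrow> (real \<Rightarrow> field) \<Rightarrow> bool" where
  "L2_into X N T f \<longleftrightarrow>
     (AE t in lebesgue_on {0..T}. f t \<in> X) \<and>
     (\<forall>w. L2 w \<longrightarrow> (\<lambda>t. ip (f t) w) \<in> borel_measurable (lebesgue_on {0..T})) \<and>
     integrable (lebesgue_on {0..T}) (\<lambda>t. (N (f t))\<^sup>2)"

text \<open>
  For \<open>u\<close> continuous and \<open>u'\<close> square integrable in time with values in \<open>L\<^sup>2\<close>, this says that \<open>u'\<close>
  is the distributional time derivative of \<open>u\<close> on \<open>(0,T)\<close>.
\<close>

definition weak_time_deriv :: "real \<Rightarrow> (real \<Rightarrow> field) \<Rightarrow> (real \<Rightarrow> field) \<Rightarrow> bool" where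
  "weak_time_deriv T u u' \<longleftrightarrow> (\<forall>w. L2 w \<longrightarrow> (\<forall>t\<in>{0..T}.
     ip (u t) w = ip (u 0) w + (LINT s|lebesgue_on {0..t}. ip (u' s) w)))"

definition Lp_into_dual :: "real \<Rightarrow> real \<Rightarrow> (real \<Rightarrow> field \<Rightarrow> real) \<Rightarrow> bool" where
  "Lp_into_dual p T F \<longleftrightarrow>
     (AE t in lebesgue_on {0..T}. dual (F t)) \<and>
     (\<forall>w\<in>Vspace. (\<lambda>t. F t w) \<in> borel_measurable (lebesgue_on {0..T})) \<and>
     integrable (lebesgue_on {0..T}) (\<lambda>t. dual_norm (F t) powr p)"

definition eq_Lp_dual ::
  "real \<Rightarrow> real \<Rightarrow> (real \<Rightarrow> field \<Rightarrow> real) \<Rightarrow> (real \<Rightarrow> field \<Rightarrow> real) \<Rightarrow> bool" where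
  "eq_Lp_dual p T F G \<longleftrightarrow> Lp_into_dual p T F \<and> Lp_into_dual p T G \<and>
     (AE t in lebesgue_on {0..T}. \<forall>w\<in>Vspace. F t w = G t w)"

text \<open>
  Strong solutions of the MHD-Voigt system on \<open>[0,T]\<close>. As \<open>A : V \<rightarrow> V'\<close> is bounded and linear
  and \<open>u\<close> is differentiable with values in \<open>V\<close>, the derivative of \<open>\<alpha>\<^sup>2Au + u\<close> is \<open>\<alpha>\<^sup>2Au' + u'\<close>.
  The norm of \<open>H\<^sup>2\<close> is equivalent to the graph norm of \<open>A\<close> on \<open>D(A) = H\<^sup>2 \<inter> V\<close>.
\<close>

definition voigt_solution :: "real \<Rightarrow> real \<Rightarrow> real \<Rightarrow> field \<Rightarrow> field
    \<Rightarrow> (real \<Rightarrow> field) \<Rightarrow> (real \<Rightarrow> field) \<Rightarrow> bool" where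
  "voigt_solution \<alpha> \<mu> T u0 b0 u b \<longleftrightarrow>
     (AE x in torus. u 0 x = u0 x) \<and> (AE x in torus. b 0 x = b0 x) \<and>
     C_into Vspace Vnorm {0..T} u \<and>
     C_into Vspace Vnorm {0..T} b \<and>
     L2_into {v \<in> Vspace. sobolev 2 v} (sobnorm 2) T b \<and>
     (\<exists>u' b'.
        C_into Vspace Vnorm {0..T} u' \<and> deriv_in_norm Vnorm {0..T} u u' \<and>
        L2_into Hspace l2norm T b' \<and> weak_time_deriv T b b' \<and>
        eq_Lp_dual (4/3) T
          (\<lambda>t w. \<alpha>\<^sup>2 * stokes (u' t) w + ip (u' t) w)
          (\<lambda>t w. convect (b t) (b t) w - convect (u t) (u t) w) \<and>
        eq_Lp_dual 2 T
          (\<lambda>t w. ip (b' t) w + \<mu> * stokes (b t) w)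
          (\<lambda>t w. convect (b t) (u t) w - convect (u t) (b t) w))"

text \<open>
  Solutions of the inviscid MHD system on \<open>[0,T)\<close> in \<open>C([0,T), H\<^sup>3 \<inter> V)\<close>. Membership in \<open>V\<close>
  contains the divergence conditions. The time derivatives are only required in the weak sense and
  the equations almost everywhere in time and space; for fields in this class the derivatives are
  then continuous in time with values in \<open>H\<^sup>1\<close>. The condition on \<open>p\<close> is put on the total pressure,
  whose gradient appears in the equation.
\<close>

definition mhd_solution :: "real \<Rightarrow> real \<Rightarrow> field \<Rightarrow> field
    \<Rightarrow> (real \<Rightarrow> field) \<Rightarrow> (real \<Rightarrow> field) \<Rightarrow> bool" where
  "mhd_solution \<mu> T u0 b0 u b \<longleftrightarrow>
     (AE x in torus. u 0 x = u0 x) \<and> (AE x in torus. b 0 x = b0 x) \<and>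
     C_into {v \<in> Vspace. sobolev 3 v} (sobnorm 3) {0..<T} u \<and>
     C_into {v \<in> Vspace. sobolev 3 v} (sobnorm 3) {0..<T} b \<and>
     (\<exists>(u' :: real \<Rightarrow> field) (b' :: real \<Rightarrow> field)
        (p :: real \<Rightarrow> real^3 \<Rightarrow> real) (q :: real \<Rightarrow> real^3 \<Rightarrow> real).
        (\<forall>S. 0 < S \<and> S < T \<longrightarrow>
           L2_into {f. L2 f} l2norm S u' \<and> weak_time_deriv S u u' \<and>
           L2_into {f. L2 f} l2norm S b' \<and> weak_time_deriv S b b') \<and>
        (AE t in lebesgue_on {0..<T}.
           sobolev 1 (\<lambda>x. p t x + (norm (b t x))\<^sup>2 / 2) \<and> sobolev 1 (q t) \<and>
           (AE x in torus.
              u' t x + advect (u t) (u t) x + grad (\<lambda>y. p t y + (norm (b t y))\<^sup>2 / 2) x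
              = advect (b t) (b t) x) \<and>
           (AE x in torus.
              b' t x + advect (u t) (b t) x - advect (b t) (u t) x + grad (q t) x
              = \<mu> *\<^sub>R laplacian (b t) x)))"

end

theory Submission
  imports Defs
begin

text \<open>
  Suppose that the MHD system has a solution \<open>(u, b)\<close> in \<open>H\<^sup>3 \<inter> V\<close> on the whole interval. For a Voigt
  solution \<open>(ua, ba)\<close> with parameter \<open>\<alpha>\<close> and the same data put \<open>U = ua - u\<close> and \<open>W = ba - b\<close>. The energy
  \<open>\<alpha>\<^sup>2 \<parallel>U\<parallel>\<^sup>2 + \<bar>U\<bar>\<^sup>2 + \<bar>W\<bar>\<^sup>2\<close> vanishes initially and grows at most at the rate
  \<open>M energy + \<alpha>\<^sup>2 L\<^sup>2\<close>, where \<open>M\<close> and \<open>L\<close> depend on \<open>(u, b)\<close> only (\<open>energy_increment\<close>). By Gronwall's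
  inequality it is at most a constant times \<open>\<alpha>\<^sup>2\<close>. Dividing by \<open>\<alpha>\<^sup>2\<close>, the norm of \<open>ua\<close> in \<open>V\<close> is bounded
  uniformly in \<open>\<alpha>\<close> on each compact subinterval (\<open>voigt_bounded_in_V\<close>). So \<open>\<alpha>\<^sup>2 \<parallel>ua(t)\<parallel>\<^sup>2\<close> tends to zero
  at every time, and the supremum in the criterion would be zero.

  Three facts produce the growth rate. Antisymmetry of the trilinear form removes all quadratic terms
  of the difference except those containing the gradient of \<open>u\<close> or \<open>b\<close> (\<open>nonlin_diagonal\<close>), and these
  gradients are bounded because \<open>H\<^sup>2\<close> embeds into \<open>L\<^sup>\<infinity>\<close>. The term \<open>\<alpha>\<^sup>2 (\<nabla> \<partial>\<^sub>t u, \<nabla> U)\<close>, which the MHD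
  system lacks, is controlled because \<open>u\<close> is Lipschitz continuous in time with values in \<open>V\<close>
  (\<open>regular_solution_Lipschitz\<close>). The difference itself is an admissible test field because \<open>V\<close> embeds
  into \<open>L\<^sup>4\<close>, which makes the trilinear form bounded on \<open>V\<close> (\<open>convect_bound\<close>).

  In time, only calculus for real functions is needed. Tested with a fixed element of \<open>V\<close>, both systems
  have right-hand sides that are continuous in time, so that the equations, assumed almost everywhere,
  hold with classical derivatives (\<open>weak_system\<close>), and the mean value theorem controls the increments of
  the energy over short intervals.

  In space, everything rests on trigonometric polynomials. They are dense by the theorem of Stone and
  Weierstrass, which makes weak derivatives unique and the Sobolev norms seminorms. Both embeddings
  follow from the convergence of \<open>\<Sum> (1 + \<bar>k\<bar>\<^sup>2)\<^sup>-\<^sup>2\<close> over \<open>\<int>\<^sup>3\<close> (\<open>lattice_sum_bounded\<close>).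
\<close>

section \<open>Square integrable functions on the torus\<close>

lemma space_torus [simp]: "space torus = cbox 0 1"
  by (simp add: torus_def space_restrict_space)

lemma emeasure_torus: "emeasure torus (space torus) = 1"
proof -
  have "(\<Prod>b\<in>(Basis :: (real^3) set). (1::real^3) \<bullet> b) = 1"
    by (rule prod.neutral) (auto simp: Basis_vec_def inner_axis)
  then show ?thesis
    by (subst space_torus, unfold torus_def, subst emeasure_restrict_space)
       (auto simp: emeasure_lborel_cbox_eq Basis_vec_def inner_axis)
qed

interpretation torus: finite_measure torus
  by (rule finite_measureI) (simp only: emeasure_torus, simp)

lemma measure_torus: "measure torus (space torus) = 1"
  by (simp only: measure_def emeasure_torus, simp)

lemma continuous_measurable_torus:
  fixes f :: "real^3 \<Rightarrow> 'b::euclidean_space"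
  assumes "continuous_on UNIV f" shows "f \<in> borel_measurable torus"
  unfolding torus_def
  by (rule measurable_restrict_space1) (simp add: assms borel_measurable_continuous_onI)

lemma continuous_bounded_torus:
  fixes f :: "real^3 \<Rightarrow> 'b::euclidean_space"
  assumes "continuous_on UNIV f" shows "\<exists>B. \<forall>x\<in>cbox 0 1. norm (f x) \<le> B"
proof -
  have "compact (f ` cbox 0 1)"
    by (rule compact_continuous_image)
       (use assms continuous_on_subset in \<open>auto simp: compact_cbox\<close>)
  then show ?thesis using compact_imp_bounded bounded_iff by (metis imageI)
qed

lemma bounded_integrable_torus:
  fixes f :: "real^3 \<Rightarrow> 'b::euclidean_space"
  assumes "f \<in> borel_measurable torus" "\<And>x. x \<in> cbox 0 1 \<Longrightarrow> norm (f x) \<le> B"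
  shows "integrable torus f"
  by (rule torus.integrable_const_bound[where B = B]) (use assms in \<open>auto intro!: AE_I2\<close>)

lemma continuous_integrable_torus:
  fixes f :: "real^3 \<Rightarrow> 'b::euclidean_space"
  assumes "continuous_on UNIV f" shows "integrable torus f"
  using bounded_integrable_torus continuous_bounded_torus[OF assms]
    continuous_measurable_torus[OF assms] by metis

lemma L2_measurable: "L2 f \<Longrightarrow> f \<in> borel_measurable torus"
  by (simp add: L2_def)

lemma L2_continuous:
  fixes f :: "real^3 \<Rightarrow> 'b::euclidean_space"
  assumes "continuous_on UNIV f" shows "L2 f"
  unfolding L2_def
  by (intro conjI continuous_measurable_torus continuous_integrable_torus assms continuous_intros)

lemma L2_inner_integrable:
  assumes "L2 f" "L2 g" shows "integrable torus (\<lambda>x. f x \<bullet> g x)"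
proof (rule Bochner_Integration.integrable_bound)
  show "integrable torus (\<lambda>x. (norm (f x))\<^sup>2 + (norm (g x))\<^sup>2)"
    using assms by (auto simp: L2_def)
  show "(\<lambda>x. f x \<bullet> g x) \<in> borel_measurable torus"
    using assms by (intro borel_measurable_inner L2_measurable)
  have "norm (f x \<bullet> g x) \<le> norm ((norm (f x))\<^sup>2 + (norm (g x))\<^sup>2)" for x
  proof -
    have "\<bar>f x \<bullet> g x\<bar> \<le> norm (f x) * norm (g x)" by (rule Cauchy_Schwarz_ineq2)
    moreover have "0 \<le> (norm (f x) - norm (g x))\<^sup>2" by simp
    moreover have "0 \<le> norm (f x) * norm (g x)" by simp
    ultimately show ?thesis unfolding power2_diff by (simp add: sum_power2_ge_zero)
  qed
  then show "AE x in torus. norm (f x \<bullet> g x) \<le> norm ((norm (f x))\<^sup>2 + (norm (g x))\<^sup>2)"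
    by simp
qed

lemma L2_bounded_scaleR:
  fixes f :: "real^3 \<Rightarrow> 'b::euclidean_space"
  assumes "L2 f" "h \<in> borel_measurable torus" "AE x in torus. \<bar>h x\<bar> \<le> M"
  shows "L2 (\<lambda>x. h x *\<^sub>R f x)"
  unfolding L2_def
proof
  show m: "(\<lambda>x. h x *\<^sub>R f x) \<in> borel_measurable torus"
    using assms L2_measurable by (intro borel_measurable_scaleR) auto
  show "integrable torus (\<lambda>x. (norm (h x *\<^sub>R f x))\<^sup>2)"
  proof (rule Bochner_Integration.integrable_bound)
    show "integrable torus (\<lambda>x. M\<^sup>2 * (norm (f x))\<^sup>2)" using assms by (simp add: L2_def)
    show "(\<lambda>x. (norm (h x *\<^sub>R f x))\<^sup>2) \<in> borel_measurable torus" using m by measurable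
    show "AE x in torus. norm ((norm (h x *\<^sub>R f x))\<^sup>2) \<le> norm (M\<^sup>2 * (norm (f x))\<^sup>2)"
      using assms(3)
    proof eventually_elim
      case (elim x)
      then have "(h x)\<^sup>2 \<le> M\<^sup>2"
        by (metis abs_ge_zero power2_abs power_mono)
      then show ?case by (simp add: power_mult_distrib mult_right_mono)
    qed
  qed
qed

lemma L2_scaleR: "L2 f \<Longrightarrow> L2 (\<lambda>x. c *\<^sub>R f x)"
  by (rule L2_bounded_scaleR[where M = "\<bar>c\<bar>"]) auto

lemma L2_add: assumes "L2 f" "L2 g" shows "L2 (\<lambda>x. f x + g x)"
  unfolding L2_def
proof
  show "(\<lambda>x. f x + g x) \<in> borel_measurable torus"
    using assms by (intro borel_measurable_add L2_measurable)
  have "(norm (f x + g x))\<^sup>2 = (norm (f x))\<^sup>2 + 2 * (f x \<bullet> g x) + (norm (g x))\<^sup>2" for x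
    by (simp add: power2_norm_eq_inner inner_add_left inner_add_right inner_commute)
  then show "integrable torus (\<lambda>x. (norm (f x + g x))\<^sup>2)"
    using assms L2_inner_integrable[OF assms] by (simp add: L2_def)
qed

lemma L2_zero: "L2 (\<lambda>x. 0)"
  by (simp add: L2_def)

lemma L2_minus: "L2 f \<Longrightarrow> L2 (\<lambda>x. - f x)"
  using L2_scaleR[of f "-1"] by simp

lemma L2_diff: "L2 f \<Longrightarrow> L2 g \<Longrightarrow> L2 (\<lambda>x. f x - g x)"
  using L2_add[of f "\<lambda>x. - g x"] L2_minus[of g] by simp

lemma L2_sum: "finite A \<Longrightarrow> (\<And>i. i \<in> A \<Longrightarrow> L2 (f i)) \<Longrightarrow> L2 (\<lambda>x. \<Sum>i\<in>A. f i x)"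
  by (induction A rule: finite_induct) (auto intro: L2_add simp: L2_zero)

lemma L2_norm: "L2 f \<Longrightarrow> L2 (\<lambda>x. norm (f x))"
  using measurable_compose[OF L2_measurable borel_measurable_norm] by (simp add: L2_def)

lemma L2_dominated:
  assumes "g \<in> borel_measurable torus" "L2 f" "AE x in torus. norm (g x) \<le> norm (f x)"
  shows "L2 g"
  unfolding L2_def
proof
  show "integrable torus (\<lambda>x. (norm (g x))\<^sup>2)"
  proof (rule Bochner_Integration.integrable_bound)
    show "integrable torus (\<lambda>x. (norm (f x))\<^sup>2)" using assms by (simp add: L2_def)
    show "(\<lambda>x. (norm (g x))\<^sup>2) \<in> borel_measurable torus" using assms(1) by measurable
    show "AE x in torus. norm ((norm (g x))\<^sup>2) \<le> norm ((norm (f x))\<^sup>2)"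
      using assms(3) by eventually_elim (simp add: power_mono)
  qed
qed (use assms in auto)

lemma L2_cong_AE:
  assumes "L2 f" "g \<in> borel_measurable torus" "AE x in torus. f x = g x"
  shows "L2 g"
  using assms by (intro L2_dominated[OF assms(2,1)]) auto

lemma L2_component: "L2 f \<Longrightarrow> L2 (\<lambda>x. f x \<bullet> c)"
proof -
  assume f: "L2 f"
  have "L2 (\<lambda>x. norm c *\<^sub>R norm (f x))" by (intro L2_scaleR L2_norm f)
  then show "L2 (\<lambda>x. f x \<bullet> c)"
  proof (rule L2_dominated[rotated])
    show "(\<lambda>x. f x \<bullet> c) \<in> borel_measurable torus"
      using L2_measurable[OF f] by (intro borel_measurable_inner) simp_all
    show "AE x in torus. norm (f x \<bullet> c) \<le> norm (norm c *\<^sub>R norm (f x))"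
      using Cauchy_Schwarz_ineq2[of _ c] by (intro AE_I2) (simp add: mult.commute[of "norm c"])
  qed
qed

lemma L2_nth: "L2 f \<Longrightarrow> L2 (\<lambda>x. f x $ c)" for f :: "real^3 \<Rightarrow> real^'n"
  using L2_component[of f "axis c 1"] by (simp add: inner_axis)

lemma L2_integrable: fixes f :: "real^3 \<Rightarrow> 'b::euclidean_space"
  assumes "L2 f" shows "integrable torus f"
proof -
  have "integrable torus (\<lambda>x. norm (f x))"
    using L2_inner_integrable[OF L2_norm[OF assms] L2_continuous[of "\<lambda>x. 1::real"]]
    by (simp add: continuous_on_const)
  then show ?thesis using assms integrable_norm_cancel L2_measurable by blast
qed

lemma L2_scaleR_integrable: fixes g :: "real^3 \<Rightarrow> 'b::euclidean_space"
  assumes "L2 f" "L2 g" shows "integrable torus (\<lambda>x. f x *\<^sub>R g x)"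
proof -
  have "integrable torus (\<lambda>x. norm (f x) * norm (g x))"
    using L2_inner_integrable[OF L2_norm[OF assms(1)] L2_norm[OF assms(2)]] by simp
  then show ?thesis
    by (rule Bochner_Integration.integrable_bound)
       (use L2_measurable[OF assms(1)] L2_measurable[OF assms(2)] in \<open>simp_all add: borel_measurable_scaleR\<close>)
qed

subsection \<open>The inner product and the norm\<close>

lemma ip_commute: "ip f g = ip g f"
  by (simp add: ip_def inner_commute)

lemma ip_add_left: "L2 f \<Longrightarrow> L2 g \<Longrightarrow> L2 h \<Longrightarrow> ip (\<lambda>x. f x + g x) h = ip f h + ip g h"
  by (simp add: ip_def inner_add_left L2_inner_integrable)

lemma ip_diff_left: "L2 f \<Longrightarrow> L2 g \<Longrightarrow> L2 h \<Longrightarrow> ip (\<lambda>x. f x - g x) h = ip f h - ip g h"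
  by (simp add: ip_def inner_diff_left L2_inner_integrable)

lemma ip_scaleR_left: "ip (\<lambda>x. c *\<^sub>R f x) h = c * ip f h"
  by (simp add: ip_def)

lemma ip_add_right: "L2 f \<Longrightarrow> L2 g \<Longrightarrow> L2 h \<Longrightarrow> ip h (\<lambda>x. f x + g x) = ip h f + ip h g"
  by (simp add: ip_def inner_add_right L2_inner_integrable)

lemma ip_diff_right: "L2 f \<Longrightarrow> L2 g \<Longrightarrow> L2 h \<Longrightarrow> ip h (\<lambda>x. f x - g x) = ip h f - ip h g"
  by (simp add: ip_def inner_diff_right L2_inner_integrable)

lemma ip_scaleR_right: "ip h (\<lambda>x. c *\<^sub>R f x) = c * ip h f"
  by (simp add: ip_def)

lemma ip_sum_left:
  "finite A \<Longrightarrow> (\<And>i. i \<in> A \<Longrightarrow> L2 (f i)) \<Longrightarrow> L2 h \<Longrightarrow> ip (\<lambda>x. \<Sum>i\<in>A. f i x) h = (\<Sum>i\<in>A. ip (f i) h)"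
  by (induction A rule: finite_induct) (auto simp: ip_add_left L2_sum, simp add: ip_def)

lemma ip_cong_AE:
  assumes "f \<in> borel_measurable torus" "f' \<in> borel_measurable torus"
    "g \<in> borel_measurable torus" "g' \<in> borel_measurable torus"
    "AE x in torus. f x = f' x" "AE x in torus. g x = g' x"
  shows "ip f g = ip f' g'"
  unfolding ip_def
  by (rule integral_cong_AE) (use assms in \<open>auto intro!: borel_measurable_inner\<close>)

lemma l2norm_nonneg [simp]: "0 \<le> l2norm f"
  by (simp add: l2norm_def)

lemma l2norm_square: "(l2norm f)\<^sup>2 = ip f f"
  by (simp add: l2norm_def ip_def power2_norm_eq_inner)

lemma ip_nonneg [simp]: "0 \<le> ip f f"
  by (simp flip: l2norm_square)

lemma l2norm_cong_AE:
  assumes "f \<in> borel_measurable torus" "g \<in> borel_measurable torus" "AE x in torus. f x = g x"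
  shows "l2norm f = l2norm g"
  using ip_cong_AE[OF assms(1,2,1,2,3,3)] l2norm_square l2norm_nonneg by (metis power2_eq_imp_eq)

lemma l2norm_scaleR: "l2norm (\<lambda>x. c *\<^sub>R f x) = \<bar>c\<bar> * l2norm f"
  by (simp add: l2norm_def power_mult_distrib real_sqrt_mult)

lemma l2norm_zero [simp]: "l2norm (\<lambda>x. 0) = 0"
  by (simp add: l2norm_def)

lemma l2norm_zero_AE: assumes "AE x in torus. f x = 0" "f \<in> borel_measurable torus"
  shows "l2norm f = 0"
  using l2norm_cong_AE[OF assms(2) _ assms(1)] by simp

lemma ip_Cauchy_Schwarz: assumes f: "L2 f" and g: "L2 g" shows "\<bar>ip f g\<bar> \<le> l2norm f * l2norm g"
proof -
  have pos: "0 \<le> ip g g * s\<^sup>2 - 2 * ip f g * s + ip f f" for s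
  proof -
    have "0 \<le> ip (\<lambda>x. f x - s *\<^sub>R g x) (\<lambda>x. f x - s *\<^sub>R g x)" by simp
    also have "\<dots> = ip f f - s * ip f g - s * ip f g + s * s * ip g g"
      using f g by (simp add: ip_diff_left ip_diff_right L2_diff L2_scaleR ip_scaleR_left
          ip_scaleR_right ip_commute[of g f] algebra_simps)
    finally show ?thesis by (simp add: power2_eq_square algebra_simps)
  qed
  have "(ip f g)\<^sup>2 \<le> ip f f * ip g g"
  proof (cases "ip g g = 0")
    case True
    have "ip f g = 0"
    proof (rule ccontr)
      assume "ip f g \<noteq> 0"
      then show False using pos[of "(ip f f + 1) / (2 * ip f g)"] True by simp
    qed
    then show ?thesis using True by simp
  next
    case False
    then have "ip g g > 0" using ip_nonneg[of g] by linarith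
    then show ?thesis using pos[of "ip f g / ip g g"] by (simp add: field_simps power2_eq_square)
  qed
  then have "\<bar>ip f g\<bar>\<^sup>2 \<le> (l2norm f * l2norm g)\<^sup>2"
    by (simp add: power_mult_distrib l2norm_square)
  then show ?thesis by (rule power2_le_imp_le) simp
qed

lemma l2norm_triangle: assumes "L2 f" "L2 g"
  shows "l2norm (\<lambda>x. f x + g x) \<le> l2norm f + l2norm g"
proof -
  have "(l2norm (\<lambda>x. f x + g x))\<^sup>2 = ip f f + 2 * ip f g + ip g g"
    using assms by (simp add: l2norm_square ip_add_left ip_add_right L2_add ip_commute[of g f])
  also have "\<dots> \<le> (l2norm f + l2norm g)\<^sup>2"
    using ip_Cauchy_Schwarz[OF assms] unfolding power2_sum l2norm_square by linarith
  finally show ?thesis by (rule power2_le_imp_le) simp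
qed

lemma l2norm_mono_AE:
  assumes "g \<in> borel_measurable torus" "L2 f" "AE x in torus. norm (g x) \<le> norm (f x)"
  shows "l2norm g \<le> l2norm f"
  unfolding l2norm_def real_sqrt_le_iff
proof (rule integral_mono_AE)
  show "integrable torus (\<lambda>x. (norm (g x))\<^sup>2)" using L2_dominated[OF assms] by (simp add: L2_def)
  show "AE x in torus. (norm (g x))\<^sup>2 \<le> (norm (f x))\<^sup>2"
    using assms(3) by eventually_elim (simp add: power_mono)
qed (use assms in \<open>auto simp: L2_def\<close>)

lemma L2_bounded_mult:
  fixes f :: "real^3 \<Rightarrow> 'b::euclidean_space"
  assumes "L2 f" "h \<in> borel_measurable torus" "AE x in torus. \<bar>h x\<bar> \<le> M"
  shows "l2norm (\<lambda>x. h x *\<^sub>R f x) \<le> \<bar>M\<bar> * l2norm f"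
proof -
  have "l2norm (\<lambda>x. h x *\<^sub>R f x) \<le> l2norm (\<lambda>x. M *\<^sub>R f x)"
    using assms L2_measurable[OF assms(1)]
    by (intro l2norm_mono_AE L2_scaleR borel_measurable_scaleR) (auto intro!: mult_right_mono)
  then show ?thesis by (simp add: l2norm_scaleR)
qed

lemma l2norm_norm: "l2norm (\<lambda>x. norm (f x)) = l2norm f"
  by (simp add: l2norm_def)

lemma ip_fields:
  fixes f g :: "real^3 \<Rightarrow> real^'n"
  assumes "L2 f" "L2 g" shows "ip f g = (\<Sum>c\<in>UNIV. ip (\<lambda>x. f x $ c) (\<lambda>x. g x $ c))"
  unfolding ip_def inner_vec_def
  by (rule Bochner_Integration.integral_sum) (use L2_inner_integrable[OF L2_nth L2_nth] assms in auto)

section \<open>Trigonometric polynomials\<close>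

definition freq :: "int^3 \<Rightarrow> real^3 \<Rightarrow> real" where
  "freq k x = 2 * pi * (\<Sum>i\<in>UNIV. of_int (k $ i) * x $ i)"

definition fourier :: "int^3 \<Rightarrow> real^3 \<Rightarrow> complex" where
  "fourier k x = cis (freq k x)"

lemma trig_poly_freq: "trig_poly \<phi> \<longleftrightarrow> (\<exists>K a b. finite K \<and>
    \<phi> = (\<lambda>x. \<Sum>k\<in>K. cos (freq k x) *\<^sub>R a k + sin (freq k x) *\<^sub>R b k))"
  by (simp add: trig_poly_def freq_def)

lemma freq_add: "freq (k + l) x = freq k x + freq l x"
  by (simp add: freq_def sum.distrib algebra_simps)

lemma freq_minus: "freq (- k) x = - freq k x"
  by (simp add: freq_def sum_negf)

lemma freq_zero [simp]: "freq 0 x = 0"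
  by (simp add: freq_def)

lemma freq_axis: "freq (axis i 1) x = 2 * pi * x $ i"
  by (simp add: freq_def axis_def if_distrib[of real_of_int] mult_if_delta cong: if_cong)

lemma freq_bounded_linear: "bounded_linear (freq k)"
  unfolding freq_def
  by (intro bounded_linear_mult_right[THEN bounded_linear_compose] bounded_linear_sum)
     (auto intro!: bounded_linear_mult_right[THEN bounded_linear_compose] bounded_linear_vec_nth)

lemma freq_axis_dir: "freq k (axis i 1) = 2 * pi * of_int (k $ i)"
  by (simp add: freq_def axis_def if_distrib[of "\<lambda>a. _ * a"] sum.delta cong: if_cong)

lemma continuous_freq [continuous_intros]: "continuous_on S (freq k)"
  by (rule linear_continuous_on[OF freq_bounded_linear])

lemma fourier_add: "fourier (k + l) x = fourier k x * fourier l x"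
  by (simp add: fourier_def freq_add cis_mult)

lemma fourier_zero [simp]: "fourier 0 x = 1"
  by (simp add: fourier_def)

lemma fourier_cnj: "cnj (fourier k x) = fourier (- k) x"
  by (simp add: fourier_def freq_minus cis_cnj)

lemma norm_fourier [simp]: "norm (fourier k x) = 1"
  by (simp add: fourier_def)

lemma continuous_fourier [continuous_intros]: "continuous_on S (fourier k)"
  unfolding fourier_def by (intro continuous_intros continuous_on_cis)

lemma integral_cis_period:
  fixes n :: int
  shows "(LINT t|lborel. indicator {0..1} t *\<^sub>R cis (2 * pi * of_int n * t)) = (if n = 0 then 1 else 0)"
proof (cases "n = 0")
  case True then show ?thesis by simp
next
  case False
  define F where "F t = cis (2 * pi * of_int n * t) / (2 * pi * of_int n * \<i>)" for t :: real
  have "(LINT t|lborel. indicator {0..1} t *\<^sub>R cis (2 * pi * of_int n * t)) = F 1 - F 0"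
  proof (rule integral_FTC_atLeastAtMost)
    show "(F has_vector_derivative cis (2 * pi * of_int n * t)) (at t within {0..1})" for t
      unfolding F_def cis_conv_exp
      by (rule derivative_eq_intros has_vector_derivative_real_field | use False in simp)+
    show "continuous_on {0..1} (\<lambda>t. cis (2 * pi * of_int n * t))"
      by (intro continuous_intros)
  qed simp
  also have "\<dots> = 0"
    using cis_multiple_2pi[of "of_int n"] by (simp add: F_def mult.commute)
  finally show ?thesis using False by simp
qed

lemma cis_sum: "finite A \<Longrightarrow> (\<Prod>i\<in>A. cis (f i)) = cis (\<Sum>i\<in>A. f i)"
  by (induction A rule: finite_induct) (simp_all add: cis_mult)

text \<open>
  Lebesgue measure is a product measure and the exponential is a product of functions of one
  coordinate, so that the integral is a product of integrals over a period.
\<close>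

lemma integral_fourier: "(LINT x|torus. fourier k x) = (if k = 0 then 1 else 0)"
proof -
  define f :: "real^3 \<Rightarrow> real \<Rightarrow> complex" where
    "f b t = indicator {0..1} t *\<^sub>R cis (2 * pi * of_int (k $ axis_index b) * t)" for b t
  have "product_sigma_finite (\<lambda>_::real^3. lborel :: real measure)"
    by standard
  then interpret P: product_sigma_finite "\<lambda>_::real^3. lborel :: real measure" .
  have Basis: "(Basis :: (real^3) set) = (\<lambda>i. axis i 1) ` UNIV"
    by (auto simp: Basis_vec_def)
  have inj: "inj_on (\<lambda>i::3. axis i (1::real)) UNIV" by (auto simp: inj_on_def axis_eq_axis)
  have comp: "axis_index (axis i (1::real) :: real^3) = i" for i
    by (simp add: axis_index_axis)
  have fac: "indicator (cbox 0 1) x *\<^sub>R fourier k x = (\<Prod>b\<in>Basis. f b (x \<bullet> b))" for x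
  proof -
    have "(\<Prod>b\<in>Basis. f b (x \<bullet> b)) = (\<Prod>i\<in>UNIV. f (axis i 1) (x $ i))"
      unfolding Basis by (simp add: prod.reindex[OF inj] inner_axis)
    also have "\<dots> = (\<Prod>i\<in>UNIV. indicator {0..1} (x $ i) *\<^sub>R cis (2 * pi * of_int (k $ i) * (x $ i)))"
      unfolding f_def comp ..
    also have "\<dots> = indicator (cbox 0 1) x *\<^sub>R fourier k x"
    proof (cases "x \<in> cbox 0 1")
      case True
      then have "x $ i \<in> {0..1}" for i by (simp add: mem_box_cart)
      then have "(\<Prod>i\<in>UNIV. indicator {0..1} (x $ i) *\<^sub>R cis (2 * pi * of_int (k $ i) * (x $ i)))
          = (\<Prod>i\<in>UNIV. cis (2 * pi * of_int (k $ i) * (x $ i)))"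
        by simp
      also have "\<dots> = fourier k x"
        by (simp add: cis_sum fourier_def freq_def sum_distrib_left mult.assoc)
      finally show ?thesis using True by simp
    next
      case False
      then obtain i where "x $ i \<notin> {0..1}" by (auto simp: mem_box_cart)
      then have "(\<Prod>i\<in>UNIV. indicator {0..1} (x $ i) *\<^sub>R cis (2 * pi * of_int (k $ i) * (x $ i))) = 0"
        by (intro prod_zero bexI[of _ i]) simp_all
      then show ?thesis using False by simp
    qed
    finally show ?thesis ..
  qed
  have fm [measurable]: "f b \<in> borel_measurable borel" for b
  proof -
    have "(\<lambda>t. cis (2 * pi * of_int (k $ axis_index b) * t)) \<in> borel_measurable borel"
      by (intro borel_measurable_continuous_onI continuous_intros)
    then show ?thesis unfolding f_def by measurable
  qed
  have fi: "integrable lborel (f b)" for b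
    unfolding f_def by (intro borel_integrable_compact continuous_intros) simp
  have "(LINT x|torus. fourier k x) = (LINT x|lborel. indicator (cbox 0 1) x *\<^sub>R fourier k x)"
    unfolding torus_def by (rule integral_restrict_space) simp
  also have "\<dots> = (LINT x|lborel. (\<Prod>b\<in>Basis. f b (x \<bullet> b)))"
    by (simp add: fac)
  also have "\<dots> = (LINT g|(\<Pi>\<^sub>M b\<in>Basis. lborel). (\<Prod>b\<in>Basis. f b ((\<Sum>b\<in>Basis. g b *\<^sub>R b) \<bullet> b)))"
    unfolding lborel_eq[where 'a = "real^3"] by (subst integral_distr) simp_all
  also have "\<dots> = (LINT g|(\<Pi>\<^sub>M b\<in>Basis. lborel). (\<Prod>b\<in>Basis. f b (g b)))"
    by (intro Bochner_Integration.integral_cong prod.cong refl)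
       (simp add: inner_sum_left inner_Basis if_distrib sum.delta cong: if_cong)
  also have "\<dots> = (\<Prod>b\<in>Basis. (LINT t|lborel. f b t))"
    by (rule P.product_integral_prod) (auto intro: fi)
  also have "\<dots> = (\<Prod>i\<in>UNIV. (LINT t|lborel. f (axis i 1) t))"
    unfolding Basis by (simp add: prod.reindex[OF inj])
  also have "\<dots> = (\<Prod>i\<in>UNIV. if k $ i = 0 then 1 else 0)"
    by (rule prod.cong[OF refl]) (simp only: f_def comp integral_cis_period)
  also have "\<dots> = (if k = 0 then 1 else 0)"
    using prod_zero[of "UNIV :: 3 set" "\<lambda>i. if k $ i = 0 then 1 else (0 :: complex)"]
    by (auto simp: vec_eq_iff)
  finally show ?thesis .
qed

subsection \<open>Complex form\<close>

text \<open>Products are easier to handle for complex exponentials than for sines and cosines.\<close>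

definition ctrig :: "(real^3 \<Rightarrow> complex) \<Rightarrow> bool" where
  "ctrig f \<longleftrightarrow> (\<exists>K c. finite K \<and> f = (\<lambda>x. \<Sum>k\<in>K. c k * fourier k x))"

lemma ctrig_fourier: "ctrig (\<lambda>x. c * fourier k x)"
  unfolding ctrig_def by (intro exI[of _ "{k}"] exI[of _ "\<lambda>_. c"]) auto

lemma ctrig_add: assumes "ctrig f" "ctrig g" shows "ctrig (\<lambda>x. f x + g x)"
proof -
  obtain K c L d where K: "finite K" "f = (\<lambda>x. \<Sum>k\<in>K. c k * fourier k x)"
    and L: "finite L" "g = (\<lambda>x. \<Sum>k\<in>L. d k * fourier k x)"
    using assms unfolding ctrig_def by blast
  let ?c = "\<lambda>k. (if k \<in> K then c k else 0) + (if k \<in> L then d k else 0)"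
  have "f x + g x = (\<Sum>k\<in>K \<union> L. ?c k * fourier k x)" for x
  proof -
    have "f x = (\<Sum>k\<in>K \<union> L. (if k \<in> K then c k else 0) * fourier k x)"
      unfolding K(2) by (rule sum.mono_neutral_cong_left) (use K(1) L(1) in auto)
    moreover have "g x = (\<Sum>k\<in>K \<union> L. (if k \<in> L then d k else 0) * fourier k x)"
      unfolding L(2) by (rule sum.mono_neutral_cong_left) (use K(1) L(1) in auto)
    ultimately show ?thesis by (simp only: distrib_right sum.distrib)
  qed
  then have "finite (K \<union> L) \<and> (\<lambda>x. f x + g x) = (\<lambda>x. \<Sum>k\<in>K \<union> L. ?c k * fourier k x)"
    using K(1) L(1) by blast
  then show ?thesis
    unfolding ctrig_def by (intro exI)
qed

lemma ctrig_sum: "finite A \<Longrightarrow> (\<And>i. i \<in> A \<Longrightarrow> ctrig (f i)) \<Longrightarrow> ctrig (\<lambda>x. \<Sum>i\<in>A. f i x)"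
proof (induction A rule: finite_induct)
  case empty then show ?case using ctrig_fourier[of 0 0] by simp
next
  case (insert a F)
  have "ctrig (\<lambda>x. f a x + (\<Sum>i\<in>F. f i x))"
    by (rule ctrig_add) (use insert in blast)+
  then show ?case using insert(1,2) by simp
qed

lemma ctrig_mult: assumes "ctrig f" "ctrig g" shows "ctrig (\<lambda>x. f x * g x)"
proof -
  obtain K c L d where K: "finite K" "f = (\<lambda>x. \<Sum>k\<in>K. c k * fourier k x)"
    and L: "finite L" "g = (\<lambda>x. \<Sum>k\<in>L. d k * fourier k x)"
    using assms unfolding ctrig_def by blast
  have "f x * g x = (\<Sum>k\<in>K. \<Sum>l\<in>L. (c k * d l) * fourier (k + l) x)" for x
    by (simp add: K(2) L(2) sum_product fourier_add algebra_simps)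
  then show ?thesis
    by (simp only:) (intro ctrig_sum ctrig_fourier K L)
qed

lemma trig_poly_iff_ctrig: "trig_poly \<psi> \<longleftrightarrow> ctrig (\<lambda>x. complex_of_real (\<psi> x))"
proof
  assume "trig_poly \<psi>"
  then obtain K a b where K: "finite K"
    "\<psi> = (\<lambda>x. \<Sum>k\<in>K. cos (freq k x) *\<^sub>R a k + sin (freq k x) *\<^sub>R b k)"
    unfolding trig_poly_freq by blast
  have eq: "complex_of_real (cos (freq k x) *\<^sub>R a k + sin (freq k x) *\<^sub>R b k) =
      (of_real (a k) / 2 - \<i> * of_real (b k) / 2) * fourier k x +
      (of_real (a k) / 2 + \<i> * of_real (b k) / 2) * fourier (- k) x" for k x
    by (simp add: fourier_def freq_minus complex_eq_iff)
  have "ctrig (\<lambda>x. \<Sum>k\<in>K. (of_real (a k) / 2 - \<i> * of_real (b k) / 2) * fourier k x +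
      (of_real (a k) / 2 + \<i> * of_real (b k) / 2) * fourier (- k) x)"
    by (intro ctrig_sum ctrig_add ctrig_fourier K)
  then show "ctrig (\<lambda>x. complex_of_real (\<psi> x))"
    unfolding K(2) of_real_sum eq .
next
  assume "ctrig (\<lambda>x. complex_of_real (\<psi> x))"
  then obtain K c where K: "finite K"
    "(\<lambda>x. complex_of_real (\<psi> x)) = (\<lambda>x. \<Sum>k\<in>K. c k * fourier k x)"
    unfolding ctrig_def by blast
  have "\<psi> x = (\<Sum>k\<in>K. cos (freq k x) *\<^sub>R Re (c k) + sin (freq k x) *\<^sub>R (- Im (c k)))" for x
  proof -
    have "\<psi> x = Re (complex_of_real (\<psi> x))" by simp
    also have "\<dots> = Re (\<Sum>k\<in>K. c k * fourier k x)" by (simp only: fun_cong[OF K(2)])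
    also have "\<dots> = (\<Sum>k\<in>K. Re (c k * fourier k x))" by (rule Re_sum)
    also have "\<dots> = (\<Sum>k\<in>K. cos (freq k x) *\<^sub>R Re (c k) + sin (freq k x) *\<^sub>R (- Im (c k)))"
      by (rule sum.cong) (simp_all add: fourier_def mult.commute)
    finally show ?thesis .
  qed
  then have "finite K \<and>
      \<psi> = (\<lambda>x. \<Sum>k\<in>K. cos (freq k x) *\<^sub>R Re (c k) + sin (freq k x) *\<^sub>R (- Im (c k)))"
    using K(1) by blast
  then show "trig_poly \<psi>"
    unfolding trig_poly_freq by (intro exI)
qed

lemma trig_poly_mult: "trig_poly f \<Longrightarrow> trig_poly g \<Longrightarrow> trig_poly (\<lambda>x. f x * g x)" for f g :: "_ \<Rightarrow> real"
  unfolding trig_poly_iff_ctrig of_real_mult by (rule ctrig_mult)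

lemma trig_poly_const: "trig_poly (\<lambda>x. c)"
  unfolding trig_poly_freq
  by (rule exI[of _ "{0}"], rule exI[of _ "\<lambda>_. c"], rule exI[of _ "\<lambda>_. 0"]) simp

lemma trig_poly_add: assumes "trig_poly f" "trig_poly g" shows "trig_poly (\<lambda>x. f x + g x)"
proof -
  obtain K a b L c d where
    K: "finite K" "f = (\<lambda>x. \<Sum>k\<in>K. cos (freq k x) *\<^sub>R a k + sin (freq k x) *\<^sub>R b k)" and
    L: "finite L" "g = (\<lambda>x. \<Sum>k\<in>L. cos (freq k x) *\<^sub>R c k + sin (freq k x) *\<^sub>R d k)"
    using assms unfolding trig_poly_freq by blast
  let ?r = "\<lambda>A a k. if k \<in> A then a k else 0"
  have "f x + g x = (\<Sum>k\<in>K \<union> L. cos (freq k x) *\<^sub>R (?r K a k + ?r L c k)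
      + sin (freq k x) *\<^sub>R (?r K b k + ?r L d k))" for x
  proof -
    have "f x = (\<Sum>k\<in>K \<union> L. cos (freq k x) *\<^sub>R ?r K a k + sin (freq k x) *\<^sub>R ?r K b k)"
      unfolding K(2) by (rule sum.mono_neutral_cong_left) (use K(1) L(1) in auto)
    moreover have "g x = (\<Sum>k\<in>K \<union> L. cos (freq k x) *\<^sub>R ?r L c k + sin (freq k x) *\<^sub>R ?r L d k)"
      unfolding L(2) by (rule sum.mono_neutral_cong_left) (use K(1) L(1) in auto)
    ultimately show ?thesis by (simp only: scaleR_add_right sum.distrib add_ac)
  qed
  then show ?thesis
    unfolding trig_poly_freq using K(1) L(1)
    by (intro exI[of _ "K \<union> L"] exI[of _ "\<lambda>k. ?r K a k + ?r L c k"] exI[of _ "\<lambda>k. ?r K b k + ?r L d k"]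
        conjI ext finite_UnI)
qed

lemma trig_poly_linear:
  assumes "bounded_linear T" "trig_poly f" shows "trig_poly (\<lambda>x. T (f x))"
proof -
  obtain K a b where K: "finite K" "f = (\<lambda>x. \<Sum>k\<in>K. cos (freq k x) *\<^sub>R a k + sin (freq k x) *\<^sub>R b k)"
    using assms unfolding trig_poly_freq by blast
  have T: "linear T" using assms(1) by (rule bounded_linear.linear)
  show ?thesis
    unfolding trig_poly_freq using K
    by (intro exI[of _ K] exI[of _ "\<lambda>k. T (a k)"] exI[of _ "\<lambda>k. T (b k)"])
       (simp add: linear_sum[OF T] linear_add[OF T] linear_scale[OF T])
qed

lemma trig_poly_scaleR: "trig_poly f \<Longrightarrow> trig_poly (\<lambda>x. c *\<^sub>R f x)"
  by (rule trig_poly_linear[OF bounded_linear_scaleR_right])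

lemma trig_poly_sum:
  "finite A \<Longrightarrow> (\<And>i. i \<in> A \<Longrightarrow> trig_poly (f i)) \<Longrightarrow> trig_poly (\<lambda>x. \<Sum>i\<in>A. f i x)"
proof (induction A rule: finite_induct)
  case empty then show ?case using trig_poly_const[of 0] by simp
next
  case (insert a F)
  have "trig_poly (\<lambda>x. f a x + (\<Sum>i\<in>F. f i x))"
    by (rule trig_poly_add) (use insert in blast)+
  then show ?case using insert(1,2) by simp
qed

lemma trig_poly_nth: "trig_poly f \<Longrightarrow> trig_poly (\<lambda>x. f x $ c)" for f :: "_ \<Rightarrow> real^'n"
  by (rule trig_poly_linear[OF bounded_linear_vec_nth])

lemma trig_poly_cos: "trig_poly (\<lambda>x. cos (freq k x))"
  unfolding trig_poly_freq
  by (intro exI[of _ "{k}"] exI[of _ "\<lambda>_. 1"] exI[of _ "\<lambda>_. 0"]) auto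

lemma trig_poly_sin: "trig_poly (\<lambda>x. sin (freq k x))"
  unfolding trig_poly_freq
  by (intro exI[of _ "{k}"] exI[of _ "\<lambda>_. 0"] exI[of _ "\<lambda>_. 1"]) auto

subsection \<open>Derivatives\<close>

lemma trig_poly_has_derivative:
  fixes a b :: "int^3 \<Rightarrow> 'b::euclidean_space"
  shows "((\<lambda>x. \<Sum>k\<in>K. cos (freq k x) *\<^sub>R a k + sin (freq k x) *\<^sub>R b k) has_derivative
    (\<lambda>h. \<Sum>k\<in>K. (- sin (freq k x) * freq k h) *\<^sub>R a k + (cos (freq k x) * freq k h) *\<^sub>R b k)) (at x)"
proof -
  have fr: "(freq k has_derivative freq k) (at x)" for k
    by (rule bounded_linear_imp_has_derivative[OF freq_bounded_linear])
  show ?thesis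
    by (intro has_derivative_sum has_derivative_add has_derivative_scaleR_left)
       (auto intro!: derivative_eq_intros fr simp: fun_eq_iff)
qed

lemma partial_trig:
  fixes a b :: "int^3 \<Rightarrow> 'b::euclidean_space"
  shows "partial i (\<lambda>x. \<Sum>k\<in>K. cos (freq k x) *\<^sub>R a k + sin (freq k x) *\<^sub>R b k) =
    (\<lambda>x. \<Sum>k\<in>K. cos (freq k x) *\<^sub>R ((2 * pi * of_int (k $ i)) *\<^sub>R b k)
       + sin (freq k x) *\<^sub>R (- (2 * pi * of_int (k $ i)) *\<^sub>R a k))"
proof
  fix x
  have "frechet_derivative (\<lambda>x. \<Sum>k\<in>K. cos (freq k x) *\<^sub>R a k + sin (freq k x) *\<^sub>R b k) (at x) =
    (\<lambda>h. \<Sum>k\<in>K. (- sin (freq k x) * freq k h) *\<^sub>R a k + (cos (freq k x) * freq k h) *\<^sub>R b k)"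
    by (rule frechet_derivative_at[symmetric, OF trig_poly_has_derivative])
  then show "partial i (\<lambda>x. \<Sum>k\<in>K. cos (freq k x) *\<^sub>R a k + sin (freq k x) *\<^sub>R b k) x =
    (\<Sum>k\<in>K. cos (freq k x) *\<^sub>R ((2 * pi * of_int (k $ i)) *\<^sub>R b k)
       + sin (freq k x) *\<^sub>R (- (2 * pi * of_int (k $ i)) *\<^sub>R a k))"
    unfolding partial_def by (simp add: freq_axis_dir)
qed

lemma trig_poly_differentiable: "trig_poly f \<Longrightarrow> f differentiable (at x)"
  unfolding trig_poly_freq differentiable_def
  by (elim exE conjE, hypsubst, rule exI, rule trig_poly_has_derivative)

lemma trig_poly_continuous: assumes "trig_poly f" shows "continuous_on UNIV f"
  by (intro continuous_at_imp_continuous_on ballI differentiable_imp_continuous_within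
      trig_poly_differentiable assms)

lemma trig_poly_L2: "trig_poly f \<Longrightarrow> L2 f"
  by (rule L2_continuous[OF trig_poly_continuous])

lemma trig_poly_partial: assumes "trig_poly f" shows "trig_poly (partial i f)"
proof -
  obtain K a b where K: "finite K" "f = (\<lambda>x. \<Sum>k\<in>K. cos (freq k x) *\<^sub>R a k + sin (freq k x) *\<^sub>R b k)"
    using assms unfolding trig_poly_freq by blast
  show ?thesis
    unfolding K(2) partial_trig trig_poly_freq
    by (rule exI, rule exI, rule exI, rule conjI[OF K(1) refl])
qed

lemma trig_poly_frechet: "trig_poly f \<Longrightarrow> (f has_derivative frechet_derivative f (at x)) (at x)"
  using trig_poly_differentiable frechet_derivative_works by blast

lemma partial_eqI: "(f has_derivative D) (at x) \<Longrightarrow> partial i f x = D (axis i 1)"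
  unfolding partial_def by (simp flip: frechet_derivative_at)

lemma partial_add: assumes "trig_poly f" "trig_poly g"
  shows "partial i (\<lambda>x. f x + g x) x = partial i f x + partial i g x"
  by (subst partial_eqI[OF has_derivative_add[OF assms[THEN trig_poly_frechet]]])
     (simp add: partial_def)

lemma partial_linear: assumes "bounded_linear T" "trig_poly f"
  shows "partial i (\<lambda>x. T (f x)) x = T (partial i f x)"
  by (subst partial_eqI[OF bounded_linear.has_derivative[OF assms(1) trig_poly_frechet[OF assms(2)]]])
     (simp add: partial_def)

lemma partial_nth: "trig_poly f \<Longrightarrow> partial i (\<lambda>x. f x $ c) x = partial i f x $ c" for f :: "_ \<Rightarrow> real^'n"
  by (rule partial_linear[OF bounded_linear_vec_nth])

lemma partial_scaleR: "trig_poly f \<Longrightarrow> partial i (\<lambda>x. r *\<^sub>R f x) x = r *\<^sub>R partial i f x"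
  by (rule partial_linear[OF bounded_linear_scaleR_right])

lemma partial_const: "partial i (\<lambda>x. c) x = 0"
  by (subst partial_eqI[OF has_derivative_const]) simp

lemma partial_sum:
  "finite A \<Longrightarrow> (\<And>i. i \<in> A \<Longrightarrow> trig_poly (f i)) \<Longrightarrow>
    partial j (\<lambda>x. \<Sum>i\<in>A. f i x) x = (\<Sum>i\<in>A. partial j (f i) x)"
proof (induction A rule: finite_induct)
  case empty then show ?case by (simp add: partial_const)
next
  case (insert a A)
  have "partial j (\<lambda>x. f a x + (\<Sum>i\<in>A. f i x)) x = partial j (f a) x + partial j (\<lambda>x. \<Sum>i\<in>A. f i x) x"
    by (rule partial_add, use insert in blast, rule trig_poly_sum) (use insert in blast)+
  then show ?case using insert by simp
qed

lemma partial_mult: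
  fixes f g :: "_ \<Rightarrow> real"
  assumes "trig_poly f" "trig_poly g"
  shows "partial i (\<lambda>x. f x * g x) x = partial i f x * g x + f x * partial i g x"
  by (subst partial_eqI[OF has_derivative_mult[OF assms[THEN trig_poly_frechet]]])
     (simp add: partial_def)

lemma partial_commute: assumes "trig_poly f" shows "partial i (partial j f) = partial j (partial i f)"
proof -
  obtain K a b where K: "finite K" "f = (\<lambda>x. \<Sum>k\<in>K. cos (freq k x) *\<^sub>R a k + sin (freq k x) *\<^sub>R b k)"
    using assms unfolding trig_poly_freq by blast
  show ?thesis
    unfolding K(2) partial_trig by (intro ext sum.cong refl) (simp add: mult.commute)
qed

text \<open>
  The derivative has no constant term, and the other terms integrate to zero.
\<close>

lemma integral_partial_zero: assumes "trig_poly f" shows "(LINT x|torus. partial i f x) = 0"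
proof -
  obtain K a b where K: "finite K" "f = (\<lambda>x. \<Sum>k\<in>K. cos (freq k x) *\<^sub>R a k + sin (freq k x) *\<^sub>R b k)"
    using assms unfolding trig_poly_freq by blast
  have I: "integrable torus (\<lambda>x. cos (freq k x))" "integrable torus (\<lambda>x. sin (freq k x))"
    "integrable torus (\<lambda>x. fourier k x)" for k
    by (intro continuous_integrable_torus continuous_intros)+
  have *: "(LINT x|torus. cos (freq k x)) = (if k = 0 then 1 else 0)"
    "(LINT x|torus. sin (freq k x)) = 0" for k
    using arg_cong[OF integral_fourier[of k], of Re] arg_cong[OF integral_fourier[of k], of Im]
    unfolding integral_Re[OF I(3), symmetric] integral_Im[OF I(3), symmetric]
    by (simp_all add: fourier_def)
  show ?thesis
    unfolding K(2) partial_trig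
    by (subst Bochner_Integration.integral_sum)
       (auto simp: I * integrable_scaleR_left intro!: sum.neutral)
qed

section \<open>Density of the trigonometric polynomials\<close>

definition torus_embed :: "real^3 \<Rightarrow> complex^3" where
  "torus_embed x = (\<chi> i. cis (2 * pi * x $ i))"

lemma trig_poly_polynomial_embed:
  assumes "real_polynomial_function p" shows "trig_poly (\<lambda>x. p (torus_embed x))"
  using assms
proof (induction p rule: real_polynomial_function.induct)
  case (linear f)
  have coord: "trig_poly (\<lambda>x. torus_embed x \<bullet> b)" if b: "b \<in> Basis" for b
  proof -
    obtain i u where b': "b = axis i u" "u \<in> Basis" using b by (auto simp: Basis_vec_def)
    then consider "b = axis i 1" | "b = axis i \<i>" by (auto simp: Basis_complex_def)
    then show ?thesis
    proof cases
      case 1 then show ?thesis using trig_poly_cos[of "axis i 1"]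
        by (simp add: torus_embed_def inner_axis freq_axis)
    next
      case 2 then show ?thesis using trig_poly_sin[of "axis i 1"]
        by (simp add: torus_embed_def inner_axis freq_axis inner_complex_def)
    qed
  qed
  have f: "linear f" using linear by (rule bounded_linear.linear)
  have "f (torus_embed x) = (\<Sum>b\<in>Basis. f b *\<^sub>R (torus_embed x \<bullet> b))" for x
  proof -
    have "f (torus_embed x) = f (\<Sum>b\<in>Basis. (torus_embed x \<bullet> b) *\<^sub>R b)"
      by (simp add: euclidean_representation)
    also have "\<dots> = (\<Sum>b\<in>Basis. f b *\<^sub>R (torus_embed x \<bullet> b))"
      by (simp add: linear_sum[OF f] linear_scale[OF f] mult.commute)
    finally show ?thesis .
  qed
  then show ?case by (simp only:) (intro trig_poly_sum trig_poly_scaleR coord finite_Basis)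
next
  case (const c) show ?case by (rule trig_poly_const)
next
  case (add f g) then show ?case by (intro trig_poly_add)
next
  case (mult f g) then show ?case by (intro trig_poly_mult)
qed

lemma torus_embed_eq:
  assumes x: "x \<in> cbox 0 1" and y: "y \<in> cbox 0 1" and eq: "torus_embed x = torus_embed y" and "x \<noteq> y"
  shows "\<exists>i. x $ i \<in> {0, 1}"
proof -
  obtain i where i: "x $ i \<noteq> y $ i" using \<open>x \<noteq> y\<close> by (auto simp: vec_eq_iff)
  have "cis (2 * pi * x $ i) = cis (2 * pi * y $ i)"
    using arg_cong[OF eq, of "\<lambda>v. v $ i"] by (simp add: torus_embed_def)
  then have "sin (2 * pi * x $ i) = sin (2 * pi * y $ i) \<and> cos (2 * pi * x $ i) = cos (2 * pi * y $ i)"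
    by (simp add: complex_eq_iff)
  then obtain n :: int where "2 * pi * x $ i = 2 * pi * y $ i + 2 * pi * n"
    using sin_cos_eq_iff by blast
  then have "2 * pi * (x $ i) = 2 * pi * (y $ i + n)" by (simp add: distrib_left)
  then have n: "x $ i = y $ i + n" by simp
  then have "n \<noteq> 0" using i by auto
  then have "n \<ge> 1 \<or> n \<le> -1" by linarith
  then have "real_of_int n \<ge> 1 \<or> real_of_int n \<le> -1" by linarith
  moreover have "0 \<le> x $ i" "x $ i \<le> 1" "0 \<le> y $ i" "y $ i \<le> 1" using x y by (auto simp: mem_box_cart)
  ultimately have "x $ i = 0 \<or> x $ i = 1" using n by linarith
  then show ?thesis by blast
qed

text \<open>
  A continuous function that vanishes on the boundary of the cube descends to the torus, embedded
  in \<open>\<complex>\<^sup>3\<close>, where the theorem of Stone and Weierstrass applies.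
\<close>

lemma trig_poly_uniformly_dense:
  fixes g :: "real^3 \<Rightarrow> real"
  assumes g: "continuous_on (cbox 0 1) g" and e: "0 < e"
    and boundary: "\<And>x i. x \<in> cbox 0 1 \<Longrightarrow> x $ i \<in> {0, 1} \<Longrightarrow> g x = 0"
  shows "\<exists>\<psi>. trig_poly \<psi> \<and> (\<forall>x\<in>cbox 0 1. \<bar>g x - \<psi> x\<bar> < e)"
proof -
  let ?Q = "cbox 0 1 :: (real^3) set"
  define F where "F z = g (SOME x. x \<in> ?Q \<and> torus_embed x = z)" for z
  have F: "F (torus_embed x) = g x" if x: "x \<in> ?Q" for x
  proof -
    define y where "y = (SOME y. y \<in> ?Q \<and> torus_embed y = torus_embed x)"
    have y: "y \<in> ?Q \<and> torus_embed y = torus_embed x"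
      unfolding y_def by (rule someI[of _ x]) (use x in simp)
    have "g y = g x"
    proof (cases "x = y")
      case False
      have "g x = 0" using torus_embed_eq[of x y] False x y boundary by metis
      moreover have "g y = 0" using torus_embed_eq[of y x] False x y boundary by metis
      ultimately show ?thesis by simp
    qed simp
    then show ?thesis by (simp add: F_def y_def)
  qed
  have E: "continuous_on S torus_embed" for S
    unfolding torus_embed_def
  proof (intro continuous_on_vec_lambda)
    show "continuous_on S (\<lambda>x. cis (2 * pi * x $ i))" for i
      by (intro continuous_intros)
  qed
  have comp: "compact (torus_embed ` ?Q)"
    by (intro compact_continuous_image E compact_cbox)
  have "continuous_on (torus_embed ` ?Q) F"
    unfolding continuous_on_closed_vimage[OF compact_imp_closed[OF comp]]
  proof (intro allI impI)
    fix B :: "real set" assume B: "closed B"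
    have "closed (?Q \<inter> g -` B)"
      by (rule continuous_closed_preimage[OF g closed_cbox B])
    then have "compact (?Q \<inter> (?Q \<inter> g -` B))"
      by (intro compact_Int_closed compact_cbox)
    then have "compact (torus_embed ` (?Q \<inter> (?Q \<inter> g -` B)))"
      by (intro compact_continuous_image E)
    moreover have "torus_embed ` (?Q \<inter> (?Q \<inter> g -` B)) = F -` B \<inter> torus_embed ` ?Q"
      using F by auto
    ultimately show "closed (F -` B \<inter> torus_embed ` ?Q)" by (metis compact_imp_closed)
  qed
  then obtain p where p: "real_polynomial_function p" "\<And>z. z \<in> torus_embed ` ?Q \<Longrightarrow> \<bar>F z - p z\<bar> < e"
    using Stone_Weierstrass_real_polynomial_function[OF comp _ e] by blast
  show ?thesis
    using trig_poly_polynomial_embed[OF p(1)] p(2)[OF imageI] F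
    by (intro exI[of _ "\<lambda>x. p (torus_embed x)"]) auto
qed

lemma AE_torus: "(AE x in torus. P x) \<longleftrightarrow> (AE x in lborel. x \<in> cbox 0 1 \<longrightarrow> P x)"
  unfolding torus_def by (rule AE_restrict_space_iff) simp

lemma AE_torus_negligible:
  assumes "negligible N" "\<And>x. x \<in> cbox 0 1 \<Longrightarrow> x \<notin> N \<Longrightarrow> P x" shows "AE x in torus. P x"
proof -
  have "AE x in lebesgue. x \<notin> N"
    using assms(1) AE_not_in negligible_iff_null_sets by blast
  then have "AE x in lborel. x \<notin> N" by (simp add: AE_completion_iff)
  then show ?thesis unfolding AE_torus by eventually_elim (use assms(2) in auto)
qed

text \<open>
  A measurable function is almost everywhere a limit of continuous functions \<open>g n\<close>. Truncation to
  \<open>[-M, M]\<close> and multiplication with a cutoff that vanishes on the boundary of the cube, and increases to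
  one inside, makes them accessible to uniform approximation. The bound \<open>M + 1\<close> allows for the error.
\<close>

lemma trig_poly_dense_AE:
  fixes h :: "real^3 \<Rightarrow> real"
  assumes h: "h \<in> borel_measurable torus" and M: "\<And>x. x \<in> cbox 0 1 \<Longrightarrow> \<bar>h x\<bar> \<le> M" "0 \<le> M"
  obtains \<psi> where "\<And>n::nat. trig_poly (\<psi> n)" "\<And>n x. x \<in> cbox 0 1 \<Longrightarrow> \<bar>\<psi> n x\<bar> \<le> M + 1"
    "AE x in torus. (\<lambda>n. \<psi> n x) \<longlonglongrightarrow> h x"
proof -
  let ?Q = "cbox 0 1 :: (real^3) set"
  have "(\<lambda>x. if x \<in> ?Q then h x else 0) \<in> borel_measurable lborel"
    using h unfolding torus_def by (subst (asm) measurable_restrict_space_iff[where c = 0]) simp_all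
  then have "(\<lambda>x. if x \<in> ?Q then h x else 0) \<in> borel_measurable lebesgue"
    by (rule measurable_completion)
  then have "(\<lambda>x. if x \<in> ?Q then h x else 0) measurable_on UNIV"
    by (intro lebesgue_measurable_imp_measurable_on_real) auto
  then obtain N g where N: "negligible N" and g: "\<And>n. continuous_on UNIV (g n)"
    and lim: "\<And>x. x \<notin> N \<Longrightarrow> (\<lambda>n. g n x) \<longlonglongrightarrow> (if x \<in> ?Q then h x else 0)"
    unfolding measurable_on_def by auto
  define cut :: "nat \<Rightarrow> real^3 \<Rightarrow> real" where
    "cut n x = (\<Prod>i\<in>UNIV. min 1 (real n * min (x $ i) (1 - x $ i)))" for n x
  define k where "k n x = cut n x * max (- M) (min M (g n x))" for n x
  have cut_range: "0 \<le> cut n x \<and> cut n x \<le> 1" if "x \<in> ?Q" for n x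
    unfolding cut_def using that by (intro conjI prod_nonneg prod_le_1) (auto simp: mem_box_cart)
  have k_bound: "\<bar>k n x\<bar> \<le> M" if "x \<in> ?Q" for n x
  proof -
    have "\<bar>max (- M) (min M (g n x))\<bar> \<le> M" using M(2) by auto
    then have "\<bar>cut n x\<bar> * \<bar>max (- M) (min M (g n x))\<bar> \<le> 1 * M"
      using cut_range[OF that, of n] by (intro mult_mono) auto
    then show ?thesis by (simp add: k_def abs_mult)
  qed
  have "\<exists>\<psi>. trig_poly \<psi> \<and> (\<forall>x\<in>?Q. \<bar>k n x - \<psi> x\<bar> < 1 / Suc n)" for n
  proof (rule trig_poly_uniformly_dense)
    have "continuous_on UNIV (k n)"
      unfolding k_def cut_def by (intro continuous_intros g)
    then show "continuous_on ?Q (k n)" by (rule continuous_on_subset) simp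
    show "k n x = 0" if "x \<in> ?Q" "x $ i \<in> {0, 1}" for x i
    proof -
      have "cut n x = 0"
        unfolding cut_def by (rule prod_zero) (use that in \<open>auto intro!: exI[of _ i]\<close>)
      then show ?thesis by (simp add: k_def)
    qed
  qed simp
  then obtain \<psi> where \<psi>: "\<And>n. trig_poly (\<psi> n)" "\<And>n x. x \<in> ?Q \<Longrightarrow> \<bar>k n x - \<psi> n x\<bar> < 1 / Suc n"
    by metis
  show ?thesis
  proof
    show "trig_poly (\<psi> n)" for n by (rule \<psi>(1))
    show "\<bar>\<psi> n x\<bar> \<le> M + 1" if "x \<in> ?Q" for n x
    proof -
      have "1 / real (Suc n) \<le> 1" by simp
      then show ?thesis using \<psi>(2)[OF that, of n] k_bound[OF that, of n] by linarith
    qed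
    have "negligible (?Q - box 0 1)"
      by (rule negligible_frontier_interval)
    then have "negligible (N \<union> (?Q - box 0 1))" using N by (rule negligible_Un[rotated])
    then show "AE x in torus. (\<lambda>n. \<psi> n x) \<longlonglongrightarrow> h x"
    proof (rule AE_torus_negligible)
      fix x assume x: "x \<in> ?Q" "x \<notin> N \<union> (?Q - box 0 1)"
      then have int: "0 < x $ i \<and> x $ i < 1" for i by (auto simp: mem_box_cart)
      have "(\<lambda>n. cut n x) \<longlonglongrightarrow> (\<Prod>i\<in>(UNIV :: 3 set). 1)"
        unfolding cut_def
      proof (rule tendsto_prod)
        fix i :: 3
        have "0 < min (x $ i) (1 - x $ i)" using int[of i] by simp
        then obtain n0 :: nat where n0: "1 < real n0 * min (x $ i) (1 - x $ i)"
          using reals_Archimedean3 by blast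
        have "min 1 (real n * min (x $ i) (1 - x $ i)) = 1" if "n \<ge> n0" for n
        proof -
          have "real n0 * min (x $ i) (1 - x $ i) \<le> real n * min (x $ i) (1 - x $ i)"
            using that int[of i] by (intro mult_right_mono) auto
          then show ?thesis using n0 by linarith
        qed
        then have "eventually (\<lambda>n. min 1 (real n * min (x $ i) (1 - x $ i)) = 1) sequentially"
          using eventually_sequentially by blast
        then show "(\<lambda>n. min 1 (real n * min (x $ i) (1 - x $ i))) \<longlonglongrightarrow> 1"
          by (rule tendsto_eventually)
      qed
      moreover have "(\<lambda>n. max (- M) (min M (g n x))) \<longlonglongrightarrow> max (- M) (min M (h x))"
        using lim[of x] x by (intro tendsto_intros) auto
      ultimately have "(\<lambda>n. k n x) \<longlonglongrightarrow> (\<Prod>i\<in>(UNIV :: 3 set). 1) * max (- M) (min M (h x))"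
        unfolding k_def by (rule tendsto_mult)
      moreover have "max (- M) (min M (h x)) = h x" using M(1)[OF x(1)] by auto
      ultimately have "(\<lambda>n. k n x) \<longlonglongrightarrow> h x" by simp
      moreover have "(\<lambda>n. k n x - \<psi> n x) \<longlonglongrightarrow> 0"
      proof (rule Lim_null_comparison)
        show "\<forall>\<^sub>F n in sequentially. norm (k n x - \<psi> n x) \<le> 1 / real (Suc n)"
          using \<psi>(2)[OF x(1)] by (intro always_eventually) (auto intro: less_imp_le)
        show "(\<lambda>n. 1 / real (Suc n)) \<longlonglongrightarrow> 0"
          using LIMSEQ_inverse_real_of_nat by (simp add: inverse_eq_divide)
      qed
      ultimately have "(\<lambda>n. k n x - (k n x - \<psi> n x)) \<longlonglongrightarrow> h x - 0" by (rule tendsto_diff)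
      then show "(\<lambda>n. \<psi> n x) \<longlonglongrightarrow> h x" by simp
    qed
  qed
qed

lemma trig_poly_integral_approx:
  fixes h f :: "real^3 \<Rightarrow> real"
  assumes f: "integrable torus f" and M: "0 \<le> M"
    and \<psi>: "\<And>n::nat. trig_poly (\<psi> n)" "\<And>n x. x \<in> cbox 0 1 \<Longrightarrow> \<bar>\<psi> n x\<bar> \<le> M"
    "AE x in torus. (\<lambda>n. \<psi> n x) \<longlonglongrightarrow> h x" and h: "h \<in> borel_measurable torus"
  shows "(\<lambda>n. LINT x|torus. \<psi> n x * f x) \<longlonglongrightarrow> (LINT x|torus. h x * f x)"
proof (rule integral_dominated_convergence[where w = "\<lambda>x. M * \<bar>f x\<bar>"])
  show "AE x in torus. (\<lambda>n. \<psi> n x * f x) \<longlonglongrightarrow> h x * f x"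
    using \<psi>(3) by eventually_elim (intro tendsto_intros)
  show "AE x in torus. norm (\<psi> n x * f x) \<le> M * \<bar>f x\<bar>" for n
    by (rule AE_I2) (use \<psi>(2) in \<open>auto simp: abs_mult intro!: mult_right_mono\<close>)
  show "(\<lambda>x. \<psi> n x * f x) \<in> borel_measurable torus" for n
    using f continuous_measurable_torus[OF trig_poly_continuous[OF \<psi>(1)]] by measurable
qed (use f h in auto)

text \<open>Testing with polynomials that approximate the sign of \<open>f\<close> gives \<open>\<integral> \<bar>f\<bar> = 0\<close>.\<close>

lemma trig_orthogonal_real:
  fixes f :: "real^3 \<Rightarrow> real"
  assumes f: "integrable torus f" and orth: "\<And>\<psi>. trig_poly \<psi> \<Longrightarrow> (LINT x|torus. \<psi> x * f x) = 0"
  shows "AE x in torus. f x = 0"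
proof -
  have sm: "(\<lambda>x. sgn (f x)) \<in> borel_measurable torus" using f by simp
  have s1: "\<bar>sgn (f x)\<bar> \<le> 1" for x by (simp add: sgn_if)
  obtain \<psi> :: "nat \<Rightarrow> real^3 \<Rightarrow> real" where \<psi>: "\<And>n. trig_poly (\<psi> n)"
    "\<And>n x. x \<in> cbox 0 1 \<Longrightarrow> \<bar>\<psi> n x\<bar> \<le> 1 + 1" "AE x in torus. (\<lambda>n. \<psi> n x) \<longlonglongrightarrow> sgn (f x)"
    using trig_poly_dense_AE[OF sm s1 zero_le_one] by blast
  have "(\<lambda>n. LINT x|torus. \<psi> n x * f x) \<longlonglongrightarrow> (LINT x|torus. sgn (f x) * f x)"
    by (rule trig_poly_integral_approx[OF f _ \<psi> sm]) simp
  then have "(LINT x|torus. sgn (f x) * f x) = 0"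
    by (simp add: orth[OF \<psi>(1)] LIMSEQ_const_iff)
  then have "(LINT x|torus. \<bar>f x\<bar>) = 0" by (simp add: abs_sgn mult.commute)
  then show ?thesis using f by (subst (asm) integral_nonneg_eq_0_iff_AE) auto
qed

lemma trig_orthogonal:
  fixes f :: "real^3 \<Rightarrow> 'b::euclidean_space"
  assumes f: "L2 f" and orth: "\<And>\<psi>. trig_poly \<psi> \<Longrightarrow> (LINT x|torus. \<psi> x *\<^sub>R f x) = 0"
  shows "AE x in torus. f x = 0"
proof -
  have "AE x in torus. \<forall>b\<in>Basis. f x \<bullet> b = 0"
  proof (rule AE_finite_allI[OF finite_Basis])
    fix b :: 'b assume b: "b \<in> Basis"
    show "AE x in torus. f x \<bullet> b = 0"
    proof (rule trig_orthogonal_real)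
      show "integrable torus (\<lambda>x. f x \<bullet> b)" using L2_integrable[OF f] by simp
      fix \<psi> :: "real^3 \<Rightarrow> real" assume \<psi>: "trig_poly \<psi>"
      have "(LINT x|torus. \<psi> x * (f x \<bullet> b)) = (LINT x|torus. (\<psi> x *\<^sub>R f x) \<bullet> b)" by simp
      also have "\<dots> = (LINT x|torus. \<psi> x *\<^sub>R f x) \<bullet> b"
        using L2_scaleR_integrable[OF trig_poly_L2[OF \<psi>] f] by (rule integral_inner_left)
      finally show "(LINT x|torus. \<psi> x * (f x \<bullet> b)) = 0" by (simp add: orth[OF \<psi>])
    qed
  qed
  then show ?thesis by eventually_elim (simp add: euclidean_all_zero_iff)
qed

text \<open>
  The duality of \<open>L\<^sup>1\<close> and \<open>L\<^sup>\<infinity>\<close>, tested with polynomials. In the limit the inequality holds for the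
  sign of \<open>g\<close> on the set where \<open>\<bar>g\<bar> > C\<close>, which must then be a null set.
\<close>

lemma bounded_AE_by_duality:
  fixes g :: "real^3 \<Rightarrow> real"
  assumes g: "integrable torus g" and C: "0 \<le> C"
    and le: "\<And>\<psi>. trig_poly \<psi> \<Longrightarrow> \<bar>LINT x|torus. \<psi> x * g x\<bar> \<le> C * (LINT x|torus. \<bar>\<psi> x\<bar>)"
  shows "AE x in torus. \<bar>g x\<bar> \<le> C"
proof -
  define h where "h x = (if \<bar>g x\<bar> > C then sgn (g x) else 0)" for x
  have hm: "h \<in> borel_measurable torus" using g unfolding h_def by measurable
  have h1: "\<bar>h x\<bar> \<le> 1" for x by (simp add: h_def sgn_if)
  obtain \<psi> :: "nat \<Rightarrow> real^3 \<Rightarrow> real" where \<psi>: "\<And>n. trig_poly (\<psi> n)"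
    "\<And>n x. x \<in> cbox 0 1 \<Longrightarrow> \<bar>\<psi> n x\<bar> \<le> 1 + 1" "AE x in torus. (\<lambda>n. \<psi> n x) \<longlonglongrightarrow> h x"
    by (rule trig_poly_dense_AE[OF hm h1]) auto
  have l1: "(\<lambda>n. LINT x|torus. \<psi> n x * g x) \<longlonglongrightarrow> (LINT x|torus. h x * g x)"
    by (rule trig_poly_integral_approx[OF g _ \<psi> hm]) simp
  have l2: "(\<lambda>n. LINT x|torus. \<bar>\<psi> n x\<bar>) \<longlonglongrightarrow> (LINT x|torus. \<bar>h x\<bar>)"
  proof (rule integral_dominated_convergence[where w = "\<lambda>x. 2"])
    show "AE x in torus. (\<lambda>n. \<bar>\<psi> n x\<bar>) \<longlonglongrightarrow> \<bar>h x\<bar>"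
      using \<psi>(3) by eventually_elim (intro tendsto_intros)
    show "(\<lambda>x. \<bar>\<psi> n x\<bar>) \<in> borel_measurable torus" for n
      using continuous_measurable_torus[OF trig_poly_continuous[OF \<psi>(1)]] by measurable
  qed (use hm \<psi>(2) in auto)
  have int_h: "integrable torus h"
    by (rule bounded_integrable_torus[OF hm, of 1]) (use h1 in auto)
  have int_hg: "integrable torus (\<lambda>x. h x * g x)"
    by (rule Bochner_Integration.integrable_bound[OF g])
       (use hm g h1 in \<open>auto simp: abs_mult intro!: mult_left_le_one_le\<close>)
  have "\<bar>LINT x|torus. h x * g x\<bar> \<le> C * (LINT x|torus. \<bar>h x\<bar>)"
    by (rule LIMSEQ_le[OF tendsto_rabs[OF l1] tendsto_mult_left[OF l2]]) (use le \<psi>(1) in auto)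
  then have "(LINT x|torus. h x * g x - C * \<bar>h x\<bar>) \<le> 0"
    using int_h int_hg by simp
  moreover have pos: "0 \<le> h x * g x - C * \<bar>h x\<bar>" for x by (auto simp: h_def sgn_if)
  ultimately have "(LINT x|torus. h x * g x - C * \<bar>h x\<bar>) = 0"
    by (intro antisym integral_nonneg_AE) auto
  then have "AE x in torus. h x * g x - C * \<bar>h x\<bar> = 0"
    using int_h int_hg pos by (subst (asm) integral_nonneg_eq_0_iff_AE) auto
  then show ?thesis using C
    by (elim eventually_mono) (auto simp: h_def sgn_if split: if_splits)
qed

section \<open>Weak derivatives and Sobolev norms\<close>

lemma weak_partial_cong_AE:
  assumes "weak_partial i f g" "AE x in torus. f x = f' x" "AE x in torus. g x = g' x"
    "L2 f" "f' \<in> borel_measurable torus" "L2 g" "g' \<in> borel_measurable torus"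
  shows "weak_partial i f' g'"
  unfolding weak_partial_def
proof (intro allI impI)
  fix \<psi> :: "real^3 \<Rightarrow> real" assume \<psi>: "trig_poly \<psi>"
  note m = L2_measurable[OF trig_poly_L2[OF \<psi>]] L2_measurable[OF trig_poly_L2[OF trig_poly_partial[OF \<psi>]]]
    L2_measurable[OF assms(4)] L2_measurable[OF assms(6)]
  have "(LINT x|torus. partial i \<psi> x *\<^sub>R f x) = (LINT x|torus. partial i \<psi> x *\<^sub>R f' x)"
    by (rule integral_cong_AE) (use assms(2,5) m in \<open>auto intro!: borel_measurable_scaleR\<close>)
  moreover have "(LINT x|torus. \<psi> x *\<^sub>R g x) = (LINT x|torus. \<psi> x *\<^sub>R g' x)"
    by (rule integral_cong_AE) (use assms(3,7) m in \<open>auto intro!: borel_measurable_scaleR\<close>)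
  ultimately show "(LINT x|torus. partial i \<psi> x *\<^sub>R f' x) = - (LINT x|torus. \<psi> x *\<^sub>R g' x)"
    using assms(1) \<psi> unfolding weak_partial_def by metis
qed

lemma weak_partial_unique:
  assumes "weak_partial i f g" "weak_partial i f h" "L2 g" "L2 h"
  shows "AE x in torus. g x = h x"
proof -
  have "AE x in torus. g x - h x = 0"
  proof (rule trig_orthogonal)
    show "L2 (\<lambda>x. g x - h x)" using assms by (intro L2_diff)
    fix \<psi> :: "real^3 \<Rightarrow> real" assume \<psi>: "trig_poly \<psi>"
    have "(LINT x|torus. \<psi> x *\<^sub>R (g x - h x)) = (LINT x|torus. \<psi> x *\<^sub>R g x) - (LINT x|torus. \<psi> x *\<^sub>R h x)"
      unfolding scaleR_diff_right
      by (rule Bochner_Integration.integral_diff) (intro L2_scaleR_integrable trig_poly_L2 \<psi> assms)+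
    also have "\<dots> = 0"
      using assms(1,2) \<psi> unfolding weak_partial_def by (metis cancel_comm_monoid_add_class.diff_cancel minus_equation_iff)
    finally show "(LINT x|torus. \<psi> x *\<^sub>R (g x - h x)) = 0" .
  qed
  then show ?thesis by simp
qed

lemma weak_partial_add:
  fixes f g :: "real^3 \<Rightarrow> 'b::euclidean_space"
  assumes "weak_partial i f f'" "weak_partial i g g'" "L2 f" "L2 f'" "L2 g" "L2 g'"
  shows "weak_partial i (\<lambda>x. f x + g x) (\<lambda>x. f' x + g' x)"
  unfolding weak_partial_def
proof (intro allI impI)
  fix \<psi> :: "real^3 \<Rightarrow> real" assume \<psi>: "trig_poly \<psi>"
  have "integrable torus (\<lambda>x. \<psi> x *\<^sub>R h x)" "integrable torus (\<lambda>x. partial i \<psi> x *\<^sub>R h x)"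
    if "L2 h" for h :: "real^3 \<Rightarrow> 'b"
    using that \<psi> by (auto intro!: L2_scaleR_integrable trig_poly_L2 trig_poly_partial)
  then show "(LINT x|torus. partial i \<psi> x *\<^sub>R (f x + g x)) = - (LINT x|torus. \<psi> x *\<^sub>R (f' x + g' x))"
    using assms \<psi> unfolding weak_partial_def by (simp add: scaleR_add_right)
qed

lemma weak_partial_linear:
  fixes f :: "real^3 \<Rightarrow> 'b::euclidean_space" and T :: "'b \<Rightarrow> 'c::euclidean_space"
  assumes "bounded_linear T" "weak_partial i f g" "L2 f" "L2 g"
  shows "weak_partial i (\<lambda>x. T (f x)) (\<lambda>x. T (g x))"
  unfolding weak_partial_def
proof (intro allI impI)
  fix \<psi> :: "real^3 \<Rightarrow> real" assume \<psi>: "trig_poly \<psi>"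
  have l: "linear T" using assms(1) by (rule bounded_linear.linear)
  have "(LINT x|torus. partial i \<psi> x *\<^sub>R T (f x)) = T (LINT x|torus. partial i \<psi> x *\<^sub>R f x)"
    unfolding linear_scale[OF l, symmetric]
    by (rule integral_bounded_linear[OF assms(1)])
       (intro L2_scaleR_integrable trig_poly_L2 trig_poly_partial \<psi> assms)
  also have "\<dots> = - T (LINT x|torus. \<psi> x *\<^sub>R g x)"
    using assms(2) \<psi> unfolding weak_partial_def by (simp add: linear_neg[OF l])
  also have "T (LINT x|torus. \<psi> x *\<^sub>R g x) = (LINT x|torus. \<psi> x *\<^sub>R T (g x))"
    unfolding linear_scale[OF l, symmetric]
    by (rule integral_bounded_linear[OF assms(1), symmetric])
       (intro L2_scaleR_integrable trig_poly_L2 \<psi> assms)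
  finally show "(LINT x|torus. partial i \<psi> x *\<^sub>R T (f x)) = - (LINT x|torus. \<psi> x *\<^sub>R T (g x))" .
qed

lemma weak_partial_scaleR:
  fixes f :: "real^3 \<Rightarrow> 'b::euclidean_space"
  assumes "weak_partial i f g" "L2 f" "L2 g"
  shows "weak_partial i (\<lambda>x. c *\<^sub>R f x) (\<lambda>x. c *\<^sub>R g x)"
  by (rule weak_partial_linear[OF bounded_linear_scaleR_right assms])

lemma weak_partial_nth:
  fixes f :: "real^3 \<Rightarrow> real^'n"
  shows "weak_partial i f g \<Longrightarrow> L2 f \<Longrightarrow> L2 g \<Longrightarrow> weak_partial i (\<lambda>x. f x $ c) (\<lambda>x. g x $ c)"
  by (rule weak_partial_linear[OF bounded_linear_vec_nth])

lemma L2_mult_integrable: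
  fixes f g :: "real^3 \<Rightarrow> real"
  shows "L2 f \<Longrightarrow> L2 g \<Longrightarrow> integrable torus (\<lambda>x. f x * g x)"
  using L2_inner_integrable[of f g] by simp

lemma integration_by_parts_trig:
  fixes \<psi> \<eta> :: "real^3 \<Rightarrow> real"
  assumes "trig_poly \<psi>" "trig_poly \<eta>"
  shows "(LINT x|torus. partial i \<psi> x * \<eta> x) = - (LINT x|torus. \<psi> x * partial i \<eta> x)"
proof -
  have "0 = (LINT x|torus. partial i \<psi> x * \<eta> x + \<psi> x * partial i \<eta> x)"
    using integral_partial_zero[OF trig_poly_mult[OF assms], of i] by (simp add: partial_mult assms)
  also have "\<dots> = (LINT x|torus. partial i \<psi> x * \<eta> x) + (LINT x|torus. \<psi> x * partial i \<eta> x)"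
    by (rule Bochner_Integration.integral_add)
       (intro L2_mult_integrable trig_poly_L2 trig_poly_partial assms)+
  finally show ?thesis by simp
qed

lemma weak_partial_trig:
  fixes \<phi> :: "real^3 \<Rightarrow> 'b::euclidean_space"
  assumes \<phi>: "trig_poly \<phi>" shows "weak_partial i \<phi> (partial i \<phi>)"
  unfolding weak_partial_def
proof (intro allI impI, rule euclidean_eqI)
  fix \<psi> :: "real^3 \<Rightarrow> real" and b :: 'b assume \<psi>: "trig_poly \<psi>"
  have \<phi>b: "trig_poly (\<lambda>x. \<phi> x \<bullet> b)" by (rule trig_poly_linear[OF bounded_linear_inner_left \<phi>])
  have "(LINT x|torus. partial i \<psi> x *\<^sub>R \<phi> x) \<bullet> b = (LINT x|torus. (partial i \<psi> x *\<^sub>R \<phi> x) \<bullet> b)"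
    by (rule integral_inner_left[symmetric])
       (intro L2_scaleR_integrable trig_poly_L2 trig_poly_partial \<psi> \<phi>)
  also have "\<dots> = - (LINT x|torus. \<psi> x * partial i (\<lambda>x. \<phi> x \<bullet> b) x)"
    using integration_by_parts_trig[OF \<psi> \<phi>b] by simp
  also have "\<dots> = - (LINT x|torus. (\<psi> x *\<^sub>R partial i \<phi> x) \<bullet> b)"
    by (simp add: partial_linear[OF bounded_linear_inner_left \<phi>])
  also have "\<dots> = (- (LINT x|torus. \<psi> x *\<^sub>R partial i \<phi> x)) \<bullet> b"
    by (subst integral_inner_left)
       (intro L2_scaleR_integrable trig_poly_L2 trig_poly_partial \<psi> \<phi>, simp)
  finally show "(LINT x|torus. partial i \<psi> x *\<^sub>R \<phi> x) \<bullet> b = (- (LINT x|torus. \<psi> x *\<^sub>R partial i \<phi> x)) \<bullet> b" .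
qed

lemma wd_works:
  assumes "L2 g" "weak_partial i f g" shows "L2 (wd i f)" "weak_partial i f (wd i f)"
proof -
  have "L2 (wd i f) \<and> weak_partial i f (wd i f)"
    unfolding wd_def by (rule someI[of _ g]) (use assms in simp)
  then show "L2 (wd i f)" "weak_partial i f (wd i f)" by auto
qed

lemma wd_eqI: "L2 g \<Longrightarrow> weak_partial i f g \<Longrightarrow> AE x in torus. wd i f x = g x"
  using weak_partial_unique[OF wd_works(2) _ wd_works(1)] by blast

lemma sobolev_L2: "sobolev s f \<Longrightarrow> L2 f"
  by (cases s) auto

lemma sobolev_cong_AE:
  "sobolev s f \<Longrightarrow> AE x in torus. f x = g x \<Longrightarrow> g \<in> borel_measurable torus \<Longrightarrow> sobolev s g"
proof (cases s)
  case 0 then show "sobolev s f \<Longrightarrow> AE x in torus. f x = g x \<Longrightarrow> g \<in> borel_measurable torus \<Longrightarrow> ?thesis"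
    using L2_cong_AE by auto
next
  case (Suc s')
  assume f: "sobolev s f" "AE x in torus. f x = g x" "g \<in> borel_measurable torus"
  have "L2 g" using L2_cong_AE[OF sobolev_L2[OF f(1)] f(3,2)] .
  moreover have "\<exists>h. weak_partial i g h \<and> sobolev s' h" for i
  proof -
    obtain h where h: "weak_partial i f h" "sobolev s' h" using f(1) Suc by auto
    have "weak_partial i g h"
      by (rule weak_partial_cong_AE[OF h(1) f(2) _ sobolev_L2[OF f(1)] f(3) sobolev_L2[OF h(2)]])
         (use sobolev_L2[OF h(2)] L2_measurable in auto)
    then show ?thesis using h by blast
  qed
  ultimately show ?thesis using Suc by simp
qed

text \<open>
  By uniqueness the chosen derivative \<open>wd i f\<close> has the regularity of any other weak derivative, so that
  it can be iterated.
\<close>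

lemma sobolev_Suc_wd:
  "sobolev (Suc s) f \<longleftrightarrow> L2 f \<and> (\<forall>i. weak_partial i f (wd i f) \<and> sobolev s (wd i f))"
proof
  assume f: "sobolev (Suc s) f"
  have "weak_partial i f (wd i f) \<and> sobolev s (wd i f)" for i
  proof -
    obtain h where h: "weak_partial i f h" "sobolev s h" using f by auto
    note w = wd_works[OF sobolev_L2[OF h(2)] h(1)]
    have "AE x in torus. h x = wd i f x"
      using wd_eqI[OF sobolev_L2[OF h(2)] h(1)] by (auto elim: eventually_mono)
    then have "sobolev s (wd i f)" by (rule sobolev_cong_AE[OF h(2) _ L2_measurable[OF w(1)]])
    then show ?thesis using w by simp
  qed
  then show "L2 f \<and> (\<forall>i. weak_partial i f (wd i f) \<and> sobolev s (wd i f))" using f by simp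
qed auto

lemma sobolev_Suc: "sobolev (Suc s) f \<Longrightarrow> sobolev s f"
proof (induction s arbitrary: f)
  case (Suc s) then show ?case by (subst sobolev_Suc_wd) (subst (asm) sobolev_Suc_wd, blast)
qed simp

lemma sobolev_one: "sobolev (Suc s) f \<Longrightarrow> sobolev 1 f"
  by (induction s) (use sobolev_Suc in auto)

lemma sobolev_1_iff: "sobolev 1 f \<longleftrightarrow> L2 f \<and> (\<forall>i. weak_partial i f (wd i f) \<and> L2 (wd i f))"
  unfolding One_nat_def sobolev_Suc_wd by simp

lemma wd_L2: "sobolev 1 f \<Longrightarrow> L2 (wd i f)"
  and wd_weak: "sobolev 1 f \<Longrightarrow> weak_partial i f (wd i f)"
  by (auto simp: sobolev_1_iff simp del: One_nat_def)

lemma sobolev_wd: "sobolev (Suc s) f \<Longrightarrow> sobolev s (wd i f)"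
  by (simp add: sobolev_Suc_wd del: sobolev.simps)

lemma wd_cong_AE:
  assumes "sobolev 1 f" "AE x in torus. f x = g x" "g \<in> borel_measurable torus"
  shows "AE x in torus. wd i f x = wd i g x"
proof -
  have g: "sobolev 1 g" using sobolev_cong_AE assms by blast
  have "weak_partial i g (wd i f)"
    by (rule weak_partial_cong_AE[OF wd_weak[OF assms(1)] assms(2) _ sobolev_L2[OF assms(1)] assms(3)
        wd_L2[OF assms(1)]]) (auto intro: L2_measurable wd_L2[OF assms(1)])
  then have "AE x in torus. wd i g x = wd i f x" by (rule wd_eqI[OF wd_L2[OF assms(1)]])
  then show ?thesis by (auto elim: eventually_mono)
qed

lemma wd_add:
  assumes "sobolev 1 f" "sobolev 1 g"
  shows "AE x in torus. wd i (\<lambda>x. f x + g x) x = wd i f x + wd i g x"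
  by (rule wd_eqI) (intro L2_add weak_partial_add wd_L2 wd_weak sobolev_L2[of 1] assms)+

lemma wd_scaleR:
  assumes "sobolev 1 f" shows "AE x in torus. wd i (\<lambda>x. c *\<^sub>R f x) x = c *\<^sub>R wd i f x"
  by (rule wd_eqI) (intro L2_scaleR weak_partial_scaleR wd_L2 wd_weak sobolev_L2[of 1] assms)+

lemma wd_trig: "trig_poly \<phi> \<Longrightarrow> AE x in torus. wd i \<phi> x = partial i \<phi> x"
  by (rule wd_eqI) (intro trig_poly_L2 trig_poly_partial weak_partial_trig, assumption)+

lemma sobolev_trig: "trig_poly \<phi> \<Longrightarrow> sobolev s \<phi>"
proof (induction s arbitrary: \<phi>)
  case 0 then show ?case by (simp add: trig_poly_L2)
next
  case (Suc s)
  have "weak_partial i \<phi> (partial i \<phi>) \<and> sobolev s (partial i \<phi>)" for i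
    by (intro conjI weak_partial_trig Suc.IH trig_poly_partial Suc.prems)
  then show ?case using trig_poly_L2[OF Suc.prems] by auto
qed

lemma sobolev_add: "sobolev s f \<Longrightarrow> sobolev s g \<Longrightarrow> sobolev s (\<lambda>x. f x + g x)"
proof (induction s arbitrary: f g)
  case 0 then show ?case by (simp add: L2_add)
next
  case (Suc s)
  have "weak_partial i (\<lambda>x. f x + g x) (\<lambda>x. wd i f x + wd i g x) \<and> sobolev s (\<lambda>x. wd i f x + wd i g x)" for i
    by (intro conjI weak_partial_add Suc.IH sobolev_wd wd_L2 wd_weak sobolev_one[of s] sobolev_L2[of "Suc s"] Suc.prems)
  then show ?case using L2_add Suc.prems by auto
qed

lemma sobolev_scaleR: "sobolev s f \<Longrightarrow> sobolev s (\<lambda>x. c *\<^sub>R f x)"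
proof (induction s arbitrary: f)
  case 0 then show ?case by (simp add: L2_scaleR)
next
  case (Suc s)
  have "weak_partial i (\<lambda>x. c *\<^sub>R f x) (\<lambda>x. c *\<^sub>R wd i f x) \<and> sobolev s (\<lambda>x. c *\<^sub>R wd i f x)" for i
    by (intro conjI weak_partial_scaleR Suc.IH sobolev_wd wd_L2 wd_weak sobolev_one[of s] sobolev_L2[of "Suc s"] Suc.prems)
  then show ?case using L2_scaleR Suc.prems by auto
qed

lemma sobolev_diff: "sobolev s f \<Longrightarrow> sobolev s g \<Longrightarrow> sobolev s (\<lambda>x. f x - g x)"
  using sobolev_add[of s f "\<lambda>x. (-1) *\<^sub>R g x"] sobolev_scaleR[of s g "-1"] by simp

lemma wd_diff:
  assumes "sobolev 1 f" "sobolev 1 g"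
  shows "AE x in torus. wd i (\<lambda>x. f x - g x) x = wd i f x - wd i g x"
  using wd_add[OF assms(1) sobolev_scaleR[OF assms(2)], of i "-1"] wd_scaleR[OF assms(2), of i "-1"]
  by eventually_elim simp

lemma sobnorm_nonneg [simp]: "0 \<le> sobnorm s f"
  by (cases s) (auto intro!: real_sqrt_ge_zero add_nonneg_nonneg sum_nonneg)

lemma sobnorm_Suc_square: "(sobnorm (Suc s) f)\<^sup>2 = (l2norm f)\<^sup>2 + (\<Sum>i\<in>UNIV. (sobnorm s (wd i f))\<^sup>2)"
  by (simp add: add_nonneg_nonneg sum_nonneg)

lemma sobnorm_cong_AE:
  "sobolev s f \<Longrightarrow> AE x in torus. f x = g x \<Longrightarrow> g \<in> borel_measurable torus \<Longrightarrow> sobnorm s f = sobnorm s g"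
proof (induction s arbitrary: f g)
  case 0 then show ?case using l2norm_cong_AE L2_measurable by auto
next
  case (Suc s)
  have g: "sobolev (Suc s) g" using sobolev_cong_AE Suc.prems by blast
  have "sobnorm s (wd i f) = sobnorm s (wd i g)" for i
    by (rule Suc.IH[OF sobolev_wd[OF Suc.prems(1)] wd_cong_AE[OF sobolev_one[OF Suc.prems(1)] Suc.prems(2,3)]
          L2_measurable[OF wd_L2[OF sobolev_one[OF g]]]])
  moreover have "l2norm f = l2norm g"
    using l2norm_cong_AE L2_measurable sobolev_L2 Suc.prems by blast
  ultimately show ?case by simp
qed

lemma sobnorm_le_Suc: "sobolev (Suc s) f \<Longrightarrow> sobnorm s f \<le> sobnorm (Suc s) f"
proof (induction s arbitrary: f)
  case 0 then show ?case by (auto intro!: real_le_rsqrt sum_nonneg)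
next
  case (Suc s)
  have "(sobnorm (Suc s) f)\<^sup>2 \<le> (sobnorm (Suc (Suc s)) f)\<^sup>2"
    unfolding sobnorm_Suc_square[of "Suc s"] sobnorm_Suc_square[of s f]
    by (intro add_left_mono sum_mono power_mono Suc.IH sobolev_wd Suc.prems sobnorm_nonneg)
  then show ?case by (rule power2_le_imp_le) (rule sobnorm_nonneg)
qed

lemma sobnorm_wd_le: "sobnorm s (wd i f) \<le> sobnorm (Suc s) f"
proof -
  have "(sobnorm s (wd i f))\<^sup>2 \<le> (\<Sum>i\<in>UNIV. (sobnorm s (wd i f))\<^sup>2)"
    by (rule member_le_sum) auto
  then have "(sobnorm s (wd i f))\<^sup>2 \<le> (sobnorm (Suc s) f)\<^sup>2"
    unfolding sobnorm_Suc_square by (simp add: add_increasing)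
  then show ?thesis by (rule power2_le_imp_le) (rule sobnorm_nonneg)
qed

lemma l2norm_le_sobnorm: "l2norm f \<le> sobnorm s f"
proof (cases s)
  case (Suc s') then show ?thesis by (auto intro!: real_le_rsqrt sum_nonneg)
qed simp

text \<open>
  The inductive step for the triangle inequality of the Sobolev norms: Minkowski's inequality for the
  sum, and then for the pair formed by it and the leading term.
\<close>

lemma sqrt_sum_triangle:
  fixes a b a' b' :: real and f g h :: "'i \<Rightarrow> real"
  assumes "0 \<le> c" "c \<le> a + b" "\<And>i. 0 \<le> h i" "\<And>i. h i \<le> f i + g i"
  shows "sqrt (c\<^sup>2 + (\<Sum>i\<in>A. (h i)\<^sup>2)) \<le> sqrt (a\<^sup>2 + (\<Sum>i\<in>A. (f i)\<^sup>2)) + sqrt (b\<^sup>2 + (\<Sum>i\<in>A. (g i)\<^sup>2))"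
proof -
  have "sqrt (c\<^sup>2 + (\<Sum>i\<in>A. (h i)\<^sup>2)) \<le> sqrt ((a + b)\<^sup>2 + (L2_set (\<lambda>i. f i + g i) A)\<^sup>2)"
    unfolding L2_set_def using assms
    by (subst real_sqrt_pow2) (auto intro!: sum_nonneg real_sqrt_le_mono add_mono power_mono sum_mono)
  also have "\<dots> \<le> sqrt ((a + b)\<^sup>2 + (L2_set f A + L2_set g A)\<^sup>2)"
    by (intro real_sqrt_le_mono add_mono order_refl power_mono L2_set_triangle_ineq L2_set_nonneg)
  also have "\<dots> \<le> sqrt (a\<^sup>2 + (L2_set f A)\<^sup>2) + sqrt (b\<^sup>2 + (L2_set g A)\<^sup>2)"
    by (rule real_sqrt_sum_squares_triangle_ineq)
  finally show ?thesis
    by (simp add: L2_set_def sum_nonneg)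
qed

lemma sobnorm_triangle:
  "sobolev s f \<Longrightarrow> sobolev s g \<Longrightarrow> sobnorm s (\<lambda>x. f x + g x) \<le> sobnorm s f + sobnorm s g"
proof (induction s arbitrary: f g)
  case 0 then show ?case by (simp add: l2norm_triangle)
next
  case (Suc s)
  have fg: "sobolev (Suc s) (\<lambda>x. f x + g x)" by (intro sobolev_add Suc.prems)
  have "sobnorm s (wd i (\<lambda>x. f x + g x)) \<le> sobnorm s (wd i f) + sobnorm s (wd i g)" for i
  proof -
    have "sobnorm s (wd i (\<lambda>x. f x + g x)) = sobnorm s (\<lambda>x. wd i f x + wd i g x)"
      by (rule sobnorm_cong_AE[OF sobolev_wd[OF fg] wd_add])
         (use Suc.prems sobolev_one L2_measurable L2_add wd_L2 in blast)+
    also have "\<dots> \<le> sobnorm s (wd i f) + sobnorm s (wd i g)"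
      by (intro Suc.IH sobolev_wd Suc.prems)
    finally show ?thesis .
  qed
  then show ?case
    unfolding sobnorm.simps
    by (intro sqrt_sum_triangle l2norm_triangle l2norm_nonneg sobnorm_nonneg sobolev_L2[of "Suc s"] Suc.prems)
qed

lemma sobnorm_scaleR:
  "sobolev s f \<Longrightarrow> sobnorm s (\<lambda>x. c *\<^sub>R f x) = \<bar>c\<bar> * sobnorm s f"
proof (induction s arbitrary: f)
  case 0 then show ?case by (simp add: l2norm_scaleR)
next
  case (Suc s)
  have "sobnorm s (wd i (\<lambda>x. c *\<^sub>R f x)) = \<bar>c\<bar> * sobnorm s (wd i f)" for i
    by (subst Suc.IH[OF sobolev_wd[OF Suc.prems], symmetric],
        rule sobnorm_cong_AE[OF sobolev_wd[OF sobolev_scaleR[OF Suc.prems]] wd_scaleR[OF sobolev_one[OF Suc.prems]]])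
       (intro L2_measurable L2_scaleR wd_L2 sobolev_one[of s] Suc.prems)
  then have "(sobnorm (Suc s) (\<lambda>x. c *\<^sub>R f x))\<^sup>2 = (\<bar>c\<bar> * sobnorm (Suc s) f)\<^sup>2"
    unfolding power_mult_distrib sobnorm_Suc_square
    by (simp add: l2norm_scaleR power_mult_distrib sum_distrib_left distrib_left)
  then show ?case by (rule power2_eq_imp_eq) (simp_all only: sobnorm_nonneg mult_nonneg_nonneg abs_ge_zero)
qed

section \<open>Embedding theorems by Fourier series\<close>

text \<open>
  The square of the Japanese bracket of the frequency.
\<close>

definition bracket :: "int^3 \<Rightarrow> real" where
  "bracket k = 1 + (\<Sum>i\<in>UNIV. (of_int (k $ i))\<^sup>2)"

lemma bracket_ge_1: "1 \<le> bracket k"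
  by (simp add: bracket_def sum_nonneg)

lemma int_sum_powr_bounded: "\<exists>C. \<forall>N. finite N \<longrightarrow> (\<Sum>n\<in>N. (1 + (real_of_int n)\<^sup>2) powr (-2/3)) \<le> C"
proof -
  define b where "b m = (if m = 0 then 1 else real m powr (-4/3))" for m :: nat
  have "summable (\<lambda>m. real m powr (-4/3))"
    by (subst summable_real_powr_iff) simp
  then have b: "summable b"
    by (rule summable_cong[THEN iffD1, rotated])
       (auto simp: b_def intro!: eventually_sequentiallyI[of 1])
  have bpos: "0 \<le> b m" for m by (simp add: b_def)
  have ab: "(1 + (real_of_int n)\<^sup>2) powr (-2/3) \<le> b (nat \<bar>n\<bar>)" for n
  proof (cases "n = 0")
    case False
    have "(1 + (real_of_int n)\<^sup>2) powr (-2/3) \<le> ((real_of_int n)\<^sup>2) powr (-2/3)"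
      using False by (intro powr_mono2') auto
    also have "\<dots> = (\<bar>real_of_int n\<bar> powr 2) powr (-2/3)"
      using False by (simp add: powr_numeral)
    also have "\<dots> = \<bar>real_of_int n\<bar> powr (-4/3)"
      unfolding powr_powr by simp
    also have "\<dots> = b (nat \<bar>n\<bar>)"
      using False by (simp add: b_def)
    finally show ?thesis .
  qed (simp add: b_def)
  have half: "(\<Sum>n\<in>N. b (nat \<bar>n\<bar>)) \<le> suminf b" if "finite N" "inj_on (\<lambda>n. nat \<bar>n\<bar>) N" for N
  proof -
    have "(\<Sum>n\<in>N. b (nat \<bar>n\<bar>)) = (\<Sum>m\<in>(\<lambda>n. nat \<bar>n\<bar>) ` N. b m)"
      by (simp add: sum.reindex[OF that(2)])
    also have "\<dots> \<le> suminf b" by (rule sum_le_suminf[OF b]) (use that bpos in auto)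
    finally show ?thesis .
  qed
  have "(\<Sum>n\<in>N. (1 + (real_of_int n)\<^sup>2) powr (-2/3)) \<le> 2 * suminf b" if N: "finite N" for N
  proof -
    have "(\<Sum>n\<in>N. (1 + (real_of_int n)\<^sup>2) powr (-2/3)) \<le> (\<Sum>n\<in>N. b (nat \<bar>n\<bar>))"
      by (rule sum_mono) (rule ab)
    also have "\<dots> = (\<Sum>n\<in>{n\<in>N. n \<ge> 0}. b (nat \<bar>n\<bar>)) + (\<Sum>n\<in>{n\<in>N. \<not> n \<ge> 0}. b (nat \<bar>n\<bar>))"
      by (subst sum.union_disjoint[symmetric]) (use N in \<open>auto intro: sum.cong\<close>)
    also have "\<dots> \<le> suminf b + suminf b"
      by (intro add_mono half) (use N in \<open>auto simp: inj_on_def\<close>)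
    finally show ?thesis by simp
  qed
  then show ?thesis by blast
qed

text \<open>
  The series \<open>\<Sum> (1 + \<bar>k\<bar>\<^sup>2)\<^sup>-\<^sup>2\<close> over \<open>\<int>\<^sup>3\<close> converges, as \<open>4 > 3\<close>; it is dominated by the product of three
  one-dimensional series with exponent \<open>4/3\<close>.
\<close>

lemma lattice_sum_bounded: "\<exists>C\<ge>0. \<forall>K. finite K \<longrightarrow> (\<Sum>k\<in>K. 1 / (bracket k)\<^sup>2) \<le> C"
proof -
  define a where "a n = (1 + (real_of_int n)\<^sup>2) powr (-2/3)" for n
  obtain C where C: "\<And>N. finite N \<Longrightarrow> (\<Sum>n\<in>N. a n) \<le> C"
    using int_sum_powr_bounded unfolding a_def by blast
  have C0: "0 \<le> C" using C[of "{}"] by simp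
  have a0: "0 \<le> a n" for n by (simp add: a_def)
  have le: "1 / (bracket k)\<^sup>2 \<le> (\<Prod>i\<in>UNIV. a (k $ i))" for k
  proof -
    have "(\<Prod>i\<in>(UNIV :: 3 set). bracket k powr (-2/3)) \<le> (\<Prod>i\<in>UNIV. a (k $ i))"
    proof (rule prod_mono, safe)
      fix i :: 3
      have "(real_of_int (k $ i))\<^sup>2 \<le> (\<Sum>i\<in>UNIV. (of_int (k $ i))\<^sup>2)"
        by (rule member_le_sum) auto
      then show "bracket k powr (-2/3) \<le> a (k $ i)"
        unfolding a_def bracket_def by (intro powr_mono2') (auto intro: add_pos_nonneg)
    qed simp
    also have "(\<Prod>i\<in>(UNIV :: 3 set). bracket k powr (-2/3)) = bracket k powr (-2)"
      using bracket_ge_1[of k] by (simp add: powr_power)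
    also have "\<dots> = 1 / (bracket k)\<^sup>2"
      using bracket_ge_1[of k] by (simp add: powr_minus_divide powr_numeral)
    finally show ?thesis .
  qed
  have "(\<Sum>k\<in>K. 1 / (bracket k)\<^sup>2) \<le> C ^ 3" if K: "finite K" for K
  proof -
    define N where "N = (\<Union>k\<in>K. range (\<lambda>i. k $ i))"
    have N: "finite N" using K by (simp add: N_def)
    have inj: "inj_on vec_nth K" by (simp add: inj_on_def vec_nth_inject)
    have "(\<Sum>k\<in>K. 1 / (bracket k)\<^sup>2) \<le> (\<Sum>k\<in>K. \<Prod>i\<in>UNIV. a (k $ i))"
      by (rule sum_mono) (rule le)
    also have "\<dots> = (\<Sum>g\<in>vec_nth ` K. \<Prod>i\<in>UNIV. a (g i))"
      by (simp add: sum.reindex[OF inj])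
    also have "\<dots> \<le> (\<Sum>g\<in>PiE (UNIV :: 3 set) (\<lambda>_. N). \<Prod>i\<in>UNIV. a (g i))"
      by (rule sum_mono2) (auto simp: N N_def K a0 intro!: finite_PiE prod_nonneg)
    also have "\<dots> = (\<Prod>i\<in>(UNIV :: 3 set). \<Sum>n\<in>N. a n)"
      by (rule prod_sum_PiE[symmetric]) (use N in auto)
    also have "\<dots> = (\<Sum>n\<in>N. a n) ^ 3" by simp
    also have "\<dots> \<le> C ^ 3" by (intro power_mono C N sum_nonneg a0)
    finally show ?thesis .
  qed
  then show ?thesis using C0 by (intro exI[of _ "C ^ 3"]) auto
qed

subsection \<open>Parseval's identity and Bessel's inequality\<close>

lemma fourier_integrable: "integrable torus (\<lambda>x. c * fourier k x)"
  by (intro continuous_integrable_torus continuous_intros)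

lemma parseval:
  assumes K: "finite K"
  shows "(LINT x|torus. (cmod (\<Sum>k\<in>K. c k * fourier k x))\<^sup>2) = (\<Sum>k\<in>K. (cmod (c k))\<^sup>2)"
proof -
  have sq: "complex_of_real ((cmod (\<Sum>k\<in>K. c k * fourier k x))\<^sup>2)
      = (\<Sum>k\<in>K. \<Sum>l\<in>K. (c k * cnj (c l)) * fourier (k - l) x)" for x
  proof -
    have "fourier (k - l) x = fourier k x * cnj (fourier l x)" for k l
      using fourier_add[of k "- l" x] by (simp add: fourier_cnj)
    then show ?thesis
      unfolding complex_norm_square by (simp add: sum_product mult_ac)
  qed
  have "complex_of_real (LINT x|torus. (cmod (\<Sum>k\<in>K. c k * fourier k x))\<^sup>2)
      = (LINT x|torus. complex_of_real ((cmod (\<Sum>k\<in>K. c k * fourier k x))\<^sup>2))"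
    by (rule integral_complex_of_real[symmetric])
  also have "\<dots> = (\<Sum>k\<in>K. \<Sum>l\<in>K. (LINT x|torus. (c k * cnj (c l)) * fourier (k - l) x))"
    unfolding sq
    by (subst Bochner_Integration.integral_sum, intro Bochner_Integration.integrable_sum fourier_integrable,
        intro sum.cong refl, rule Bochner_Integration.integral_sum, rule fourier_integrable)
  also have "\<dots> = (\<Sum>k\<in>K. \<Sum>l\<in>K. if l = k then c k * cnj (c l) else 0)"
    by (intro sum.cong refl) (simp add: integral_fourier)
  also have "\<dots> = (\<Sum>k\<in>K. c k * cnj (c k))"
    using K by simp
  also have "\<dots> = complex_of_real (\<Sum>k\<in>K. (cmod (c k))\<^sup>2)"
    unfolding of_real_sum complex_norm_square ..
  finally show ?thesis by (simp only: of_real_eq_iff)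
qed

lemma trig_poly_coefficients:
  fixes \<psi> :: "real^3 \<Rightarrow> real"
  assumes "trig_poly \<psi>"
  obtains K c where "finite K" "\<And>x. complex_of_real (\<psi> x) = (\<Sum>k\<in>K. c k * fourier k x)"
  using assms unfolding trig_poly_iff_ctrig ctrig_def fun_eq_iff by blast

lemma fourier_coefficient:
  assumes K: "finite K" "\<And>x. complex_of_real (\<psi> x) = (\<Sum>k\<in>K. c k * fourier k x)" and l: "l \<in> K"
  shows "c l = (LINT x|torus. complex_of_real (\<psi> x) * fourier (- l) x)"
proof -
  have "(LINT x|torus. complex_of_real (\<psi> x) * fourier (- l) x)
      = (LINT x|torus. (\<Sum>k\<in>K. c k * fourier (k - l) x))"
    unfolding K(2) sum_distrib_right using fourier_add[of _ "- l"] by (simp add: mult_ac)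
  also have "\<dots> = (\<Sum>k\<in>K. (LINT x|torus. c k * fourier (k - l) x))"
    by (rule Bochner_Integration.integral_sum) (rule fourier_integrable)
  also have "\<dots> = (\<Sum>k\<in>K. if k = l then c k else 0)"
    by (intro sum.cong refl) (simp add: integral_fourier)
  also have "\<dots> = c l" using K(1) l by simp
  finally show ?thesis ..
qed

text \<open>
  Real and imaginary parts are differentiated separately; the imaginary part is identically zero.
\<close>

lemma fourier_partial:
  fixes \<psi> :: "real^3 \<Rightarrow> real"
  assumes K: "finite K" "\<And>x. complex_of_real (\<psi> x) = (\<Sum>k\<in>K. c k * fourier k x)"
  shows "complex_of_real (partial i \<psi> x) = (\<Sum>k\<in>K. (2 * pi * of_int (k $ i) * \<i> * c k) * fourier k x)"
proof (rule complex_eqI)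
  have re: "\<psi> = (\<lambda>x. \<Sum>k\<in>K. cos (freq k x) *\<^sub>R Re (c k) + sin (freq k x) *\<^sub>R (- Im (c k)))"
  proof
    fix x
    have "\<psi> x = Re (\<Sum>k\<in>K. c k * fourier k x)" by (simp flip: K(2))
    then show "\<psi> x = (\<Sum>k\<in>K. cos (freq k x) *\<^sub>R Re (c k) + sin (freq k x) *\<^sub>R (- Im (c k)))"
      by (simp add: fourier_def mult.commute)
  qed
  have im: "(\<lambda>x. 0 :: real) = (\<lambda>x. \<Sum>k\<in>K. cos (freq k x) *\<^sub>R Im (c k) + sin (freq k x) *\<^sub>R Re (c k))"
  proof
    fix x
    have "0 = Im (\<Sum>k\<in>K. c k * fourier k x)" by (simp flip: K(2))
    then show "0 = (\<Sum>k\<in>K. cos (freq k x) *\<^sub>R Im (c k) + sin (freq k x) *\<^sub>R Re (c k))"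
      by (simp add: fourier_def mult.commute add.commute)
  qed
  have "partial i \<psi> x = (\<Sum>k\<in>K. cos (freq k x) *\<^sub>R ((2 * pi * of_int (k $ i)) *\<^sub>R (- Im (c k)))
       + sin (freq k x) *\<^sub>R (- (2 * pi * of_int (k $ i)) *\<^sub>R Re (c k)))"
    by (subst re, subst partial_trig) (rule refl)
  then show "Re (complex_of_real (partial i \<psi> x)) = Re (\<Sum>k\<in>K. (2 * pi * of_int (k $ i) * \<i> * c k) * fourier k x)"
    by (auto simp: fourier_def algebra_simps intro!: sum.cong)
  have "partial i (\<lambda>x. 0 :: real) x = (\<Sum>k\<in>K. cos (freq k x) *\<^sub>R ((2 * pi * of_int (k $ i)) *\<^sub>R Re (c k))
       + sin (freq k x) *\<^sub>R (- (2 * pi * of_int (k $ i)) *\<^sub>R Im (c k)))"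
    by (subst im, subst partial_trig) (rule refl)
  then show "Im (complex_of_real (partial i \<psi> x)) = Im (\<Sum>k\<in>K. (2 * pi * of_int (k $ i) * \<i> * c k) * fourier k x)"
    unfolding partial_const
    by (auto simp: fourier_def algebra_simps intro!: sum.cong)
qed

lemma l2norm_fourier:
  fixes \<psi> :: "real^3 \<Rightarrow> real"
  assumes K: "finite K" "\<And>x. complex_of_real (\<psi> x) = (\<Sum>k\<in>K. c k * fourier k x)"
  shows "(l2norm \<psi>)\<^sup>2 = (\<Sum>k\<in>K. (cmod (c k))\<^sup>2)"
    and "(l2norm (partial i \<psi>))\<^sup>2 = (\<Sum>k\<in>K. (2 * pi * of_int (k $ i))\<^sup>2 * (cmod (c k))\<^sup>2)"
proof -
  have n: "norm r = cmod (complex_of_real r)" for r by simp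
  show "(l2norm \<psi>)\<^sup>2 = (\<Sum>k\<in>K. (cmod (c k))\<^sup>2)"
    unfolding l2norm_def n K(2) parseval[OF K(1)] by (simp add: sum_nonneg)
  show "(l2norm (partial i \<psi>))\<^sup>2 = (\<Sum>k\<in>K. (2 * pi * of_int (k $ i))\<^sup>2 * (cmod (c k))\<^sup>2)"
    unfolding l2norm_def n fourier_partial[OF K] parseval[OF K(1)]
    by (simp add: sum_nonneg norm_mult power_mult_distrib)
qed

text \<open>
  The coefficient of frequency zero is the mean value, and each derivative in the direction of a nonzero
  component of \<open>k\<close> multiplies the coefficient by at least \<open>2\<pi>\<close>.
\<close>

lemma poincare_trig:
  fixes \<psi> :: "real^3 \<Rightarrow> real"
  assumes \<psi>: "trig_poly \<psi>" and mean: "(LINT x|torus. \<psi> x) = 0"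
  shows "(l2norm \<psi>)\<^sup>2 \<le> (\<Sum>i\<in>UNIV. (l2norm (partial i \<psi>))\<^sup>2)"
proof -
  obtain K c where K: "finite K" "\<And>x. complex_of_real (\<psi> x) = (\<Sum>k\<in>K. c k * fourier k x)"
    using trig_poly_coefficients[OF \<psi>] by blast
  have "(cmod (c k))\<^sup>2 \<le> (\<Sum>i\<in>UNIV. (2 * pi * of_int (k $ i))\<^sup>2 * (cmod (c k))\<^sup>2)" if "k \<in> K" for k
  proof (cases "k = 0")
    case True
    have "c k = (LINT x|torus. complex_of_real (\<psi> x))"
      using fourier_coefficient[OF K that] True by simp
    then have "c k = 0" using mean by simp
    then show ?thesis by simp
  next
    case False
    then obtain i where i: "k $ i \<noteq> 0" by (auto simp: vec_eq_iff)
    have "1 * 1 \<le> (2 * pi)\<^sup>2 * (real_of_int (k $ i))\<^sup>2"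
    proof (rule mult_mono)
      have "1 \<le> 2 * pi" using pi_gt3 by simp
      then show "1 \<le> (2 * pi)\<^sup>2" by (rule one_le_power)
      have "1 \<le> \<bar>k $ i\<bar>" using i by simp
      then have "1 \<le> \<bar>real_of_int (k $ i)\<bar>" by linarith
      then show "1 \<le> (real_of_int (k $ i))\<^sup>2" by (metis one_le_power power2_abs)
    qed auto
    then have "(cmod (c k))\<^sup>2 \<le> (2 * pi * of_int (k $ i))\<^sup>2 * (cmod (c k))\<^sup>2"
      using mult_right_mono[of 1 _ "(cmod (c k))\<^sup>2"] by (simp add: power_mult_distrib)
    also have "\<dots> \<le> (\<Sum>i\<in>UNIV. (2 * pi * of_int (k $ i))\<^sup>2 * (cmod (c k))\<^sup>2)"
      by (rule member_le_sum) auto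
    finally show ?thesis .
  qed
  then have "(\<Sum>k\<in>K. (cmod (c k))\<^sup>2) \<le> (\<Sum>k\<in>K. \<Sum>i\<in>UNIV. (2 * pi * of_int (k $ i))\<^sup>2 * (cmod (c k))\<^sup>2)"
    by (rule sum_mono)
  then show ?thesis
    unfolding l2norm_fourier[OF K] by (subst sum.swap)
qed

text \<open>
  On the Fourier side, the square of \<open>\<psi>\<close> is a convolution. Weighting the coefficients with the
  square roots of \<open>1 + \<bar>k\<bar>\<^sup>2\<close>, the Cauchy-Schwarz inequality bounds each of its coefficients, because
  the sum of \<open>1 / ((1 + \<bar>k\<bar>\<^sup>2)(1 + \<bar>l\<bar>\<^sup>2))\<close> over \<open>k + l = m\<close> is bounded uniformly in \<open>m\<close>.
\<close>

lemma L4_trig: "\<exists>C\<ge>0. \<forall>\<psi> :: real^3 \<Rightarrow> real. trig_poly \<psi> \<longrightarrow>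
    (LINT x|torus. (\<psi> x) ^ 4) \<le> C * ((l2norm \<psi>)\<^sup>2 + (\<Sum>i\<in>UNIV. (l2norm (partial i \<psi>))\<^sup>2))\<^sup>2"
proof -
  obtain C where C0: "0 \<le> C" and C: "\<And>K. finite K \<Longrightarrow> (\<Sum>k\<in>K. 1 / (bracket k)\<^sup>2) \<le> C"
    using lattice_sum_bounded by blast
  have "(LINT x|torus. (\<psi> x) ^ 4) \<le> C * ((l2norm \<psi>)\<^sup>2 + (\<Sum>i\<in>UNIV. (l2norm (partial i \<psi>))\<^sup>2))\<^sup>2"
    if \<psi>: "trig_poly \<psi>" for \<psi> :: "real^3 \<Rightarrow> real"
  proof -
    obtain K c where K: "finite K" "\<And>x. complex_of_real (\<psi> x) = (\<Sum>k\<in>K. c k * fourier k x)"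
      using trig_poly_coefficients[OF \<psi>] by blast
    define P where "P m = {p \<in> K \<times> K. fst p + snd p = m}" for m
    define M where "M = (\<lambda>p. fst p + snd p) ` (K \<times> K)"
    define d where "d m = (\<Sum>p\<in>P m. c (fst p) * c (snd p))" for m
    define w where "w k = bracket k * (cmod (c k))\<^sup>2" for k
    have fin: "finite (K \<times> K)" "finite (P m)" "finite M" for m using K(1) by (auto simp: P_def M_def)
    have square: "complex_of_real ((\<psi> x)\<^sup>2) = (\<Sum>m\<in>M. d m * fourier m x)" for x
    proof -
      have "complex_of_real ((\<psi> x)\<^sup>2) = (\<Sum>p\<in>K \<times> K. c (fst p) * c (snd p) * fourier (fst p + snd p) x)"
        unfolding of_real_power unfolding K(2) unfolding power2_eq_square sum_product
        by (simp add: sum.cartesian_product split_def fourier_add mult_ac)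
      also have "\<dots> = (\<Sum>m\<in>M. \<Sum>p\<in>P m. c (fst p) * c (snd p) * fourier (fst p + snd p) x)"
        unfolding M_def P_def by (rule sum.image_gen[OF fin(1)])
      also have "\<dots> = (\<Sum>m\<in>M. d m * fourier m x)"
        by (rule sum.cong[OF refl]) (simp add: d_def sum_distrib_right, simp add: P_def)
      finally show ?thesis .
    qed
    have dm: "(cmod (d m))\<^sup>2 \<le> C * (\<Sum>p\<in>P m. w (fst p) * w (snd p))" for m
    proof -
      have b: "bracket k > 0" for k using bracket_ge_1[of k] by linarith
      have tail: "(\<Sum>p\<in>P m. (1 / (sqrt (bracket (fst p)) * sqrt (bracket (snd p))))\<^sup>2) \<le> C"
      proof -
        have "(1 / (sqrt (bracket k) * sqrt (bracket l)))\<^sup>2 \<le> (1 / (bracket k)\<^sup>2 + 1 / (bracket l)\<^sup>2) / 2" for k l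
        proof -
          have "0 \<le> (1 / bracket k - 1 / bracket l)\<^sup>2" by simp
          then show ?thesis using b[of k] b[of l]
            by (simp add: power_mult_distrib power_divide power2_diff less_imp_le)
        qed
        then have "(\<Sum>p\<in>P m. (1 / (sqrt (bracket (fst p)) * sqrt (bracket (snd p))))\<^sup>2)
            \<le> (\<Sum>p\<in>P m. (1 / (bracket (fst p))\<^sup>2 + 1 / (bracket (snd p))\<^sup>2) / 2)"
          by (rule sum_mono)
        also have "\<dots> = ((\<Sum>p\<in>P m. 1 / (bracket (fst p))\<^sup>2) + (\<Sum>p\<in>P m. 1 / (bracket (snd p))\<^sup>2)) / 2"
          by (simp add: sum.distrib flip: sum_divide_distrib)
        also have "(\<Sum>p\<in>P m. 1 / (bracket (fst p))\<^sup>2) = (\<Sum>k\<in>fst ` P m. 1 / (bracket k)\<^sup>2)"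
          by (subst sum.reindex) (auto simp: inj_on_def P_def)
        also have "(\<Sum>p\<in>P m. 1 / (bracket (snd p))\<^sup>2) = (\<Sum>k\<in>snd ` P m. 1 / (bracket k)\<^sup>2)"
          by (subst sum.reindex) (auto simp: inj_on_def P_def)
        also have "((\<Sum>k\<in>fst ` P m. 1 / (bracket k)\<^sup>2) + (\<Sum>k\<in>snd ` P m. 1 / (bracket k)\<^sup>2)) / 2 \<le> (C + C) / 2"
          by (intro divide_right_mono add_mono C finite_imageI fin) simp
        finally show ?thesis by simp
      qed
      have "cmod (d m) \<le> (\<Sum>p\<in>P m. cmod (c (fst p)) * cmod (c (snd p)))"
        unfolding d_def by (rule order_trans[OF norm_sum]) (simp add: norm_mult)
      also have "\<dots> = (\<Sum>p\<in>P m. (sqrt (w (fst p)) * sqrt (w (snd p))) *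
          (1 / (sqrt (bracket (fst p)) * sqrt (bracket (snd p)))))"
        using b by (intro sum.cong refl) (simp add: w_def real_sqrt_mult less_imp_neq[symmetric])
      finally have "(cmod (d m))\<^sup>2 \<le> (\<Sum>p\<in>P m. (sqrt (w (fst p)) * sqrt (w (snd p))) *
          (1 / (sqrt (bracket (fst p)) * sqrt (bracket (snd p)))))\<^sup>2"
        by (rule power_mono) simp
      also have "\<dots> \<le> (\<Sum>p\<in>P m. (sqrt (w (fst p)) * sqrt (w (snd p)))\<^sup>2) *
          (\<Sum>p\<in>P m. (1 / (sqrt (bracket (fst p)) * sqrt (bracket (snd p))))\<^sup>2)"
        by (rule Cauchy_Schwarz_ineq_sum)
      also have "(\<Sum>p\<in>P m. (sqrt (w (fst p)) * sqrt (w (snd p)))\<^sup>2) = (\<Sum>p\<in>P m. w (fst p) * w (snd p))"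
        using b by (intro sum.cong refl) (simp add: power_mult_distrib w_def less_imp_le)
      also have "(\<Sum>p\<in>P m. w (fst p) * w (snd p)) *
          (\<Sum>p\<in>P m. (1 / (sqrt (bracket (fst p)) * sqrt (bracket (snd p))))\<^sup>2)
          \<le> (\<Sum>p\<in>P m. w (fst p) * w (snd p)) * C"
        by (rule mult_left_mono[OF tail]) (use b in \<open>auto simp: w_def less_imp_le intro!: sum_nonneg\<close>)
      finally show ?thesis by (simp add: mult.commute)
    qed
    have "(LINT x|torus. (\<psi> x) ^ 4) = (LINT x|torus. (cmod (complex_of_real ((\<psi> x)\<^sup>2)))\<^sup>2)"
      by (simp add: power_mult[symmetric] flip: of_real_power)
    also have "\<dots> = (\<Sum>m\<in>M. (cmod (d m))\<^sup>2)"
      unfolding square by (rule parseval[OF fin(3)])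
    also have "\<dots> \<le> (\<Sum>m\<in>M. C * (\<Sum>p\<in>P m. w (fst p) * w (snd p)))"
      by (rule sum_mono) (rule dm)
    also have "\<dots> = C * (\<Sum>p\<in>K \<times> K. w (fst p) * w (snd p))"
      unfolding M_def P_def sum_distrib_left[symmetric] by (subst sum.image_gen[OF fin(1)]) (rule refl)
    also have "(\<Sum>p\<in>K \<times> K. w (fst p) * w (snd p)) = (\<Sum>k\<in>K. w k)\<^sup>2"
      by (simp add: power2_eq_square sum_product sum.cartesian_product split_def)
    also have "C * (\<Sum>k\<in>K. w k)\<^sup>2 \<le> C * ((l2norm \<psi>)\<^sup>2 + (\<Sum>i\<in>UNIV. (l2norm (partial i \<psi>))\<^sup>2))\<^sup>2"
    proof (intro mult_left_mono power_mono C0 sum_nonneg)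
      show "0 \<le> w k" for k using bracket_ge_1[of k] by (simp add: w_def)
      have "w k \<le> (cmod (c k))\<^sup>2 + (\<Sum>i\<in>UNIV. (2 * pi * of_int (k $ i))\<^sup>2 * (cmod (c k))\<^sup>2)" for k
      proof -
        have "1 \<le> (2 * pi)\<^sup>2" using pi_gt3 by (intro one_le_power) simp
        then have "(real_of_int (k $ i))\<^sup>2 \<le> (2 * pi * of_int (k $ i))\<^sup>2" for i
          using mult_right_mono[of 1 "(2 * pi)\<^sup>2" "(real_of_int (k $ i))\<^sup>2"] by (simp add: power_mult_distrib)
        then have "bracket k \<le> 1 + (\<Sum>i\<in>UNIV. (2 * pi * of_int (k $ i))\<^sup>2)"
          unfolding bracket_def by (intro add_left_mono sum_mono)
        then have "w k \<le> (1 + (\<Sum>i\<in>UNIV. (2 * pi * of_int (k $ i))\<^sup>2)) * (cmod (c k))\<^sup>2"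
          unfolding w_def by (rule mult_right_mono) simp
        then show ?thesis by (simp add: distrib_right sum_distrib_right)
      qed
      then have "(\<Sum>k\<in>K. w k) \<le> (\<Sum>k\<in>K. (cmod (c k))\<^sup>2 + (\<Sum>i\<in>UNIV. (2 * pi * of_int (k $ i))\<^sup>2 * (cmod (c k))\<^sup>2))"
        by (rule sum_mono)
      then show "(\<Sum>k\<in>K. w k) \<le> (l2norm \<psi>)\<^sup>2 + (\<Sum>i\<in>UNIV. (l2norm (partial i \<psi>))\<^sup>2)"
        unfolding l2norm_fourier[OF K] sum.distrib by (simp only: sum.swap[of _ "UNIV :: 3 set" K])
    qed
    finally show ?thesis .
  qed
  then show ?thesis using C0 by blast
qed

subsection \<open>Boundedness of functions in \<open>H\<^sup>2\<close>\<close>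

text \<open>
  In the usual convention this is the coefficient of index \<open>-k\<close>.
\<close>

definition fourier_coeff :: "(real^3 \<Rightarrow> real) \<Rightarrow> int^3 \<Rightarrow> complex" where
  "fourier_coeff g k = (LINT x|torus. fourier k x * complex_of_real (g x))"

lemma fourier_coeff_integrable:
  assumes "L2 g" shows "integrable torus (\<lambda>x. fourier k x * complex_of_real (g x))"
proof (rule Bochner_Integration.integrable_bound[OF L2_integrable[OF assms]])
  show "(\<lambda>x. fourier k x * complex_of_real (g x)) \<in> borel_measurable torus"
  proof (rule borel_measurable_times[OF continuous_measurable_torus[OF continuous_fourier]])
    show "(\<lambda>x. complex_of_real (g x)) \<in> borel_measurable torus"
      by (rule measurable_compose[OF L2_measurable[OF assms] borel_measurable_continuous_onI])
         (intro continuous_intros)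
  qed
qed (simp add: norm_mult)

text \<open>
  Pairing \<open>g\<close> with the polynomial \<open>T\<close> that has the conjugate coefficients gives the sum of squares on one
  side, and by Parseval at most its square root times the norm of \<open>g\<close> on the other.
\<close>

lemma bessel:
  assumes g: "L2 g" and K: "finite K" shows "(\<Sum>k\<in>K. (cmod (fourier_coeff g k))\<^sup>2) \<le> (l2norm g)\<^sup>2"
proof -
  let ?S = "\<Sum>k\<in>K. (cmod (fourier_coeff g k))\<^sup>2"
  define T where "T x = (\<Sum>k\<in>K. cnj (fourier_coeff g k) * fourier k x)" for x
  have T: "continuous_on UNIV T" unfolding T_def by (intro continuous_intros)
  have LT: "L2 (\<lambda>x. Re (T x))" by (intro L2_continuous continuous_intros T)
  have "complex_of_real ?S = (\<Sum>k\<in>K. cnj (fourier_coeff g k) * fourier_coeff g k)"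
    unfolding of_real_sum complex_norm_square by (simp add: mult.commute)
  also have "\<dots> = (\<Sum>k\<in>K. (LINT x|torus. cnj (fourier_coeff g k) * (fourier k x * complex_of_real (g x))))"
    by (rule sum.cong) (simp_all add: fourier_coeff_def)
  also have "\<dots> = (LINT x|torus. (\<Sum>k\<in>K. cnj (fourier_coeff g k) * (fourier k x * complex_of_real (g x))))"
    by (rule Bochner_Integration.integral_sum[symmetric]) (intro integrable_mult_right fourier_coeff_integrable g)
  also have "\<dots> = (LINT x|torus. T x * complex_of_real (g x))"
    unfolding T_def sum_distrib_right mult.assoc ..
  finally have eq: "complex_of_real ?S = (LINT x|torus. T x * complex_of_real (g x))" .
  have "integrable torus (\<lambda>x. T x * complex_of_real (g x))"
    unfolding T_def sum_distrib_right mult.assoc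
    by (intro Bochner_Integration.integrable_sum integrable_mult_right fourier_coeff_integrable g)
  then have "(LINT x|torus. Re (T x * complex_of_real (g x))) = Re (LINT x|torus. T x * complex_of_real (g x))"
    by (rule integral_Re)
  then have "?S = (LINT x|torus. Re (T x * complex_of_real (g x)))"
    by (simp only: eq[symmetric] Re_complex_of_real)
  also have "\<dots> = ip (\<lambda>x. Re (T x)) g" by (simp add: ip_def)
  also have "\<dots> \<le> l2norm (\<lambda>x. Re (T x)) * l2norm g"
    using ip_Cauchy_Schwarz[OF LT g] by linarith
  also have "l2norm (\<lambda>x. Re (T x)) \<le> l2norm T"
    using L2_measurable[OF LT] by (intro l2norm_mono_AE L2_continuous T) (auto simp: abs_Re_le_cmod)
  also have "l2norm T = sqrt (\<Sum>k\<in>K. (cmod (cnj (fourier_coeff g k)))\<^sup>2)"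
    unfolding l2norm_def T_def parseval[OF K] ..
  also have "\<dots> = sqrt ?S" by simp
  finally have le: "?S \<le> sqrt ?S * l2norm g" by (simp add: mult_right_mono)
  have S0: "0 \<le> ?S" by (rule sum_nonneg) simp
  show ?thesis
  proof (cases "?S = 0")
    case False
    then have "sqrt ?S * sqrt ?S \<le> sqrt ?S * l2norm g" "0 < sqrt ?S" using S0 le by auto
    then have "sqrt ?S \<le> l2norm g" by (rule mult_left_le_imp_le)
    then have "(sqrt ?S)\<^sup>2 \<le> (l2norm g)\<^sup>2" using S0 by (intro power_mono) auto
    then show ?thesis using S0 by simp
  qed simp
qed

lemma fourier_coeff_second_derivative:
  assumes "L2 g" "L2 g'" "L2 g''" "weak_partial i g g'" "weak_partial i g' g''"
  shows "of_real ((2 * pi * of_int (k $ i))\<^sup>2) * fourier_coeff g k = - fourier_coeff g'' k"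
proof -
  have twice: "(LINT x|torus. partial i (partial i \<psi>) x * g x) = (LINT x|torus. \<psi> x * g'' x)"
    if "trig_poly \<psi>" for \<psi> :: "real^3 \<Rightarrow> real"
    using assms(4,5) that trig_poly_partial[OF that, of i] unfolding weak_partial_def by simp
  have c: "partial i (\<lambda>x. cos (freq k x)) = (\<lambda>x. - (2 * pi * of_int (k $ i)) * sin (freq k x))"
    and s: "partial i (\<lambda>x. sin (freq k x)) = (\<lambda>x. (2 * pi * of_int (k $ i)) * cos (freq k x))"
    using partial_trig[where i = i and K = "{k}" and a = "\<lambda>_. 1 :: real" and b = "\<lambda>_. 0"]
      partial_trig[where i = i and K = "{k}" and a = "\<lambda>_. 0 :: real" and b = "\<lambda>_. 1"]
    by (simp_all add: mult.commute)
  have cc: "partial i (partial i (\<lambda>x. cos (freq k x))) = (\<lambda>x. - ((2 * pi * of_int (k $ i))\<^sup>2 * cos (freq k x)))"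
  proof
    fix x show "partial i (partial i (\<lambda>x. cos (freq k x))) x = - ((2 * pi * of_int (k $ i))\<^sup>2 * cos (freq k x))"
      unfolding c using partial_scaleR[OF trig_poly_sin, of i "- (2 * pi * of_int (k $ i))" k x]
      by (simp add: s power2_eq_square)
  qed
  have ss: "partial i (partial i (\<lambda>x. sin (freq k x))) = (\<lambda>x. - ((2 * pi * of_int (k $ i))\<^sup>2 * sin (freq k x)))"
  proof
    fix x show "partial i (partial i (\<lambda>x. sin (freq k x))) x = - ((2 * pi * of_int (k $ i))\<^sup>2 * sin (freq k x))"
      unfolding s using partial_scaleR[OF trig_poly_cos, of i "2 * pi * of_int (k $ i)" k x]
      by (simp add: c power2_eq_square)
  qed
  have re: "Re (fourier_coeff h k) = (LINT x|torus. cos (freq k x) * h x)"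
    and im: "Im (fourier_coeff h k) = (LINT x|torus. sin (freq k x) * h x)" if "L2 h" for h
    unfolding fourier_coeff_def using fourier_coeff_integrable[OF that]
    by (simp_all add: fourier_def flip: integral_Re integral_Im)
  have "(2 * pi * of_int (k $ i))\<^sup>2 * (LINT x|torus. cos (freq k x) * g x) = - (LINT x|torus. cos (freq k x) * g'' x)"
    unfolding twice[OF trig_poly_cos, symmetric] cc by (simp add: mult.assoc)
  moreover have "(2 * pi * of_int (k $ i))\<^sup>2 * (LINT x|torus. sin (freq k x) * g x) = - (LINT x|torus. sin (freq k x) * g'' x)"
    unfolding twice[OF trig_poly_sin, symmetric] ss by (simp add: mult.assoc)
  ultimately show ?thesis
    by (simp add: complex_eq_iff re im assms(1,3))
qed

text \<open>
  The weak second derivatives make the coefficients of \<open>g\<close>, weighted with \<open>1 + \<bar>k\<bar>\<^sup>2\<close>, square summable.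
  By the Cauchy-Schwarz inequality they are summable, and their sum bounds the pairing of \<open>g\<close> with a
  polynomial in terms of its norm in \<open>L\<^sup>1\<close>. This avoids the convergence of Fourier series.
\<close>

lemma bounded_of_second_derivatives:
  "\<exists>C\<ge>0. \<forall>(g :: real^3 \<Rightarrow> real) g' g''. L2 g \<and> (\<forall>i. L2 (g' i) \<and> L2 (g'' i) \<and>
      weak_partial i g (g' i) \<and> weak_partial i (g' i) (g'' i)) \<longrightarrow>
    (AE x in torus. \<bar>g x\<bar> \<le> C * (l2norm g + (\<Sum>i\<in>UNIV. l2norm (g'' i))))"
proof -
  obtain C where C0: "0 \<le> C" and C: "\<And>K. finite K \<Longrightarrow> (\<Sum>k\<in>K. 1 / (bracket k)\<^sup>2) \<le> C"
    using lattice_sum_bounded by blast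
  have "AE x in torus. \<bar>g x\<bar> \<le> sqrt C * (l2norm g + (\<Sum>i\<in>UNIV. l2norm (g'' i)))"
    if g: "L2 g" and g': "\<And>i. L2 (g' i)" "\<And>i. L2 (g'' i)"
      "\<And>i. weak_partial i g (g' i)" "\<And>i. weak_partial i (g' i) (g'' i)"
    for g :: "real^3 \<Rightarrow> real" and g' g'' :: "3 \<Rightarrow> real^3 \<Rightarrow> real"
  proof (rule bounded_AE_by_duality)
    let ?N = "l2norm g + (\<Sum>i\<in>UNIV. l2norm (g'' i))"
    have sum: "(\<Sum>k\<in>K. cmod (fourier_coeff g k)) \<le> sqrt C * ?N" if K: "finite K" for K
    proof -
      have b: "bracket k > 0" for k using bracket_ge_1[of k] by linarith
      have coeff: "bracket k * cmod (fourier_coeff g k)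
          \<le> cmod (fourier_coeff g k) + (\<Sum>i\<in>UNIV. cmod (fourier_coeff (g'' i) k))" for k
      proof -
        have "(real_of_int (k $ i))\<^sup>2 * cmod (fourier_coeff g k) \<le> cmod (fourier_coeff (g'' i) k)" for i
        proof -
          have "1 \<le> (2 * pi)\<^sup>2" using pi_gt3 by (intro one_le_power) simp
          then have "(real_of_int (k $ i))\<^sup>2 \<le> (2 * pi * of_int (k $ i))\<^sup>2"
            using mult_right_mono[of 1 "(2 * pi)\<^sup>2" "(real_of_int (k $ i))\<^sup>2"] by (simp add: power_mult_distrib)
          then have "(real_of_int (k $ i))\<^sup>2 * cmod (fourier_coeff g k)
              \<le> (2 * pi * of_int (k $ i))\<^sup>2 * cmod (fourier_coeff g k)" by (rule mult_right_mono) simp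
          also have "\<dots> = cmod (of_real ((2 * pi * of_int (k $ i))\<^sup>2) * fourier_coeff g k)"
            by (simp only: norm_mult norm_of_real abs_power2)
          also have "\<dots> = cmod (fourier_coeff (g'' i) k)"
            unfolding fourier_coeff_second_derivative[OF g g'] by simp
          finally show ?thesis .
        qed
        then have "(\<Sum>i\<in>UNIV. (real_of_int (k $ i))\<^sup>2 * cmod (fourier_coeff g k))
            \<le> (\<Sum>i\<in>UNIV. cmod (fourier_coeff (g'' i) k))" by (rule sum_mono)
        then show ?thesis by (simp add: bracket_def distrib_right sum_distrib_right)
      qed
      have bess: "L2_set (\<lambda>k. cmod (fourier_coeff h k)) K \<le> l2norm h" if "L2 h" for h
        unfolding L2_set_def using bessel[OF that K] by (simp add: real_le_lsqrt sum_nonneg)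
      have tri: "L2_set (\<lambda>k. \<Sum>i\<in>I. f i k) K \<le> (\<Sum>i\<in>I. L2_set (f i) K)" if "finite I"
        for I :: "3 set" and f :: "3 \<Rightarrow> int^3 \<Rightarrow> real"
        using that
        by (induction I rule: finite_induct)
           (auto simp: L2_set_def intro: order_trans[OF L2_set_triangle_ineq[unfolded L2_set_def]])
      have "(\<Sum>k\<in>K. cmod (fourier_coeff g k)) = (\<Sum>k\<in>K. (1 / bracket k) * (bracket k * cmod (fourier_coeff g k)))"
        using b by (intro sum.cong) (simp_all add: less_imp_neq[symmetric])
      also have "\<dots> = (\<Sum>k\<in>K. \<bar>1 / bracket k\<bar> * \<bar>bracket k * cmod (fourier_coeff g k)\<bar>)"
        using b by (intro sum.cong) (simp_all add: abs_mult less_imp_le)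
      also have "\<dots> \<le> L2_set (\<lambda>k. 1 / bracket k) K * L2_set (\<lambda>k. bracket k * cmod (fourier_coeff g k)) K"
        by (rule L2_set_mult_ineq)
      also have "\<dots> \<le> sqrt C * ?N"
      proof (rule mult_mono)
        show "L2_set (\<lambda>k. 1 / bracket k) K \<le> sqrt C"
          unfolding L2_set_def using C[OF K] by (intro real_sqrt_le_mono) (simp add: power_divide)
        have "L2_set (\<lambda>k. bracket k * cmod (fourier_coeff g k)) K \<le>
            L2_set (\<lambda>k. cmod (fourier_coeff g k) + (\<Sum>i\<in>UNIV. cmod (fourier_coeff (g'' i) k))) K"
          using b by (intro L2_set_mono coeff) (simp add: less_imp_le)
        also have "\<dots> \<le> L2_set (\<lambda>k. cmod (fourier_coeff g k)) K + L2_set (\<lambda>k. \<Sum>i\<in>UNIV. cmod (fourier_coeff (g'' i) k)) K"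
          by (rule L2_set_triangle_ineq)
        also have "\<dots> \<le> l2norm g + (\<Sum>i\<in>UNIV. L2_set (\<lambda>k. cmod (fourier_coeff (g'' i) k)) K)"
          by (intro add_mono bess g tri) simp
        also have "\<dots> \<le> ?N" by (intro add_left_mono sum_mono bess g')
        finally show "L2_set (\<lambda>k. bracket k * cmod (fourier_coeff g k)) K \<le> ?N" .
      qed (use C0 in \<open>auto intro: L2_set_nonneg\<close>)
      finally show ?thesis .
    qed
    show "integrable torus g" by (rule L2_integrable[OF g])
    show "0 \<le> sqrt C * ?N" using C0 by (auto intro!: mult_nonneg_nonneg add_nonneg_nonneg sum_nonneg)
    fix \<psi> :: "real^3 \<Rightarrow> real" assume \<psi>: "trig_poly \<psi>"
    obtain K c where K: "finite K" "\<And>x. complex_of_real (\<psi> x) = (\<Sum>k\<in>K. c k * fourier k x)"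
      using trig_poly_coefficients[OF \<psi>] by blast
    have c: "cmod (c k) \<le> (LINT x|torus. \<bar>\<psi> x\<bar>)" if "k \<in> K" for k
      unfolding fourier_coefficient[OF K that]
      by (rule order_trans[OF integral_norm_bound]) (simp add: norm_mult)
    have "complex_of_real (LINT x|torus. \<psi> x * g x) = (LINT x|torus. complex_of_real (\<psi> x) * complex_of_real (g x))"
      by (simp flip: integral_complex_of_real)
    also have "\<dots> = (LINT x|torus. (\<Sum>k\<in>K. c k * (fourier k x * complex_of_real (g x))))"
      unfolding K(2) by (simp add: sum_distrib_right mult.assoc)
    also have "\<dots> = (\<Sum>k\<in>K. c k * fourier_coeff g k)"
      by (subst Bochner_Integration.integral_sum)
         (intro integrable_mult_right fourier_coeff_integrable g, simp add: fourier_coeff_def)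
    finally have "\<bar>LINT x|torus. \<psi> x * g x\<bar> = cmod (\<Sum>k\<in>K. c k * fourier_coeff g k)"
      by (metis norm_of_real)
    also have "\<dots> \<le> (\<Sum>k\<in>K. (LINT x|torus. \<bar>\<psi> x\<bar>) * cmod (fourier_coeff g k))"
      by (rule order_trans[OF norm_sum]) (auto simp: norm_mult intro!: sum_mono mult_right_mono c)
    also have "\<dots> = (LINT x|torus. \<bar>\<psi> x\<bar>) * (\<Sum>k\<in>K. cmod (fourier_coeff g k))"
      by (simp add: sum_distrib_left)
    also have "\<dots> \<le> (LINT x|torus. \<bar>\<psi> x\<bar>) * (sqrt C * ?N)"
      by (intro mult_left_mono sum K) (simp add: integral_nonneg_AE)
    finally show "\<bar>LINT x|torus. \<psi> x * g x\<bar> \<le> sqrt C * ?N * (LINT x|torus. \<bar>\<psi> x\<bar>)"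
      by (simp add: mult.commute)
  qed
  then show ?thesis using C0 by (intro exI[of _ "sqrt C"]) auto
qed

lemma l2norm_nth_le: "L2 f \<Longrightarrow> l2norm (\<lambda>x. f x $ c) \<le> l2norm f" for f :: "real^3 \<Rightarrow> real^'n"
  by (rule l2norm_mono_AE) (auto intro: L2_measurable L2_nth simp: component_le_norm_cart)

lemma sobolev_2_bounded:
  "\<exists>C\<ge>0. \<forall>g :: field. sobolev 2 g \<longrightarrow> (AE x in torus. norm (g x) \<le> C * sobnorm 2 g)"
proof -
  obtain C where C0: "0 \<le> C" and C: "\<And>(g :: real^3 \<Rightarrow> real) g' g''. L2 g \<Longrightarrow> (\<And>i. L2 (g' i) \<and> L2 (g'' i) \<and>
      weak_partial i g (g' i) \<and> weak_partial i (g' i) (g'' i)) \<Longrightarrow>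
    (AE x in torus. \<bar>g x\<bar> \<le> C * (l2norm g + (\<Sum>i\<in>UNIV. l2norm (g'' i))))"
    using bounded_of_second_derivatives by metis
  have "AE x in torus. norm (g x) \<le> 12 * C * sobnorm 2 g" if "sobolev 2 g" for g :: field
  proof -
    have g2: "sobolev (Suc (Suc 0)) g" using that by (simp add: numeral_2_eq_2)
    have g1: "sobolev 1 g" by (rule sobolev_one[OF g2])
    have gi: "sobolev 1 (wd i g)" for i using sobolev_wd[OF g2] by simp
    have N: "sobnorm 2 g = sobnorm (Suc (Suc 0)) g" by (simp add: numeral_2_eq_2)
    have l: "L2 g" "L2 (wd i g)" "L2 (wd i (wd i g))" for i
      using g1 gi wd_L2 sobolev_L2 by blast+
    have "AE x in torus. \<forall>c\<in>UNIV. \<bar>g x $ c\<bar> \<le> 4 * C * sobnorm 2 g"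
    proof (rule AE_finite_allI)
      fix c :: 3
      have "AE x in torus. \<bar>g x $ c\<bar> \<le> C * (l2norm (\<lambda>x. g x $ c) + (\<Sum>i\<in>UNIV. l2norm (\<lambda>x. wd i (wd i g) x $ c)))"
        by (rule C[of _ "\<lambda>i x. wd i g x $ c"]) (intro conjI L2_nth weak_partial_nth wd_weak g1 gi l)+
      moreover have "l2norm (\<lambda>x. g x $ c) \<le> sobnorm 2 g"
        by (rule order_trans[OF l2norm_nth_le l2norm_le_sobnorm]) (rule l)
      moreover have "l2norm (\<lambda>x. wd i (wd i g) x $ c) \<le> sobnorm 2 g" for i
      proof -
        have "l2norm (\<lambda>x. wd i (wd i g) x $ c) \<le> sobnorm 0 (wd i (wd i g))"
          using l2norm_nth_le[OF l(3)] by simp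
        also have "\<dots> \<le> sobnorm 2 g"
          unfolding N using sobnorm_wd_le[of 0 i "wd i g"] sobnorm_wd_le[of "Suc 0" i g] by linarith
        finally show ?thesis .
      qed
      ultimately have "AE x in torus. \<bar>g x $ c\<bar> \<le> C * (sobnorm 2 g + (\<Sum>i\<in>(UNIV :: 3 set). sobnorm 2 g))"
        using C0 by (elim eventually_mono)
          (auto elim!: order_trans intro!: mult_left_mono add_mono sum_mono simp del: sum_constant)
      then show "AE x in torus. \<bar>g x $ c\<bar> \<le> 4 * C * sobnorm 2 g" by (simp add: algebra_simps)
    qed simp
    then show ?thesis
    proof eventually_elim
      case (elim x)
      have "norm (g x) \<le> (\<Sum>c\<in>UNIV. \<bar>g x $ c\<bar>)" by (rule norm_le_l1_cart)
      also have "\<dots> \<le> (\<Sum>c\<in>(UNIV :: 3 set). 4 * C * sobnorm 2 g)" using elim by (intro sum_mono) auto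
      finally show ?case by simp
    qed
  qed
  then show ?thesis using C0 by (intro exI[of _ "12 * C"]) auto
qed

section \<open>The space \<open>V\<close>\<close>

lemma polys_trig: "\<phi> \<in> solenoidal_polys \<Longrightarrow> trig_poly \<phi>"
  by (simp add: solenoidal_polys_def)

lemma polys_div: "\<phi> \<in> solenoidal_polys \<Longrightarrow> (\<Sum>i\<in>UNIV. partial i \<phi> x $ i) = 0"
  by (simp add: solenoidal_polys_def)

lemma polys_add:
  assumes "\<phi> \<in> solenoidal_polys" "\<psi> \<in> solenoidal_polys"
  shows "(\<lambda>x. \<phi> x + \<psi> x) \<in> solenoidal_polys"
proof -
  have t: "trig_poly \<phi>" "trig_poly \<psi>" using assms polys_trig by auto
  have "(LINT x|torus. \<phi> x + \<psi> x) = 0"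
    using assms Bochner_Integration.integral_add[OF t[THEN trig_poly_L2, THEN L2_integrable]]
    by (simp add: solenoidal_polys_def)
  then show ?thesis
    using assms t trig_poly_add[OF t]
    by (simp add: solenoidal_polys_def partial_add sum.distrib)
qed

lemma polys_scaleR:
  assumes "\<phi> \<in> solenoidal_polys" shows "(\<lambda>x. c *\<^sub>R \<phi> x) \<in> solenoidal_polys"
proof -
  have t: "trig_poly \<phi>" using assms polys_trig by auto
  show ?thesis
    using assms t trig_poly_scaleR[OF t]
    by (simp add: solenoidal_polys_def partial_scaleR flip: sum_distrib_left)
qed

text \<open>
  The Laplacian of a test field is again a test field, so that it can be inserted into the equations.
\<close>

lemma polys_laplacian:
  assumes \<phi>: "\<phi> \<in> solenoidal_polys"
  shows "(\<lambda>x. \<Sum>j\<in>UNIV. partial j (partial j \<phi>) x) \<in> solenoidal_polys"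
proof -
  have t: "trig_poly \<phi>" "trig_poly (partial i \<phi>)" "trig_poly (partial j (partial i \<phi>))" for i j
    using \<phi> polys_trig trig_poly_partial by blast+
  have p: "partial i (\<lambda>x. \<Sum>j\<in>UNIV. partial j (partial j \<phi>) x) x = (\<Sum>j\<in>UNIV. partial j (partial j (partial i \<phi>)) x)" for i x
  proof -
    have "partial i (partial j (partial j \<phi>)) = partial j (partial j (partial i \<phi>))" for j
      using partial_commute[OF t(2), of i j j] partial_commute[OF t(1), of i j] by simp
    then show ?thesis by (simp add: partial_sum t)
  qed
  have "(\<Sum>i\<in>UNIV. partial i (\<lambda>x. \<Sum>j\<in>UNIV. partial j (partial j \<phi>) x) x $ i) = 0" for x
  proof -
    have "(\<Sum>i\<in>UNIV. partial i (\<lambda>x. \<Sum>j\<in>UNIV. partial j (partial j \<phi>) x) x $ i)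
        = (\<Sum>j\<in>UNIV. \<Sum>i\<in>UNIV. partial j (partial j (partial i \<phi>)) x $ i)"
      unfolding p sum_component by (rule sum.swap)
    also have "\<dots> = (\<Sum>j\<in>UNIV. partial j (partial j (\<lambda>x. \<Sum>i\<in>UNIV. partial i \<phi> x $ i)) x)"
    proof (rule sum.cong[OF refl])
      fix j :: 3
      have n: "trig_poly (\<lambda>x. partial i \<phi> x $ i)" "trig_poly (partial j (\<lambda>x. partial i \<phi> x $ i))" for i
        by (intro trig_poly_nth trig_poly_partial t)+
      have "partial j (\<lambda>x. \<Sum>i\<in>UNIV. partial i \<phi> x $ i) = (\<lambda>x. \<Sum>i\<in>UNIV. partial j (\<lambda>x. partial i \<phi> x $ i) x)"
        by (rule ext) (rule partial_sum, simp_all add: n)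
      then have "partial j (partial j (\<lambda>x. \<Sum>i\<in>UNIV. partial i \<phi> x $ i)) x
          = (\<Sum>i\<in>UNIV. partial j (partial j (\<lambda>x. partial i \<phi> x $ i)) x)"
        by (simp add: partial_sum n)
      also have "\<dots> = (\<Sum>i\<in>UNIV. partial j (partial j (partial i \<phi>)) x $ i)"
      proof (rule sum.cong[OF refl])
        fix i
        have "partial j (\<lambda>x. partial i \<phi> x $ i) = (\<lambda>x. partial j (partial i \<phi>) x $ i)"
          by (rule ext) (rule partial_nth[OF t(2)])
        then show "partial j (partial j (\<lambda>x. partial i \<phi> x $ i)) x = partial j (partial j (partial i \<phi>)) x $ i"
          by (simp add: partial_nth t)
      qed
      finally show "(\<Sum>i\<in>UNIV. partial j (partial j (partial i \<phi>)) x $ i) =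
          partial j (partial j (\<lambda>x. \<Sum>i\<in>UNIV. partial i \<phi> x $ i)) x" ..
    qed
    also have "\<dots> = 0"
    proof -
      have z: "partial j (\<lambda>x. 0 :: real) = (\<lambda>x. 0)" for j by (rule ext) (rule partial_const)
      show ?thesis by (simp add: polys_div[OF \<phi>] z)
    qed
    finally show ?thesis .
  qed
  moreover have "(LINT x|torus. (\<Sum>j\<in>UNIV. partial j (partial j \<phi>) x)) = 0"
    by (subst Bochner_Integration.integral_sum)
       (simp_all add: integral_partial_zero t L2_integrable[OF trig_poly_L2])
  moreover have "trig_poly (\<lambda>x. \<Sum>j\<in>UNIV. partial j (partial j \<phi>) x)"
    by (intro trig_poly_sum t) simp
  ultimately show ?thesis by (simp add: solenoidal_polys_def)
qed

lemma l2norm_square_fields: "L2 f \<Longrightarrow> (l2norm f)\<^sup>2 = (\<Sum>c\<in>UNIV. (l2norm (\<lambda>x. f x $ c))\<^sup>2)"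
  for f :: "real^3 \<Rightarrow> real^'n"
  by (simp add: l2norm_square ip_fields)

lemma Vnorm_nonneg [simp]: "0 \<le> Vnorm u"
  by (simp add: Vnorm_def sum_nonneg)

lemma Vnorm_square: "(Vnorm u)\<^sup>2 = (\<Sum>i\<in>UNIV. (l2norm (wd i u))\<^sup>2)"
  by (simp add: Vnorm_def sum_nonneg)

lemma sobnorm_1_square: "(sobnorm 1 u)\<^sup>2 = (l2norm u)\<^sup>2 + (Vnorm u)\<^sup>2"
  unfolding One_nat_def sobnorm_Suc_square Vnorm_square by simp

lemma l2norm_wd_le_Vnorm: "l2norm (wd i u) \<le> Vnorm u"
proof -
  have "(l2norm (wd i u))\<^sup>2 \<le> (Vnorm u)\<^sup>2"
    unfolding Vnorm_square by (rule member_le_sum) auto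
  then show ?thesis by (rule power2_le_imp_le) simp
qed

lemma Vnorm_le_sobnorm: "Vnorm u \<le> sobnorm 1 u"
proof -
  have "(Vnorm u)\<^sup>2 \<le> (sobnorm 1 u)\<^sup>2" unfolding sobnorm_1_square by simp
  then show ?thesis by (rule power2_le_imp_le) (rule sobnorm_nonneg)
qed

lemma Vnorm_triangle:
  assumes "sobolev 1 u" "sobolev 1 v" shows "Vnorm (\<lambda>x. u x + v x) \<le> Vnorm u + Vnorm v"
proof -
  have "l2norm (wd i (\<lambda>x. u x + v x)) \<le> l2norm (wd i u) + l2norm (wd i v)" for i
  proof -
    have "l2norm (wd i (\<lambda>x. u x + v x)) = l2norm (\<lambda>x. wd i u x + wd i v x)"
      by (intro l2norm_cong_AE wd_add L2_measurable L2_add wd_L2 sobolev_add assms)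
    then show ?thesis using l2norm_triangle[OF wd_L2 wd_L2] assms by simp
  qed
  then show ?thesis
    using sqrt_sum_triangle[where c = 0 and a = 0 and b = 0 and A = UNIV
        and h = "\<lambda>i. l2norm (wd i (\<lambda>x. u x + v x))" and f = "\<lambda>i. l2norm (wd i u)" and g = "\<lambda>i. l2norm (wd i v)"]
    by (simp add: Vnorm_def)
qed

lemma Vnorm_scaleR: assumes "sobolev 1 u" shows "Vnorm (\<lambda>x. c *\<^sub>R u x) = \<bar>c\<bar> * Vnorm u"
proof -
  have "l2norm (wd i (\<lambda>x. c *\<^sub>R u x)) = \<bar>c\<bar> * l2norm (wd i u)" for i
  proof -
    have "l2norm (wd i (\<lambda>x. c *\<^sub>R u x)) = l2norm (\<lambda>x. c *\<^sub>R wd i u x)"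
      by (intro l2norm_cong_AE wd_scaleR L2_measurable L2_scaleR wd_L2 sobolev_scaleR assms)
    then show ?thesis by (simp add: l2norm_scaleR)
  qed
  then have "(Vnorm (\<lambda>x. c *\<^sub>R u x))\<^sup>2 = (\<bar>c\<bar> * Vnorm u)\<^sup>2"
    unfolding power_mult_distrib Vnorm_square by (simp add: power_mult_distrib sum_distrib_left)
  then show ?thesis by (rule power2_eq_imp_eq) simp_all
qed

lemma Vnorm_diff_commute:
  assumes "sobolev 1 u" "sobolev 1 v" shows "Vnorm (\<lambda>x. u x - v x) = Vnorm (\<lambda>x. v x - u x)"
  using Vnorm_scaleR[OF sobolev_diff[OF assms], of "-1"] by simp

lemma Vnorm_diff_triangle:
  assumes "sobolev 1 u" "sobolev 1 v" shows "Vnorm (\<lambda>x. u x - v x) \<le> Vnorm u + Vnorm v"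
  using Vnorm_triangle[OF assms(1) sobolev_scaleR[OF assms(2)], of "-1"] Vnorm_scaleR[OF assms(2), of "-1"]
  by simp

lemma Vnorm_cong_AE:
  assumes "sobolev 1 f" "AE x in torus. f x = g x" "g \<in> borel_measurable torus"
  shows "Vnorm f = Vnorm g"
proof -
  have g: "sobolev 1 g" by (rule sobolev_cong_AE[OF assms])
  have "l2norm (wd i f) = l2norm (wd i g)" for i
    by (intro l2norm_cong_AE wd_cong_AE L2_measurable wd_L2 assms g)
  then show ?thesis by (simp add: Vnorm_def)
qed

lemma Vspace_sobolev: "u \<in> Vspace \<Longrightarrow> sobolev 1 u"
  by (simp add: Vspace_def del: One_nat_def)

lemma Vspace_L2: "u \<in> Vspace \<Longrightarrow> L2 u"
  using Vspace_sobolev sobolev_L2 by blast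

lemma Vspace_approx:
  assumes "u \<in> Vspace" "0 < e" obtains \<phi> where "\<phi> \<in> solenoidal_polys" "sobnorm 1 (\<lambda>x. u x - \<phi> x) < e"
  using assms unfolding Vspace_def by blast

lemma polys_Vspace: assumes "\<phi> \<in> solenoidal_polys" shows "\<phi> \<in> Vspace"
proof -
  have "sobnorm 1 (\<lambda>x. \<phi> x - \<phi> x) = \<bar>0\<bar> * sobnorm 1 \<phi>"
    using sobnorm_scaleR[OF sobolev_trig[OF polys_trig[OF assms]], of 1 0] by (simp del: One_nat_def)
  then show ?thesis
    using assms sobolev_trig[OF polys_trig[OF assms], of 1] unfolding Vspace_def
    by (auto simp del: One_nat_def intro!: bexI[of _ \<phi>])
qed

lemma Vspace_add: assumes "u \<in> Vspace" "v \<in> Vspace" shows "(\<lambda>x. u x + v x) \<in> Vspace"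
proof -
  note s = assms[THEN Vspace_sobolev]
  have "\<exists>\<phi>\<in>solenoidal_polys. sobnorm 1 (\<lambda>x. (u x + v x) - \<phi> x) < e" if e: "e > 0" for e
  proof -
    obtain \<phi> where \<phi>: "\<phi> \<in> solenoidal_polys" "sobnorm 1 (\<lambda>x. u x - \<phi> x) < e / 2"
      using Vspace_approx[OF assms(1), of "e / 2"] half_gt_zero[OF e] by blast
    obtain \<psi> where \<psi>: "\<psi> \<in> solenoidal_polys" "sobnorm 1 (\<lambda>x. v x - \<psi> x) < e / 2"
      using Vspace_approx[OF assms(2), of "e / 2"] half_gt_zero[OF e] by blast
    have "sobnorm 1 (\<lambda>x. (u x - \<phi> x) + (v x - \<psi> x)) \<le> sobnorm 1 (\<lambda>x. u x - \<phi> x) + sobnorm 1 (\<lambda>x. v x - \<psi> x)"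
      by (intro sobnorm_triangle sobolev_diff s sobolev_trig polys_trig \<phi> \<psi>)
    also have "\<dots> < e" using \<phi>(2) \<psi>(2) by linarith
    also have "(\<lambda>x. (u x - \<phi> x) + (v x - \<psi> x)) = (\<lambda>x. (u x + v x) - (\<phi> x + \<psi> x))"
      by (simp add: algebra_simps)
    finally show ?thesis using polys_add[OF \<phi>(1) \<psi>(1)] by (rule bexI)
  qed
  then show ?thesis using sobolev_add[OF s] unfolding Vspace_def by blast
qed

lemma Vspace_scaleR: assumes "u \<in> Vspace" shows "(\<lambda>x. c *\<^sub>R u x) \<in> Vspace"
proof -
  note s = Vspace_sobolev[OF assms]
  have "\<exists>\<phi>\<in>solenoidal_polys. sobnorm 1 (\<lambda>x. c *\<^sub>R u x - \<phi> x) < e" if "e > 0" for e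
  proof -
    have pos: "0 < e / (\<bar>c\<bar> + 1)" using that by (simp add: add_nonneg_pos)
    obtain \<phi> where \<phi>: "\<phi> \<in> solenoidal_polys" "sobnorm 1 (\<lambda>x. u x - \<phi> x) < e / (\<bar>c\<bar> + 1)"
      using Vspace_approx[OF assms, of "e / (\<bar>c\<bar> + 1)"] pos by blast
    have "sobnorm 1 (\<lambda>x. c *\<^sub>R (u x - \<phi> x)) = \<bar>c\<bar> * sobnorm 1 (\<lambda>x. u x - \<phi> x)"
      by (intro sobnorm_scaleR sobolev_diff s sobolev_trig polys_trig \<phi>)
    also have "\<dots> \<le> \<bar>c\<bar> * (e / (\<bar>c\<bar> + 1))" using \<phi>(2) by (intro mult_left_mono) auto
    also have "\<dots> < e" using that by (simp add: field_simps)
    finally have "sobnorm 1 (\<lambda>x. c *\<^sub>R u x - c *\<^sub>R \<phi> x) < e" by (simp add: scaleR_diff_right)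
    then show ?thesis using polys_scaleR[OF \<phi>(1)] by (rule bexI)
  qed
  then show ?thesis using sobolev_scaleR[OF s] unfolding Vspace_def by blast
qed

lemma Vspace_diff: "u \<in> Vspace \<Longrightarrow> v \<in> Vspace \<Longrightarrow> (\<lambda>x. u x - v x) \<in> Vspace"
  using Vspace_add[of u "\<lambda>x. (-1) *\<^sub>R v x"] Vspace_scaleR[of v "-1"] by simp

lemma Vspace_L2_approx:
  assumes "u \<in> Vspace" "0 < e"
  obtains \<phi> where "\<phi> \<in> solenoidal_polys" "l2norm (\<lambda>x. u x - \<phi> x) < e" "Vnorm (\<lambda>x. u x - \<phi> x) < e"
proof -
  obtain \<phi> where \<phi>: "\<phi> \<in> solenoidal_polys" "sobnorm 1 (\<lambda>x. u x - \<phi> x) < e"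
    by (rule Vspace_approx[OF assms])
  show thesis
    by (rule that[OF \<phi>(1) order_le_less_trans[OF l2norm_le_sobnorm \<phi>(2)]
          order_le_less_trans[OF Vnorm_le_sobnorm \<phi>(2)]])
qed

text \<open>
  Identities on \<open>V\<close> are proved for polynomials, where classical calculus applies, and extended by
  continuity; \<open>Q\<close> is the difference of the two sides.
\<close>

lemma Vspace_closure:
  assumes u: "u \<in> Vspace"
    and zero: "\<And>\<phi>. \<phi> \<in> solenoidal_polys \<Longrightarrow> Q \<phi> = (0 :: real)"
    and cont: "\<And>\<phi>. \<phi> \<in> solenoidal_polys \<Longrightarrow> \<bar>Q u - Q \<phi>\<bar> \<le> C * (l2norm (\<lambda>x. u x - \<phi> x) + Vnorm (\<lambda>x. u x - \<phi> x))"
  shows "Q u = 0"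
proof (rule ccontr)
  assume ne: "Q u \<noteq> 0"
  define e where "e = \<bar>Q u\<bar> / (2 * (\<bar>C\<bar> + 1))"
  have e: "e > 0" using ne by (simp add: e_def add_nonneg_pos)
  obtain \<phi> where \<phi>: "\<phi> \<in> solenoidal_polys" "l2norm (\<lambda>x. u x - \<phi> x) < e" "Vnorm (\<lambda>x. u x - \<phi> x) < e"
    using Vspace_L2_approx[OF u, of e] e by blast
  have "\<bar>Q u\<bar> \<le> C * (l2norm (\<lambda>x. u x - \<phi> x) + Vnorm (\<lambda>x. u x - \<phi> x))"
    using cont[OF \<phi>(1)] zero[OF \<phi>(1)] by simp
  also have "\<dots> \<le> \<bar>C\<bar> * (l2norm (\<lambda>x. u x - \<phi> x) + Vnorm (\<lambda>x. u x - \<phi> x))"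
    by (intro mult_right_mono) auto
  also have "\<dots> \<le> \<bar>C\<bar> * (2 * e)" using \<phi>(2,3) by (intro mult_left_mono) auto
  also have "\<dots> < (\<bar>C\<bar> + 1) * (2 * e)" using e by simp
  also have "\<dots> = \<bar>Q u\<bar>"
  proof -
    have "2 * \<bar>C\<bar> + 2 \<noteq> 0" by linarith
    then show ?thesis by (simp add: e_def field_simps)
  qed
  finally show False by simp
qed

lemma Vnorm_trig:
  assumes "trig_poly \<phi>" shows "(Vnorm \<phi>)\<^sup>2 = (\<Sum>i\<in>UNIV. (l2norm (partial i \<phi>))\<^sup>2)"
proof -
  have "l2norm (wd i \<phi>) = l2norm (partial i \<phi>)" for i
    by (intro l2norm_cong_AE wd_trig L2_measurable wd_L2 sobolev_trig trig_poly_L2 trig_poly_partial assms)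
  then show ?thesis by (simp add: Vnorm_square)
qed

lemma poincare_polys: assumes \<phi>: "\<phi> \<in> solenoidal_polys" shows "l2norm \<phi> \<le> Vnorm \<phi>"
proof -
  have t: "trig_poly \<phi>" by (rule polys_trig[OF \<phi>])
  have "(l2norm \<phi>)\<^sup>2 = (\<Sum>c\<in>UNIV. (l2norm (\<lambda>x. \<phi> x $ c))\<^sup>2)"
    by (rule l2norm_square_fields[OF trig_poly_L2[OF t]])
  also have "\<dots> \<le> (\<Sum>c\<in>UNIV. \<Sum>i\<in>UNIV. (l2norm (partial i (\<lambda>x. \<phi> x $ c)))\<^sup>2)"
  proof (intro sum_mono poincare_trig trig_poly_nth t)
    fix c
    have "(LINT x|torus. \<phi> x $ c) = (LINT x|torus. \<phi> x) $ c"
      by (rule integral_bounded_linear[OF bounded_linear_vec_nth L2_integrable[OF trig_poly_L2[OF t]]])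
    then show "(LINT x|torus. \<phi> x $ c) = 0" using \<phi> by (simp add: solenoidal_polys_def)
  qed
  also have "\<dots> = (\<Sum>i\<in>UNIV. \<Sum>c\<in>UNIV. (l2norm (\<lambda>x. partial i \<phi> x $ c))\<^sup>2)"
    unfolding partial_nth[OF t, abs_def] by (rule sum.swap)
  also have "\<dots> = (Vnorm \<phi>)\<^sup>2"
    unfolding Vnorm_trig[OF t]
    by (intro sum.cong refl l2norm_square_fields[symmetric] trig_poly_L2 trig_poly_partial t)
  finally show ?thesis by (rule power2_le_imp_le) simp
qed

lemma poincare: assumes u: "u \<in> Vspace" shows "l2norm u \<le> Vnorm u"
proof (rule field_le_epsilon)
  fix e :: real assume "0 < e"
  then obtain \<phi> where \<phi>: "\<phi> \<in> solenoidal_polys" "l2norm (\<lambda>x. u x - \<phi> x) < e / 2" "Vnorm (\<lambda>x. u x - \<phi> x) < e / 2"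
    using Vspace_L2_approx[OF u, of "e / 2"] half_gt_zero[of e] by blast
  note s = Vspace_sobolev[OF u] Vspace_sobolev[OF polys_Vspace[OF \<phi>(1)]]
  have "l2norm u \<le> l2norm (\<lambda>x. u x - \<phi> x) + l2norm \<phi>"
    using l2norm_triangle[OF L2_diff, of u \<phi> \<phi>] sobolev_L2[OF s(1)] sobolev_L2[OF s(2)] by simp
  moreover have "Vnorm \<phi> \<le> Vnorm u + Vnorm (\<lambda>x. u x - \<phi> x)"
    using Vnorm_triangle[OF sobolev_diff[OF s(2,1)] s(1)] Vnorm_diff_commute[OF s] by simp
  ultimately show "l2norm u \<le> Vnorm u + e" using poincare_polys[OF \<phi>(1)] \<phi>(2,3) by linarith
qed

subsection \<open>The embedding into \<open>L\<^sup>4\<close>\<close>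

lemma norm_power4_le: "(norm v) ^ 4 \<le> 3 * (\<Sum>c\<in>UNIV. (v $ c) ^ 4)" for v :: "real^3"
proof -
  have "(norm v) ^ 4 = ((norm v)\<^sup>2)\<^sup>2" by simp
  also have "(norm v)\<^sup>2 = (\<Sum>c\<in>UNIV. (v $ c)\<^sup>2)"
    unfolding power2_norm_eq_inner inner_vec_def by (simp add: power2_eq_square)
  also have "(\<Sum>c\<in>UNIV. (v $ c)\<^sup>2)\<^sup>2 \<le> (\<Sum>c\<in>(UNIV :: 3 set). 1\<^sup>2) * (\<Sum>c\<in>UNIV. ((v $ c)\<^sup>2)\<^sup>2)"
    using Cauchy_Schwarz_ineq_sum[of "\<lambda>_. 1" "\<lambda>c. (v $ c)\<^sup>2" UNIV] by simp
  finally show ?thesis by simp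
qed

lemma L4_polys: "\<exists>C\<ge>0. \<forall>\<phi>\<in>solenoidal_polys. (LINT x|torus. (norm (\<phi> x)) ^ 4) \<le> C * (Vnorm \<phi>) ^ 4"
proof -
  obtain C where C0: "0 \<le> C" and C: "\<And>\<psi> :: real^3 \<Rightarrow> real. trig_poly \<psi> \<Longrightarrow>
    (LINT x|torus. (\<psi> x) ^ 4) \<le> C * ((l2norm \<psi>)\<^sup>2 + (\<Sum>i\<in>UNIV. (l2norm (partial i \<psi>))\<^sup>2))\<^sup>2"
    using L4_trig by blast
  have "(LINT x|torus. (norm (\<phi> x)) ^ 4) \<le> 36 * C * (Vnorm \<phi>) ^ 4" if \<phi>: "\<phi> \<in> solenoidal_polys" for \<phi>
  proof -
    have t: "trig_poly \<phi>" by (rule polys_trig[OF \<phi>])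
    note cont = trig_poly_continuous[OF t]
    have "(LINT x|torus. (norm (\<phi> x)) ^ 4) \<le> (LINT x|torus. 3 * (\<Sum>c\<in>UNIV. (\<phi> x $ c) ^ 4))"
      by (intro integral_mono norm_power4_le continuous_integrable_torus continuous_intros cont)
    also have "\<dots> = 3 * (\<Sum>c\<in>UNIV. (LINT x|torus. (\<phi> x $ c) ^ 4))"
      by (simp add: Bochner_Integration.integral_sum continuous_integrable_torus continuous_intros cont)
    also have "\<dots> \<le> 3 * (\<Sum>c\<in>(UNIV :: 3 set). C * (2 * (Vnorm \<phi>)\<^sup>2)\<^sup>2)"
    proof (intro mult_left_mono sum_mono order_trans[OF C] power_mono C0 trig_poly_nth t)
      fix c
      have "(l2norm (\<lambda>x. \<phi> x $ c))\<^sup>2 \<le> (l2norm \<phi>)\<^sup>2"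
        by (intro power_mono l2norm_nth_le trig_poly_L2 t) simp
      also have "\<dots> \<le> (Vnorm \<phi>)\<^sup>2" by (intro power_mono poincare_polys \<phi>) simp
      finally have 1: "(l2norm (\<lambda>x. \<phi> x $ c))\<^sup>2 \<le> (Vnorm \<phi>)\<^sup>2" .
      have 2: "(\<Sum>i\<in>UNIV. (l2norm (partial i (\<lambda>x. \<phi> x $ c)))\<^sup>2) \<le> (Vnorm \<phi>)\<^sup>2"
        unfolding Vnorm_trig[OF t] partial_nth[OF t, abs_def]
        by (intro sum_mono power_mono l2norm_nth_le trig_poly_L2 trig_poly_partial t) simp
      show "(l2norm (\<lambda>x. \<phi> x $ c))\<^sup>2 + (\<Sum>i\<in>UNIV. (l2norm (partial i (\<lambda>x. \<phi> x $ c)))\<^sup>2) \<le> 2 * (Vnorm \<phi>)\<^sup>2"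
        using 1 2 by linarith
    qed (auto intro!: add_nonneg_nonneg sum_nonneg)
    also have "\<dots> = 36 * C * (Vnorm \<phi>) ^ 4" by (simp add: power_mult_distrib)
    finally show ?thesis .
  qed
  then show ?thesis using C0 by (intro exI[of _ "36 * C"]) auto
qed

text \<open>
  Along a subsequence the approximating polynomials converge almost everywhere, and Fatou's lemma
  carries their bound over to the limit.
\<close>

lemma L4_Vspace:
  "\<exists>C\<ge>0. \<forall>u\<in>Vspace. integrable torus (\<lambda>x. (norm (u x)) ^ 4) \<and> (LINT x|torus. (norm (u x)) ^ 4) \<le> C * (Vnorm u) ^ 4"
proof -
  obtain C where C0: "0 \<le> C" and C: "\<And>\<phi>. \<phi> \<in> solenoidal_polys \<Longrightarrow>
      (LINT x|torus. (norm (\<phi> x)) ^ 4) \<le> C * (Vnorm \<phi>) ^ 4"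
    using L4_polys by blast
  have "integrable torus (\<lambda>x. (norm (u x)) ^ 4) \<and> (LINT x|torus. (norm (u x)) ^ 4) \<le> C * (Vnorm u) ^ 4"
    if u: "u \<in> Vspace" for u
  proof -
    have ex: "\<forall>n::nat. \<exists>\<phi>. \<phi> \<in> solenoidal_polys \<and> l2norm (\<lambda>x. u x - \<phi> x) < 1 / Suc n
        \<and> Vnorm (\<lambda>x. u x - \<phi> x) < 1 / Suc n"
    proof
      fix n
      show "\<exists>\<phi>. \<phi> \<in> solenoidal_polys \<and> l2norm (\<lambda>x. u x - \<phi> x) < 1 / Suc n
          \<and> Vnorm (\<lambda>x. u x - \<phi> x) < 1 / Suc n"
        by (rule Vspace_L2_approx[OF u, of "1 / Suc n"]) auto
    qed
    from choice[OF ex] obtain \<phi> where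
      \<phi>_all: "\<forall>n. \<phi> n \<in> solenoidal_polys \<and> l2norm (\<lambda>x. u x - \<phi> n x) < 1 / Suc n
        \<and> Vnorm (\<lambda>x. u x - \<phi> n x) < 1 / Suc n" ..
    then have \<phi>: "\<phi> n \<in> solenoidal_polys" "l2norm (\<lambda>x. u x - \<phi> n x) < 1 / Suc n"
      "Vnorm (\<lambda>x. u x - \<phi> n x) < 1 / Suc n" for n by simp_all
    have L: "L2 (\<lambda>x. u x - \<phi> n x)" for n
      by (intro L2_diff Vspace_L2 polys_Vspace u \<phi>)
    have inv0: "(\<lambda>n. 1 / real (Suc n)) \<longlonglongrightarrow> 0"
      using LIMSEQ_inverse_real_of_nat by (simp add: inverse_eq_divide)
    have L1: "(LINT x|torus. norm (u x - \<phi> n x)) \<le> 1 / Suc n" for n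
    proof -
      have "ip (\<lambda>x. norm (u x - \<phi> n x)) (\<lambda>x. 1) \<le> l2norm (\<lambda>x. norm (u x - \<phi> n x)) * l2norm (\<lambda>x. 1 :: real)"
        using ip_Cauchy_Schwarz[OF L2_norm[OF L[of n]] L2_continuous[OF continuous_on_const, of "1 :: real"]] by linarith
      moreover have "l2norm (\<lambda>x. 1 :: real) = 1" using measure_torus by (simp add: l2norm_def)
      ultimately have "(LINT x|torus. norm (u x - \<phi> n x)) \<le> l2norm (\<lambda>x. u x - \<phi> n x)"
        by (simp add: ip_def l2norm_norm)
      then show ?thesis using \<phi>(2)[of n] by linarith
    qed
    have "(\<lambda>n. LINT x|torus. norm (u x - \<phi> n x)) \<longlonglongrightarrow> 0"
      by (rule tendsto_sandwich[OF _ _ tendsto_const inv0]) (use L1 in \<open>auto intro!: always_eventually\<close>)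
    then obtain r :: "nat \<Rightarrow> nat" where r: "strict_mono r"
      and lim: "AE x in torus. (\<lambda>n. u x - \<phi> (r n) x) \<longlonglongrightarrow> 0"
      using tendsto_L1_AE_subseq[of torus "\<lambda>n x. u x - \<phi> n x", OF L2_integrable[OF L]] by blast
    have um: "u \<in> borel_measurable torus" using L2_measurable Vspace_L2 u by blast
    have pm: "\<phi> n \<in> borel_measurable torus" for n using L2_measurable Vspace_L2 polys_Vspace \<phi>(1) by blast
    have "(\<integral>\<^sup>+x. ennreal ((norm (u x)) ^ 4) \<partial>torus) = (\<integral>\<^sup>+x. liminf (\<lambda>n. ennreal ((norm (\<phi> (r n) x)) ^ 4)) \<partial>torus)"
    proof (rule nn_integral_cong_AE, use lim in eventually_elim)
      case (elim x)
      have "(\<lambda>n. u x - (u x - \<phi> (r n) x)) \<longlonglongrightarrow> u x - 0" by (intro tendsto_diff tendsto_const elim)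
      then have "(\<lambda>n. \<phi> (r n) x) \<longlonglongrightarrow> u x" by simp
      then have "(\<lambda>n. ennreal ((norm (\<phi> (r n) x)) ^ 4)) \<longlonglongrightarrow> ennreal ((norm (u x)) ^ 4)"
        by (intro tendsto_intros tendsto_ennrealI)
      then show ?case by (intro lim_imp_Liminf[symmetric]) simp_all
    qed
    also have "\<dots> \<le> liminf (\<lambda>n. \<integral>\<^sup>+x. ennreal ((norm (\<phi> (r n) x)) ^ 4) \<partial>torus)"
      by (rule nn_integral_liminf) (use pm in measurable)
    also have "\<dots> \<le> liminf (\<lambda>n. ennreal (C * (Vnorm u + 1 / Suc (r n)) ^ 4))"
    proof (intro Liminf_mono always_eventually allI)
      fix n
      note s = Vspace_sobolev[OF u] Vspace_sobolev[OF polys_Vspace[OF \<phi>(1)[of "r n"]]]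
      have "(\<integral>\<^sup>+x. ennreal ((norm (\<phi> (r n) x)) ^ 4) \<partial>torus) = ennreal (LINT x|torus. (norm (\<phi> (r n) x)) ^ 4)"
        by (intro nn_integral_eq_integral continuous_integrable_torus continuous_intros
            trig_poly_continuous polys_trig \<phi>) simp
      also have "\<dots> \<le> ennreal (C * (Vnorm (\<phi> (r n))) ^ 4)" by (intro ennreal_leI C \<phi>)
      also have "\<dots> \<le> ennreal (C * (Vnorm u + 1 / Suc (r n)) ^ 4)"
      proof (intro ennreal_leI mult_left_mono power_mono C0 Vnorm_nonneg)
        show "Vnorm (\<phi> (r n)) \<le> Vnorm u + 1 / Suc (r n)"
          using Vnorm_triangle[OF sobolev_diff[OF s(2,1)] s(1)] Vnorm_diff_commute[OF s] \<phi>(3)[of "r n"] by simp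
      qed
      finally show "(\<integral>\<^sup>+x. ennreal ((norm (\<phi> (r n) x)) ^ 4) \<partial>torus) \<le> ennreal (C * (Vnorm u + 1 / Suc (r n)) ^ 4)" .
    qed
    also have "\<dots> = ennreal (C * (Vnorm u + 0) ^ 4)"
    proof (intro lim_imp_Liminf tendsto_ennrealI tendsto_intros)
      show "(\<lambda>n. 1 / real (Suc (r n))) \<longlonglongrightarrow> 0"
        using LIMSEQ_subseq_LIMSEQ[OF inv0 r] by (simp add: o_def)
    qed simp
    finally have le: "(\<integral>\<^sup>+x. ennreal ((norm (u x)) ^ 4) \<partial>torus) \<le> ennreal (C * (Vnorm u) ^ 4)" by simp
    have int: "integrable torus (\<lambda>x. (norm (u x)) ^ 4)"
    proof (rule integrableI_bounded)
      show "(\<lambda>x. (norm (u x)) ^ 4) \<in> borel_measurable torus" using um by measurable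
      show "(\<integral>\<^sup>+x. ennreal (norm ((norm (u x)) ^ 4)) \<partial>torus) < \<infinity>"
        using le by (simp add: order_le_less_trans[OF _ ennreal_less_top])
    qed
    have "ennreal (LINT x|torus. (norm (u x)) ^ 4) \<le> ennreal (C * (Vnorm u) ^ 4)"
      using le nn_integral_eq_integral[OF int] by simp
    then show ?thesis using int C0 by (simp add: ennreal_le_iff)
  qed
  then show ?thesis using C0 by blast
qed

text \<open>
  By the Cauchy-Schwarz inequality for the squares of the two norms, which belong to \<open>L\<^sup>2\<close>.
\<close>

lemma Vspace_product:
  "\<exists>C\<ge>0. \<forall>u\<in>Vspace. \<forall>w\<in>Vspace. L2 (\<lambda>x. norm (u x) * norm (w x)) \<and>
    l2norm (\<lambda>x. norm (u x) * norm (w x)) \<le> C * Vnorm u * Vnorm w"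
proof -
  obtain C where C0: "0 \<le> C" and C: "\<And>u. u \<in> Vspace \<Longrightarrow> integrable torus (\<lambda>x. (norm (u x)) ^ 4)"
    "\<And>u. u \<in> Vspace \<Longrightarrow> (LINT x|torus. (norm (u x)) ^ 4) \<le> C * (Vnorm u) ^ 4"
    using L4_Vspace by blast
  have m: "(\<lambda>x. norm (u x)) \<in> borel_measurable torus" if "u \<in> Vspace" for u
    using L2_measurable[OF L2_norm[OF Vspace_L2[OF that]]] .
  have sq: "L2 (\<lambda>x. (norm (u x))\<^sup>2)" if "u \<in> Vspace" for u
    unfolding L2_def using C(1)[OF that] m[OF that] by simp
  have sqn: "l2norm (\<lambda>x. (norm (u x))\<^sup>2) \<le> sqrt C * (Vnorm u)\<^sup>2" if "u \<in> Vspace" for u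
  proof -
    have "l2norm (\<lambda>x. (norm (u x))\<^sup>2) = sqrt (LINT x|torus. (norm (u x)) ^ 4)" by (simp add: l2norm_def)
    also have "\<dots> \<le> sqrt (C * (Vnorm u) ^ 4)" by (intro real_sqrt_le_mono C that)
    also have "\<dots> = sqrt C * (Vnorm u)\<^sup>2"
    proof -
      have "(Vnorm u) ^ 4 = ((Vnorm u)\<^sup>2)\<^sup>2" by simp
      then show ?thesis unfolding real_sqrt_mult by (simp only: real_sqrt_abs) simp
    qed
    finally show ?thesis .
  qed
  show ?thesis
  proof (intro exI[of _ "sqrt C"] conjI ballI)
    show "0 \<le> sqrt C" using C0 by simp
    fix u w assume u: "u \<in> Vspace" and w: "w \<in> Vspace"
    have eq: "(norm (norm (u x) * norm (w x)))\<^sup>2 = (norm (u x))\<^sup>2 \<bullet> (norm (w x))\<^sup>2" for x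
      by (simp add: power_mult_distrib)
    show "L2 (\<lambda>x. norm (u x) * norm (w x))"
      unfolding L2_def eq using L2_inner_integrable[OF sq[OF u] sq[OF w]] m[OF u] m[OF w] by simp
    have "(l2norm (\<lambda>x. norm (u x) * norm (w x)))\<^sup>2 = ip (\<lambda>x. (norm (u x))\<^sup>2) (\<lambda>x. (norm (w x))\<^sup>2)"
      unfolding l2norm_def ip_def eq by simp
    also have "\<dots> \<le> l2norm (\<lambda>x. (norm (u x))\<^sup>2) * l2norm (\<lambda>x. (norm (w x))\<^sup>2)"
      using ip_Cauchy_Schwarz[OF sq[OF u] sq[OF w]] by linarith
    also have "\<dots> \<le> (sqrt C * (Vnorm u)\<^sup>2) * (sqrt C * (Vnorm w)\<^sup>2)"
      by (intro mult_mono sqn u w) (use C0 in auto)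
    also have "\<dots> = C * ((Vnorm u)\<^sup>2 * (Vnorm w)\<^sup>2)"
      using real_sqrt_mult_self[of C] C0 by (simp only: mult_ac) (metis abs_of_nonneg mult.assoc)
    also have "\<dots> = (sqrt C * Vnorm u * Vnorm w)\<^sup>2" using C0 by (simp add: power_mult_distrib)
    finally show "l2norm (\<lambda>x. norm (u x) * norm (w x)) \<le> sqrt C * Vnorm u * Vnorm w"
      by (rule power2_le_imp_le) (use C0 in auto)
  qed
qed

section \<open>The trilinear form\<close>

text \<open>
  From here on \<open>sobolev 1\<close> is an atomic notion. Rewriting \<open>1\<close> to \<open>Suc 0\<close> would unfold it.
\<close>

declare sobolev.simps(2) [simp del] sobnorm.simps(2) [simp del] One_nat_def [simp del]

lemma advect_inner: "advect u v x \<bullet> w x = (\<Sum>i\<in>UNIV. u x $ i * (wd i v x \<bullet> w x))"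
  by (simp add: advect_def inner_sum_left)

lemma convect_term_integrable:
  assumes "u \<in> Vspace" "sobolev 1 v" "w \<in> Vspace"
  shows "integrable torus (\<lambda>x. u x $ i * (wd i v x \<bullet> w x))"
proof (rule Bochner_Integration.integrable_bound)
  obtain C :: real where C: "\<And>u w. u \<in> Vspace \<Longrightarrow> w \<in> Vspace \<Longrightarrow> L2 (\<lambda>x. norm (u x) * norm (w x))"
    using Vspace_product by blast
  show "integrable torus (\<lambda>x. norm (wd i v x) * (norm (u x) * norm (w x)))"
    by (intro L2_mult_integrable C L2_norm wd_L2 assms)
  show "(\<lambda>x. u x $ i * (wd i v x \<bullet> w x)) \<in> borel_measurable torus"
    by (intro borel_measurable_times borel_measurable_inner L2_measurable L2_nth wd_L2 Vspace_L2 assms)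
  have "\<bar>u x $ i\<bar> * \<bar>wd i v x \<bullet> w x\<bar> \<le> norm (u x) * (norm (wd i v x) * norm (w x))" for x
    by (intro mult_mono component_le_norm_cart Cauchy_Schwarz_ineq2) auto
  then show "AE x in torus. norm (u x $ i * (wd i v x \<bullet> w x)) \<le> norm (norm (wd i v x) * (norm (u x) * norm (w x)))"
    by (intro AE_I2) (simp add: abs_mult mult_ac)
qed

lemma convect_integrable:
  assumes "u \<in> Vspace" "sobolev 1 v" "w \<in> Vspace"
  shows "integrable torus (\<lambda>x. advect u v x \<bullet> w x)"
  unfolding advect_inner by (intro Bochner_Integration.integrable_sum convect_term_integrable assms)

lemma convect_sum:
  assumes "u \<in> Vspace" "sobolev 1 v" "w \<in> Vspace"
  shows "convect u v w = (\<Sum>i\<in>UNIV. (LINT x|torus. u x $ i * (wd i v x \<bullet> w x)))"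
  unfolding convect_def ip_def advect_inner
  by (rule Bochner_Integration.integral_sum) (intro convect_term_integrable assms)

text \<open>The form is bounded on \<open>V\<close> by Hoelder's inequality with exponents \<open>4, 2, 4\<close>.\<close>

lemma convect_bound:
  "\<exists>K\<ge>0. \<forall>u\<in>Vspace. \<forall>v. sobolev 1 v \<longrightarrow> (\<forall>w\<in>Vspace. \<bar>convect u v w\<bar> \<le> K * Vnorm u * Vnorm v * Vnorm w)"
proof -
  obtain C where C0: "0 \<le> C" and C: "\<And>u w. u \<in> Vspace \<Longrightarrow> w \<in> Vspace \<Longrightarrow> L2 (\<lambda>x. norm (u x) * norm (w x))"
    "\<And>u w. u \<in> Vspace \<Longrightarrow> w \<in> Vspace \<Longrightarrow> l2norm (\<lambda>x. norm (u x) * norm (w x)) \<le> C * Vnorm u * Vnorm w"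
    using Vspace_product by blast
  have "\<bar>convect u v w\<bar> \<le> 3 * C * Vnorm u * Vnorm v * Vnorm w"
    if u: "u \<in> Vspace" and v: "sobolev 1 v" and w: "w \<in> Vspace" for u v w
  proof -
    have "\<bar>LINT x|torus. u x $ i * (wd i v x \<bullet> w x)\<bar> \<le> Vnorm v * (C * Vnorm u * Vnorm w)" for i
    proof -
      have "\<bar>LINT x|torus. u x $ i * (wd i v x \<bullet> w x)\<bar> \<le> (LINT x|torus. norm (u x $ i * (wd i v x \<bullet> w x)))"
        using integral_norm_bound[of torus "\<lambda>x. u x $ i * (wd i v x \<bullet> w x)"] by simp
      also have "\<dots> \<le> (LINT x|torus. norm (wd i v x) * (norm (u x) * norm (w x)))"
      proof (intro integral_mono integrable_norm convect_term_integrable L2_mult_integrable C L2_norm wd_L2 u v w)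
        fix x
        have "\<bar>u x $ i\<bar> * \<bar>wd i v x \<bullet> w x\<bar> \<le> norm (u x) * (norm (wd i v x) * norm (w x))"
          by (intro mult_mono component_le_norm_cart Cauchy_Schwarz_ineq2) auto
        then show "norm (u x $ i * (wd i v x \<bullet> w x)) \<le> norm (wd i v x) * (norm (u x) * norm (w x))"
          by (simp add: abs_mult mult_ac)
      qed
      also have "\<dots> = ip (\<lambda>x. norm (wd i v x)) (\<lambda>x. norm (u x) * norm (w x))"
        by (simp add: ip_def)
      also have "\<dots> \<le> l2norm (\<lambda>x. norm (wd i v x)) * l2norm (\<lambda>x. norm (u x) * norm (w x))"
        using ip_Cauchy_Schwarz[OF L2_norm[OF wd_L2[OF v]] C(1)[OF u w]] by (meson abs_le_D1)
      also have "\<dots> \<le> Vnorm v * (C * Vnorm u * Vnorm w)"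
        unfolding l2norm_norm by (intro mult_mono l2norm_wd_le_Vnorm C u w) auto
      finally show ?thesis .
    qed
    then have "\<bar>convect u v w\<bar> \<le> (\<Sum>i\<in>(UNIV :: 3 set). Vnorm v * (C * Vnorm u * Vnorm w))"
      unfolding convect_sum[OF u v w] by (intro order_trans[OF sum_abs] sum_mono)
    then show ?thesis by (simp add: mult_ac)
  qed
  then show ?thesis using C0 by (intro exI[of _ "3 * C"]) auto
qed

text \<open>
  If the gradient of the transported field is bounded, the norms of \<open>L\<^sup>2\<close> suffice. This is what makes
  Gronwall's inequality applicable to the difference of two solutions.
\<close>

lemma convect_gradient_bounded:
  assumes u: "u \<in> Vspace" and v: "sobolev 1 v" and w: "w \<in> Vspace"
    and M: "AE x in torus. \<forall>i. norm (wd i v x) \<le> M" and M0: "0 \<le> M"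
  shows "\<bar>convect u v w\<bar> \<le> 3 * M * l2norm u * l2norm w"
proof -
  have "\<bar>convect u v w\<bar> \<le> (LINT x|torus. norm (advect u v x \<bullet> w x))"
    unfolding convect_def ip_def using integral_norm_bound[of torus "\<lambda>x. advect u v x \<bullet> w x"] by simp
  also have "\<dots> \<le> (LINT x|torus. 3 * M * (norm (u x) * norm (w x)))"
  proof (rule integral_mono_AE)
    show "integrable torus (\<lambda>x. norm (advect u v x \<bullet> w x))"
      by (intro integrable_norm convect_integrable u v w)
    show "integrable torus (\<lambda>x. 3 * M * (norm (u x) * norm (w x)))"
      by (intro integrable_mult_right L2_mult_integrable L2_norm Vspace_L2 u w)
    show "AE x in torus. norm (advect u v x \<bullet> w x) \<le> 3 * M * (norm (u x) * norm (w x))"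
      using M
    proof eventually_elim
      case (elim x)
      have "norm (advect u v x \<bullet> w x) \<le> (\<Sum>i\<in>UNIV. \<bar>u x $ i * (wd i v x \<bullet> w x)\<bar>)"
        unfolding advect_inner by (simp add: sum_abs)
      also have "\<dots> \<le> (\<Sum>i\<in>(UNIV :: 3 set). norm (u x) * (M * norm (w x)))"
      proof (rule sum_mono)
        fix i
        have "\<bar>wd i v x \<bullet> w x\<bar> \<le> norm (wd i v x) * norm (w x)" by (rule Cauchy_Schwarz_ineq2)
        also have "\<dots> \<le> M * norm (w x)" using elim by (intro mult_right_mono) auto
        finally show "\<bar>u x $ i * (wd i v x \<bullet> w x)\<bar> \<le> norm (u x) * (M * norm (w x))"
          unfolding abs_mult by (intro mult_mono component_le_norm_cart) auto
      qed
      finally show ?case by (simp add: mult_ac)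
    qed
  qed
  also have "\<dots> = 3 * M * ip (\<lambda>x. norm (u x)) (\<lambda>x. norm (w x))" by (simp add: ip_def)
  also have "\<dots> \<le> 3 * M * (l2norm u * l2norm w)"
    using ip_Cauchy_Schwarz[OF L2_norm[OF Vspace_L2[OF u]] L2_norm[OF Vspace_L2[OF w]]] M0
    by (intro mult_left_mono) (simp_all add: l2norm_norm)
  finally show ?thesis by (simp add: mult_ac)
qed

lemma convect_diff1:
  assumes "u \<in> Vspace" "u' \<in> Vspace" "sobolev 1 v" "w \<in> Vspace"
  shows "convect (\<lambda>x. u x - u' x) v w = convect u v w - convect u' v w"
proof -
  have "advect (\<lambda>x. u x - u' x) v x \<bullet> w x = advect u v x \<bullet> w x - advect u' v x \<bullet> w x" for x
    by (simp add: advect_def scaleR_diff_left sum_subtractf inner_diff_left)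
  then show ?thesis
    by (simp add: convect_def ip_def convect_integrable assms Bochner_Integration.integral_diff)
qed

lemma convect_diff2:
  assumes "u \<in> Vspace" "sobolev 1 v" "sobolev 1 v'" "w \<in> Vspace"
  shows "convect u (\<lambda>x. v x - v' x) w = convect u v w - convect u v' w"
proof -
  have "AE x in torus. \<forall>i\<in>UNIV. wd i (\<lambda>x. v x - v' x) x = wd i v x - wd i v' x"
    by (rule AE_finite_allI) (simp_all only: finite_code wd_diff[OF assms(2,3)] finite_UNIV)
  then have "AE x in torus. advect u (\<lambda>x. v x - v' x) x \<bullet> w x = advect u v x \<bullet> w x - advect u v' x \<bullet> w x"
    by eventually_elim (simp add: advect_def scaleR_diff_right sum_subtractf inner_diff_left)
  then have "convect u (\<lambda>x. v x - v' x) w = (LINT x|torus. advect u v x \<bullet> w x - advect u v' x \<bullet> w x)"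
    unfolding convect_def ip_def
    by (intro integral_cong_AE borel_measurable_diff borel_measurable_integrable convect_integrable
        sobolev_diff assms)
  then show ?thesis
    by (simp add: convect_def ip_def convect_integrable assms Bochner_Integration.integral_diff)
qed

lemma convect_diff3:
  assumes "u \<in> Vspace" "sobolev 1 v" "w \<in> Vspace" "w' \<in> Vspace"
  shows "convect u v (\<lambda>x. w x - w' x) = convect u v w - convect u v w'"
  by (simp add: convect_def ip_def inner_diff_right convect_integrable assms Bochner_Integration.integral_diff)

lemma convect_scaleR3: "convect u v (\<lambda>x. c *\<^sub>R w x) = c * convect u v w"
  by (simp add: convect_def ip_scaleR_right)

text \<open>
  The sum is the integral of \<open>a \<cdot> \<nabla>(v \<cdot> w)\<close>. As \<open>a\<close> is solenoidal, the integrand is the divergence of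
  \<open>(v \<cdot> w) a\<close>.
\<close>

lemma convect_antisym_polys:
  assumes "a \<in> solenoidal_polys" "v \<in> solenoidal_polys" "w \<in> solenoidal_polys"
  shows "convect a v w + convect a w v = 0"
proof -
  note t = assms[THEN polys_trig] and V = assms[THEN polys_Vspace]
  define g where "g x = (\<Sum>c\<in>UNIV. v x $ c * w x $ c)" for x
  have g: "trig_poly g"
    unfolding g_def by (intro trig_poly_sum trig_poly_mult trig_poly_nth t finite_class.finite_UNIV)
  have dg: "partial i g x = partial i v x \<bullet> w x + partial i w x \<bullet> v x" for i x
    unfolding g_def
    by (simp add: partial_sum partial_mult partial_nth trig_poly_mult trig_poly_nth t inner_vec_def
        sum.distrib algebra_simps)
  have wd: "AE x in torus. \<forall>i\<in>UNIV. wd i v x = partial i v x \<and> wd i w x = partial i w x"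
  proof (rule AE_finite_allI)
    show "AE x in torus. wd i v x = partial i v x \<and> wd i w x = partial i w x" for i
      using wd_trig[OF t(2)] wd_trig[OF t(3)] by eventually_elim simp
  qed simp
  have "convect a v w + convect a w v = (LINT x|torus. advect a v x \<bullet> w x + advect a w x \<bullet> v x)"
    unfolding convect_def ip_def
    by (intro Bochner_Integration.integral_add[symmetric] convect_integrable Vspace_sobolev V)
  also have "\<dots> = (LINT x|torus. (\<Sum>i\<in>UNIV. partial i (\<lambda>x. a x $ i * g x) x))"
  proof (rule integral_cong_AE)
    show "AE x in torus. advect a v x \<bullet> w x + advect a w x \<bullet> v x = (\<Sum>i\<in>UNIV. partial i (\<lambda>x. a x $ i * g x) x)"
      using wd
    proof eventually_elim
      case (elim x)
      have "(\<Sum>i\<in>UNIV. partial i (\<lambda>x. a x $ i * g x) x) = (\<Sum>i\<in>UNIV. partial i a x $ i) * g x + (\<Sum>i\<in>UNIV. a x $ i * partial i g x)"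
        by (simp add: partial_mult trig_poly_nth t g partial_nth sum.distrib sum_distrib_right)
      also have "\<dots> = (\<Sum>i\<in>UNIV. a x $ i * partial i g x)" using polys_div[OF assms(1)] by simp
      also have "\<dots> = advect a v x \<bullet> w x + advect a w x \<bullet> v x"
        unfolding advect_inner dg using elim by (simp add: distrib_left sum.distrib)
      finally show ?case ..
    qed
    show "(\<lambda>x. \<Sum>i\<in>UNIV. partial i (\<lambda>x. a x $ i * g x) x) \<in> borel_measurable torus"
      by (intro L2_measurable trig_poly_L2 trig_poly_sum trig_poly_partial trig_poly_mult trig_poly_nth t g finite_class.finite_UNIV)
    show "(\<lambda>x. advect a v x \<bullet> w x + advect a w x \<bullet> v x) \<in> borel_measurable torus"
      by (intro borel_measurable_add borel_measurable_integrable convect_integrable Vspace_sobolev V)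
  qed
  also have "\<dots> = (\<Sum>i\<in>UNIV. (LINT x|torus. partial i (\<lambda>x. a x $ i * g x) x))"
    by (intro Bochner_Integration.integral_sum L2_integrable trig_poly_L2 trig_poly_partial trig_poly_mult trig_poly_nth t g)
  also have "\<dots> = 0"
    by (intro sum.neutral ballI integral_partial_zero trig_poly_mult trig_poly_nth t g)
  finally show ?thesis .
qed

lemma convect_antisym:
  assumes u: "u \<in> Vspace" and v: "v \<in> Vspace" and w: "w \<in> Vspace"
  shows "convect u v w = - convect u w v"
proof -
  obtain K where K0: "0 \<le> K" and K: "\<And>u v w. u \<in> Vspace \<Longrightarrow> sobolev 1 v \<Longrightarrow> w \<in> Vspace \<Longrightarrow>
    \<bar>convect u v w\<bar> \<le> K * Vnorm u * Vnorm v * Vnorm w" using convect_bound by blast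
  note s = Vspace_sobolev and P = polys_Vspace
  have 1: "convect u v w + convect u w v = 0"
    if u: "u \<in> Vspace" and v: "v \<in> solenoidal_polys" and w: "w \<in> solenoidal_polys" for u v w
  proof (rule Vspace_closure[OF u, where C = "2 * K * Vnorm v * Vnorm w"])
    fix \<phi> assume \<phi>: "\<phi> \<in> solenoidal_polys"
    show "convect \<phi> v w + convect \<phi> w v = 0" by (rule convect_antisym_polys[OF \<phi> v w])
    let ?d = "\<lambda>x. u x - \<phi> x"
    have "(convect u v w + convect u w v) - (convect \<phi> v w + convect \<phi> w v) = convect ?d v w + convect ?d w v"
      by (simp add: convect_diff1 u v w \<phi> s P)
    moreover have "\<bar>convect ?d v w\<bar> \<le> K * Vnorm ?d * Vnorm v * Vnorm w"
      "\<bar>convect ?d w v\<bar> \<le> K * Vnorm ?d * Vnorm w * Vnorm v"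
      by (intro K Vspace_diff u v w \<phi> s P)+
    ultimately have "\<bar>(convect u v w + convect u w v) - (convect \<phi> v w + convect \<phi> w v)\<bar>
        \<le> 2 * K * Vnorm v * Vnorm w * Vnorm ?d" by (simp add: mult_ac)
    also have "\<dots> \<le> 2 * K * Vnorm v * Vnorm w * (l2norm ?d + Vnorm ?d)"
      using K0 by (intro mult_left_mono) auto
    finally show "\<bar>(convect u v w + convect u w v) - (convect \<phi> v w + convect \<phi> w v)\<bar>
        \<le> 2 * K * Vnorm v * Vnorm w * (l2norm ?d + Vnorm ?d)" .
  qed
  have step: "\<bar>(convect u v w + convect u w v) - (convect u \<phi> w + convect u w \<phi>)\<bar>
        \<le> 2 * K * Vnorm u * Vnorm w * (l2norm (\<lambda>x. v x - \<phi> x) + Vnorm (\<lambda>x. v x - \<phi> x))"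
    if u: "u \<in> Vspace" and v: "v \<in> Vspace" and w: "w \<in> Vspace" and \<phi>: "\<phi> \<in> solenoidal_polys" for u v w \<phi>
  proof -
    let ?d = "\<lambda>x. v x - \<phi> x"
    have "(convect u v w + convect u w v) - (convect u \<phi> w + convect u w \<phi>) = convect u ?d w + convect u w ?d"
      by (simp add: convect_diff2 convect_diff3 u v w \<phi> s P)
    moreover have "\<bar>convect u ?d w\<bar> \<le> K * Vnorm u * Vnorm ?d * Vnorm w"
      "\<bar>convect u w ?d\<bar> \<le> K * Vnorm u * Vnorm w * Vnorm ?d"
      by (intro K Vspace_diff u v w \<phi> s P)+
    ultimately have "\<bar>(convect u v w + convect u w v) - (convect u \<phi> w + convect u w \<phi>)\<bar>
        \<le> 2 * K * Vnorm u * Vnorm w * Vnorm ?d" by (simp add: mult_ac)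
    also have "\<dots> \<le> 2 * K * Vnorm u * Vnorm w * (l2norm ?d + Vnorm ?d)"
      using K0 by (intro mult_left_mono) auto
    finally show ?thesis .
  qed
  have 2: "convect u v w + convect u w v = 0" if w: "w \<in> solenoidal_polys" for w
    by (rule Vspace_closure[OF v 1[OF u _ w] step[OF u v P[OF w]]])
  have "convect u w v + convect u v w = 0"
  proof (rule Vspace_closure[OF w _ step[OF u w v]])
    show "convect u \<phi> v + convect u v \<phi> = 0" if "\<phi> \<in> solenoidal_polys" for \<phi>
      using 2[OF that] by simp
  qed
  then show ?thesis by simp
qed

section \<open>The Stokes form, the Laplacian and the pressure\<close>

lemma stokes_commute: "stokes u w = stokes w u"
  by (simp add: stokes_def ip_commute)

lemma stokes_self: "stokes u u = (Vnorm u)\<^sup>2"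
  by (simp add: stokes_def Vnorm_square l2norm_square)

lemma stokes_diff_left:
  assumes "sobolev 1 u" "sobolev 1 v" "sobolev 1 w"
  shows "stokes (\<lambda>x. u x - v x) w = stokes u w - stokes v w"
proof -
  have "ip (wd i (\<lambda>x. u x - v x)) (wd i w) = ip (wd i u) (wd i w) - ip (wd i v) (wd i w)" for i
  proof -
    have "ip (wd i (\<lambda>x. u x - v x)) (wd i w) = ip (\<lambda>x. wd i u x - wd i v x) (wd i w)"
      by (intro ip_cong_AE L2_measurable L2_diff wd_L2 sobolev_diff wd_diff assms) simp
    then show ?thesis by (simp add: ip_diff_left wd_L2 assms)
  qed
  then show ?thesis by (simp add: stokes_def sum_subtractf)
qed

lemma stokes_scaleR_left:
  assumes "sobolev 1 u" "sobolev 1 w" shows "stokes (\<lambda>x. c *\<^sub>R u x) w = c * stokes u w"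
proof -
  have "ip (wd i (\<lambda>x. c *\<^sub>R u x)) (wd i w) = c * ip (wd i u) (wd i w)" for i
  proof -
    have "ip (wd i (\<lambda>x. c *\<^sub>R u x)) (wd i w) = ip (\<lambda>x. c *\<^sub>R wd i u x) (wd i w)"
      by (intro ip_cong_AE L2_measurable L2_scaleR wd_L2 sobolev_scaleR wd_scaleR assms) simp
    then show ?thesis by (simp add: ip_scaleR_left)
  qed
  then show ?thesis by (simp add: stokes_def sum_distrib_left)
qed

lemma stokes_diff_right:
  assumes "sobolev 1 u" "sobolev 1 v" "sobolev 1 w"
  shows "stokes w (\<lambda>x. u x - v x) = stokes w u - stokes w v"
  using stokes_diff_left[OF assms] by (simp add: stokes_commute)

lemma stokes_bound:
  assumes "sobolev 1 u" "sobolev 1 w" shows "\<bar>stokes u w\<bar> \<le> Vnorm u * Vnorm w"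
proof -
  have "\<bar>stokes u w\<bar> \<le> (\<Sum>i\<in>UNIV. \<bar>ip (wd i u) (wd i w)\<bar>)"
    unfolding stokes_def by (rule sum_abs)
  also have "\<dots> \<le> (\<Sum>i\<in>UNIV. \<bar>l2norm (wd i u)\<bar> * \<bar>l2norm (wd i w)\<bar>)"
    by (intro sum_mono) (simp add: ip_Cauchy_Schwarz wd_L2 assms)
  also have "\<dots> \<le> Vnorm u * Vnorm w"
    using L2_set_mult_ineq[of "\<lambda>i. l2norm (wd i u)" "\<lambda>i. l2norm (wd i w)" UNIV]
    by (simp add: L2_set_def Vnorm_def)
  finally show ?thesis .
qed

lemma ip_by_parts:
  fixes f :: "real^3 \<Rightarrow> real^'n"
  assumes f: "weak_partial i f g" "L2 f" "L2 g" and \<phi>: "trig_poly \<phi>"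
  shows "ip f (partial i \<phi>) = - ip g \<phi>"
proof -
  have "ip (\<lambda>x. f x $ c) (\<lambda>x. partial i \<phi> x $ c) = - ip (\<lambda>x. g x $ c) (\<lambda>x. \<phi> x $ c)" for c
  proof -
    have "(LINT x|torus. partial i (\<lambda>x. \<phi> x $ c) x *\<^sub>R (f x $ c)) = - (LINT x|torus. (\<phi> x $ c) *\<^sub>R (g x $ c))"
      using weak_partial_nth[OF f, of c] trig_poly_nth[OF \<phi>, of c] unfolding weak_partial_def by blast
    then show ?thesis unfolding ip_def by (simp add: partial_nth[OF \<phi>] mult.commute)
  qed
  then show ?thesis
    by (simp add: ip_fields f trig_poly_L2 trig_poly_partial \<phi> sum_negf)
qed

text \<open>
  Integration by parts puts both derivatives on the polynomial, so that only \<open>u\<close> itself remains, whose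
  time derivative is known.
\<close>

lemma stokes_polys:
  assumes \<phi>: "trig_poly \<phi>" and u: "sobolev 1 u"
  shows "stokes u \<phi> = - ip u (\<lambda>x. \<Sum>j\<in>UNIV. partial j (partial j \<phi>) x)"
proof -
  have "stokes u \<phi> = (\<Sum>i\<in>UNIV. ip (wd i u) (partial i \<phi>))"
    unfolding stokes_def
    by (intro sum.cong refl ip_cong_AE L2_measurable wd_L2 u sobolev_trig \<phi> trig_poly_L2
        trig_poly_partial wd_trig) simp
  also have "\<dots> = (\<Sum>i\<in>UNIV. - ip (partial i (partial i \<phi>)) u)"
    using ip_by_parts[OF wd_weak[OF u] sobolev_L2[OF u] wd_L2[OF u] trig_poly_partial[OF \<phi>]]
    by (intro sum.cong refl) (simp add: ip_commute)
  also have "\<dots> = - ip (\<lambda>x. \<Sum>j\<in>UNIV. partial j (partial j \<phi>) x) u"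
    by (simp add: ip_sum_left trig_poly_L2 trig_poly_partial \<phi> sobolev_L2[OF u] sum_negf)
  finally show ?thesis by (simp add: ip_commute)
qed

lemma laplacian_L2: "sobolev 2 b \<Longrightarrow> L2 (laplacian b)"
proof -
  assume "sobolev 2 b"
  then have "sobolev (Suc (Suc 0)) b" by (simp add: numeral_2_eq_2)
  then have "sobolev 1 (wd i b)" for i using sobolev_wd by (simp add: One_nat_def)
  then show ?thesis unfolding laplacian_def[abs_def] by (intro L2_sum wd_L2) simp
qed

text \<open>
  For polynomial \<open>w\<close> this is integration by parts, and both sides are continuous in \<open>w\<close>.
\<close>

lemma laplacian_ip:
  assumes b: "sobolev 2 b" and w: "w \<in> Vspace" shows "ip (laplacian b) w = - stokes b w"
proof -
  have b2: "sobolev (Suc (Suc 0)) b" using b by (simp add: numeral_2_eq_2)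
  then have bi: "sobolev 1 (wd i b)" for i using sobolev_wd by (simp add: One_nat_def)
  have b1: "sobolev 1 b" by (rule sobolev_one[OF b2])
  note L = laplacian_L2[OF b]
  have "ip (laplacian b) w + stokes b w = 0"
  proof (rule Vspace_closure[OF w, where C = "l2norm (laplacian b) + Vnorm b"])
    fix \<phi> assume \<phi>: "\<phi> \<in> solenoidal_polys"
    note t = polys_trig[OF \<phi>] and V = polys_Vspace[OF \<phi>]
    have "stokes b \<phi> = (\<Sum>i\<in>UNIV. ip (wd i b) (partial i \<phi>))"
      unfolding stokes_def
      by (intro sum.cong refl ip_cong_AE L2_measurable wd_L2 b1 sobolev_trig t trig_poly_L2
          trig_poly_partial wd_trig) simp
    also have "\<dots> = (\<Sum>i\<in>UNIV. - ip (wd i (wd i b)) \<phi>)"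
      by (intro sum.cong refl ip_by_parts wd_weak wd_L2 bi b1 t)
    also have "\<dots> = - ip (laplacian b) \<phi>"
      unfolding laplacian_def[abs_def]
      by (simp add: ip_sum_left wd_L2 bi trig_poly_L2 t sum_negf)
    finally show "ip (laplacian b) \<phi> + stokes b \<phi> = 0" by simp
    let ?d = "\<lambda>x. w x - \<phi> x"
    have "(ip (laplacian b) w + stokes b w) - (ip (laplacian b) \<phi> + stokes b \<phi>) = ip (laplacian b) ?d + stokes b ?d"
      by (simp add: ip_diff_right stokes_diff_right L b1 w V Vspace_L2 Vspace_sobolev)
    moreover have "\<bar>ip (laplacian b) ?d\<bar> \<le> l2norm (laplacian b) * l2norm ?d"
      by (intro ip_Cauchy_Schwarz L Vspace_L2 Vspace_diff w V)
    moreover have "\<bar>stokes b ?d\<bar> \<le> Vnorm b * Vnorm ?d"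
      by (intro stokes_bound b1 Vspace_sobolev Vspace_diff w V)
    moreover have "(l2norm (laplacian b) + Vnorm b) * (l2norm ?d + Vnorm ?d) =
        l2norm (laplacian b) * l2norm ?d + Vnorm b * Vnorm ?d + (l2norm (laplacian b) * Vnorm ?d + Vnorm b * l2norm ?d)"
      by (simp add: algebra_simps)
    moreover have "0 \<le> l2norm (laplacian b) * Vnorm ?d" "0 \<le> Vnorm b * l2norm ?d" by simp_all
    ultimately show "\<bar>(ip (laplacian b) w + stokes b w) - (ip (laplacian b) \<phi> + stokes b \<phi>)\<bar>
        \<le> (l2norm (laplacian b) + Vnorm b) * (l2norm ?d + Vnorm ?d)" by linarith
  qed
  then show ?thesis by simp
qed

lemma grad_L2: assumes "sobolev 1 p" shows "L2 (grad p)"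
proof -
  have "L2 (\<lambda>x. wd i p x *\<^sub>R (axis i 1 :: real^3))" for i
  proof (rule L2_dominated[OF _ wd_L2[OF assms, of i]])
    show "(\<lambda>x. wd i p x *\<^sub>R (axis i 1 :: real^3)) \<in> borel_measurable torus"
      using L2_measurable[OF wd_L2[OF assms]] by measurable
  qed simp
  then have "L2 (\<lambda>x. \<Sum>i\<in>UNIV. wd i p x *\<^sub>R (axis i 1 :: real^3))" by (intro L2_sum) simp_all
  moreover have "(\<Sum>i\<in>UNIV. wd i p x *\<^sub>R (axis i 1 :: real^3)) = grad p x" for x
    unfolding grad_def vec_eq_iff by (simp add: axis_def if_distrib[of "\<lambda>a. _ * a"] sum.delta cong: if_cong)
  ultimately show ?thesis by simp
qed

text \<open>Gradients are orthogonal to solenoidal fields, so that the pressure disappears.\<close>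

lemma grad_ip: assumes p: "sobolev 1 p" and w: "w \<in> Vspace" shows "ip (grad p) w = 0"
proof (rule Vspace_closure[OF w, where C = "l2norm (grad p)"])
  fix \<phi> assume \<phi>: "\<phi> \<in> solenoidal_polys"
  note t = polys_trig[OF \<phi>] and V = polys_Vspace[OF \<phi>]
  have "ip (grad p) \<phi> = (\<Sum>i\<in>UNIV. (LINT x|torus. \<phi> x $ i * wd i p x))"
    unfolding ip_fields[OF grad_L2[OF p] trig_poly_L2[OF t]] by (simp add: ip_def grad_def mult.commute)
  also have "\<dots> = (\<Sum>i\<in>UNIV. - (LINT x|torus. partial i \<phi> x $ i * p x))"
  proof (rule sum.cong[OF refl])
    fix i
    show "(LINT x|torus. \<phi> x $ i * wd i p x) = - (LINT x|torus. partial i \<phi> x $ i * p x)"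
    proof -
      have "(LINT x|torus. partial i (\<lambda>x. \<phi> x $ i) x *\<^sub>R p x) = - (LINT x|torus. \<phi> x $ i *\<^sub>R wd i p x)"
        using wd_weak[OF p, of i] trig_poly_nth[OF t, of i] unfolding weak_partial_def by blast
      then show ?thesis by (simp add: partial_nth[OF t])
    qed
  qed
  also have "\<dots> = - (LINT x|torus. (\<Sum>i\<in>UNIV. partial i \<phi> x $ i * p x))"
    by (subst Bochner_Integration.integral_sum)
       (auto intro!: L2_mult_integrable L2_nth trig_poly_nth trig_poly_L2 trig_poly_partial t sobolev_L2[OF p] simp: sum_negf)
  also have "\<dots> = 0" by (simp add: polys_div[OF \<phi>] flip: sum_distrib_right)
  finally show "ip (grad p) \<phi> = 0" .
  let ?d = "\<lambda>x. w x - \<phi> x"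
  have "\<bar>ip (grad p) w - ip (grad p) \<phi>\<bar> = \<bar>ip (grad p) ?d\<bar>"
    by (simp add: ip_diff_right grad_L2 p w V Vspace_L2)
  also have "\<dots> \<le> l2norm (grad p) * l2norm ?d"
    by (intro ip_Cauchy_Schwarz grad_L2 p Vspace_L2 Vspace_diff w V)
  also have "\<dots> \<le> l2norm (grad p) * (l2norm ?d + Vnorm ?d)" by (intro mult_left_mono) auto
  finally show "\<bar>ip (grad p) w - ip (grad p) \<phi>\<bar> \<le> l2norm (grad p) * (l2norm ?d + Vnorm ?d)" .
qed

section \<open>Fields in \<open>H\<^sup>3 \<inter> V\<close>\<close>

lemma sobolev_3_Suc: "sobolev 3 v \<longleftrightarrow> sobolev (Suc 2) v"
  unfolding numeral_3_eq_3 numeral_2_eq_2 ..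

lemma sobnorm_3_Suc: "sobnorm 3 v = sobnorm (Suc 2) v"
  unfolding numeral_3_eq_3 numeral_2_eq_2 ..

lemma sobolev_3_2: "sobolev 3 v \<Longrightarrow> sobolev 2 v"
  unfolding sobolev_3_Suc by (rule sobolev_Suc)

lemma sobolev_3_bounded:
  "\<exists>C\<ge>0. \<forall>v :: field. sobolev 3 v \<longrightarrow> (AE x in torus. norm (v x) \<le> C * sobnorm 3 v) \<and>
    (AE x in torus. \<forall>i. norm (wd i v x) \<le> C * sobnorm 3 v)"
proof -
  obtain C where C0: "0 \<le> C" and C: "\<And>g :: field. sobolev 2 g \<Longrightarrow> AE x in torus. norm (g x) \<le> C * sobnorm 2 g"
    using sobolev_2_bounded by blast
  have "AE x in torus. norm (v x) \<le> C * sobnorm 3 v" if v: "sobolev 3 v" for v :: field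
  proof -
    have "C * sobnorm 2 v \<le> C * sobnorm 3 v"
      unfolding sobnorm_3_Suc using v C0 by (intro mult_left_mono sobnorm_le_Suc) (simp_all only: sobolev_3_Suc)
    then show ?thesis using C[OF sobolev_3_2[OF v]] by (elim eventually_mono) linarith
  qed
  moreover have "AE x in torus. \<forall>i. norm (wd i v x) \<le> C * sobnorm 3 v" if v: "sobolev 3 v" for v :: field
  proof -
    have "AE x in torus. \<forall>i\<in>UNIV. norm (wd i v x) \<le> C * sobnorm 3 v"
    proof (rule AE_finite_allI)
      fix i :: 3
      have "sobolev 2 (wd i v)" using v unfolding sobolev_3_Suc by (rule sobolev_wd)
      moreover have "C * sobnorm 2 (wd i v) \<le> C * sobnorm 3 v"
        unfolding sobnorm_3_Suc using C0 by (intro mult_left_mono sobnorm_wd_le)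
      ultimately show "AE x in torus. norm (wd i v x) \<le> C * sobnorm 3 v"
        using C[of "wd i v"] by (auto elim!: eventually_mono)
    qed simp
    then show ?thesis by simp
  qed
  ultimately show ?thesis using C0 by blast
qed

lemma Vnorm_le_sobnorm_3: "sobolev 3 v \<Longrightarrow> Vnorm v \<le> sobnorm 3 v"
proof -
  assume "sobolev 3 v"
  then have "sobolev (Suc (Suc (Suc 0))) v" by (simp add: numeral_3_eq_3)
  then have "sobnorm 1 v \<le> sobnorm (Suc (Suc (Suc 0))) v"
    using sobnorm_le_Suc[of "Suc 0" v] sobnorm_le_Suc[of "Suc (Suc 0)" v] sobolev_Suc[of "Suc (Suc 0)" v]
    unfolding One_nat_def by linarith
  then show ?thesis using Vnorm_le_sobnorm[of v] by (simp add: numeral_3_eq_3 del: sobnorm.simps)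
qed

lemma bounded_trig_mult_L2:
  fixes h \<eta> :: "real^3 \<Rightarrow> real"
  assumes "L2 h" "trig_poly \<eta>" shows "L2 (\<lambda>x. \<eta> x * h x)"
proof -
  obtain B where "\<And>x. x \<in> cbox 0 1 \<Longrightarrow> norm (\<eta> x) \<le> B"
    using continuous_bounded_torus[OF trig_poly_continuous[OF assms(2)]] by blast
  then have "AE x in torus. \<bar>\<eta> x\<bar> \<le> B" by (intro AE_I2) auto
  then show ?thesis
    using L2_bounded_scaleR[OF assms(1) L2_measurable[OF trig_poly_L2[OF assms(2)]], of B] by simp
qed

text \<open>
  The product rule in weak form. For a polynomial in place of \<open>b\<close> it is the definition of the weak
  derivative of \<open>h\<close>, and both sides are continuous in \<open>b\<close> with respect to the norm of \<open>V\<close>.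
\<close>

lemma weak_product_rule:
  fixes h \<eta> :: "real^3 \<Rightarrow> real"
  assumes b: "b \<in> Vspace" and h: "weak_partial j h h'" "L2 h" "L2 h'" and \<eta>: "trig_poly \<eta>"
  shows "ip (\<lambda>x. b x $ i) (\<lambda>x. partial j \<eta> x * h x)
    = - ip (\<lambda>x. wd j b x $ i) (\<lambda>x. \<eta> x * h x) - ip (\<lambda>x. b x $ i) (\<lambda>x. \<eta> x * h' x)"
proof -
  note p = trig_poly_partial[OF \<eta>, of j]
  note L = bounded_trig_mult_L2[OF h(2) p] bounded_trig_mult_L2[OF h(2) \<eta>] bounded_trig_mult_L2[OF h(3) \<eta>]
  define Q where "Q b = ip (\<lambda>x. b x $ i) (\<lambda>x. partial j \<eta> x * h x) + ip (\<lambda>x. wd j b x $ i) (\<lambda>x. \<eta> x * h x)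
    + ip (\<lambda>x. b x $ i) (\<lambda>x. \<eta> x * h' x)" for b :: field
  let ?A = "l2norm (\<lambda>x. partial j \<eta> x * h x)" and ?B = "l2norm (\<lambda>x. \<eta> x * h x)" and ?D = "l2norm (\<lambda>x. \<eta> x * h' x)"
  have "Q b = 0"
  proof (rule Vspace_closure[OF b, where C = "?A + ?B + ?D"])
    fix \<phi> assume \<phi>: "\<phi> \<in> solenoidal_polys"
    note t = polys_trig[OF \<phi>] and V = polys_Vspace[OF \<phi>]
    have ti: "trig_poly (\<lambda>x. \<phi> x $ i)" "trig_poly (\<lambda>x. partial j \<phi> x $ i)"
      by (intro trig_poly_nth trig_poly_partial t)+
    have int: "integrable torus (\<lambda>x. \<phi> x $ i * (partial j \<eta> x * h x))"
      "integrable torus (\<lambda>x. partial j \<phi> x $ i * (\<eta> x * h x))"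
      by (intro L2_mult_integrable trig_poly_L2 ti L)+
    have "(LINT x|torus. partial j (\<lambda>x. \<phi> x $ i * \<eta> x) x * h x) = - (LINT x|torus. (\<phi> x $ i * \<eta> x) * h' x)"
      using h(1) trig_poly_mult[OF ti(1) \<eta>] unfolding weak_partial_def by simp
    moreover have "(LINT x|torus. partial j (\<lambda>x. \<phi> x $ i * \<eta> x) x * h x) =
        (LINT x|torus. \<phi> x $ i * (partial j \<eta> x * h x) + partial j \<phi> x $ i * (\<eta> x * h x))"
      unfolding partial_mult[OF ti(1) \<eta>] partial_nth[OF t]
      by (intro Bochner_Integration.integral_cong refl) (simp add: algebra_simps)
    ultimately have "(LINT x|torus. \<phi> x $ i * (partial j \<eta> x * h x)) + (LINT x|torus. partial j \<phi> x $ i * (\<eta> x * h x))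
        + (LINT x|torus. \<phi> x $ i * (\<eta> x * h' x)) = 0"
      using Bochner_Integration.integral_add[OF int] by (simp add: mult.assoc)
    moreover have "ip (\<lambda>x. wd j \<phi> x $ i) (\<lambda>x. \<eta> x * h x) = ip (\<lambda>x. partial j \<phi> x $ i) (\<lambda>x. \<eta> x * h x)"
    proof (intro ip_cong_AE L2_measurable L L2_nth wd_L2 trig_poly_L2 trig_poly_partial sobolev_trig t)
      show "AE x in torus. wd j \<phi> x $ i = partial j \<phi> x $ i"
        using wd_trig[OF t, of j] by eventually_elim simp
    qed simp
    ultimately show "Q \<phi> = 0" by (simp add: Q_def) (simp add: ip_def)
    let ?d = "\<lambda>x. b x - \<phi> x"
    have dV: "?d \<in> Vspace" by (intro Vspace_diff b V)
    note bs = Vspace_sobolev[OF b] and ps = Vspace_sobolev[OF V] and ds = Vspace_sobolev[OF dV]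
    have wdd: "ip (\<lambda>x. wd j ?d x $ i) (\<lambda>x. \<eta> x * h x) =
        ip (\<lambda>x. wd j b x $ i) (\<lambda>x. \<eta> x * h x) - ip (\<lambda>x. wd j \<phi> x $ i) (\<lambda>x. \<eta> x * h x)"
    proof -
      have "ip (\<lambda>x. wd j ?d x $ i) (\<lambda>x. \<eta> x * h x) = ip (\<lambda>x. wd j b x $ i - wd j \<phi> x $ i) (\<lambda>x. \<eta> x * h x)"
      proof (intro ip_cong_AE L2_measurable L L2_nth L2_diff wd_L2 ds bs ps)
        show "AE x in torus. wd j ?d x $ i = wd j b x $ i - wd j \<phi> x $ i"
          using wd_diff[OF bs ps, of j] by eventually_elim simp
      qed simp
      then show ?thesis by (simp add: ip_diff_left L2_nth wd_L2 bs ps L)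
    qed
    have "Q b - Q \<phi> = ip (\<lambda>x. ?d x $ i) (\<lambda>x. partial j \<eta> x * h x) + ip (\<lambda>x. wd j ?d x $ i) (\<lambda>x. \<eta> x * h x)
        + ip (\<lambda>x. ?d x $ i) (\<lambda>x. \<eta> x * h' x)"
      unfolding wdd by (simp add: Q_def ip_diff_left L2_nth Vspace_L2 b V L)
    moreover have "\<bar>ip (\<lambda>x. ?d x $ i) (\<lambda>x. partial j \<eta> x * h x)\<bar> \<le> (l2norm ?d + Vnorm ?d) * ?A"
      by (rule order_trans[OF ip_Cauchy_Schwarz[OF L2_nth[OF Vspace_L2[OF dV]] L(1)]])
         (intro mult_right_mono add_increasing2 l2norm_nth_le Vspace_L2 dV Vnorm_nonneg l2norm_nonneg)
    moreover have "\<bar>ip (\<lambda>x. ?d x $ i) (\<lambda>x. \<eta> x * h' x)\<bar> \<le> (l2norm ?d + Vnorm ?d) * ?D"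
      by (rule order_trans[OF ip_Cauchy_Schwarz[OF L2_nth[OF Vspace_L2[OF dV]] L(3)]])
         (intro mult_right_mono add_increasing2 l2norm_nth_le Vspace_L2 dV Vnorm_nonneg l2norm_nonneg)
    moreover have "\<bar>ip (\<lambda>x. wd j ?d x $ i) (\<lambda>x. \<eta> x * h x)\<bar> \<le> (l2norm ?d + Vnorm ?d) * ?B"
      by (rule order_trans[OF ip_Cauchy_Schwarz[OF L2_nth[OF wd_L2[OF ds]] L(2)]])
         (intro mult_right_mono add_increasing order_trans[OF l2norm_nth_le l2norm_wd_le_Vnorm] wd_L2 ds l2norm_nonneg)
    moreover have "(?A + ?B + ?D) * (l2norm ?d + Vnorm ?d) =
        (l2norm ?d + Vnorm ?d) * ?A + (l2norm ?d + Vnorm ?d) * ?B + (l2norm ?d + Vnorm ?d) * ?D"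
      by (simp add: algebra_simps)
    ultimately show "\<bar>Q b - Q \<phi>\<bar> \<le> (?A + ?B + ?D) * (l2norm ?d + Vnorm ?d)" by linarith
  qed
  then show ?thesis by (simp add: Q_def)
qed

text \<open>
  Since \<open>(b \<cdot> \<nabla>) b\<close> belongs to \<open>H\<^sup>1\<close>, its pairing with the Laplacian of a test function is
  bounded by the norm of the test function in \<open>V\<close>.
\<close>

lemma convect_laplacian_bound:
  "\<exists>K\<ge>0. \<forall>b\<in>Vspace. sobolev 3 b \<longrightarrow> (\<forall>\<phi>\<in>solenoidal_polys.
    \<bar>convect b b (\<lambda>x. \<Sum>j\<in>UNIV. partial j (partial j \<phi>) x)\<bar> \<le> K * (sobnorm 3 b)\<^sup>2 * Vnorm \<phi>)"
proof -
  obtain C where C0: "0 \<le> C" and C: "\<And>v :: field. sobolev 3 v \<Longrightarrow> AE x in torus. norm (v x) \<le> C * sobnorm 3 v"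
    "\<And>v :: field. sobolev 3 v \<Longrightarrow> AE x in torus. \<forall>i. norm (wd i v x) \<le> C * sobnorm 3 v"
    using sobolev_3_bounded by blast
  have "\<bar>convect b b (\<lambda>x. \<Sum>j\<in>UNIV. partial j (partial j \<phi>) x)\<bar> \<le> 54 * C * (sobnorm 3 b)\<^sup>2 * Vnorm \<phi>"
    if b: "b \<in> Vspace" and b3: "sobolev 3 b" and \<phi>: "\<phi> \<in> solenoidal_polys" for b \<phi>
  proof -
    note t = polys_trig[OF \<phi>]
    let ?S = "sobnorm 3 b"
    have b1: "sobolev 1 b" by (rule Vspace_sobolev[OF b])
    have b2: "sobolev (Suc (Suc 0)) (wd i b)" for i
      using sobolev_wd[OF b3[unfolded sobolev_3_Suc]] by (simp add: numeral_2_eq_2)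
    have bi: "sobolev 1 (wd i b)" for i by (rule sobolev_one[OF b2])
    have n2: "l2norm (wd j (wd i b)) \<le> ?S" for i j
      using sobnorm_wd_le[of 0 j "wd i b"] sobnorm_le_Suc[OF b2[of i]] sobnorm_wd_le[of "Suc (Suc 0)" i b]
      by (simp add: numeral_3_eq_3 del: sobnorm.simps) (simp del: sobnorm.simps(2))
    have n1: "l2norm (wd i b) \<le> ?S" for i
      using l2norm_le_sobnorm[of "wd i b" 2] sobnorm_wd_le[of 2 i b] unfolding sobnorm_3_Suc by linarith
    define T where "T i j c = ip (\<lambda>x. b x $ i) (\<lambda>x. partial j (\<lambda>x. partial j \<phi> x $ c) x * wd i b x $ c)" for i j c
    have tj: "trig_poly (\<lambda>x. partial j \<phi> x $ c)" "trig_poly (\<lambda>x. partial j (\<lambda>x. partial j \<phi> x $ c) x)" for j c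
      by (intro trig_poly_nth trig_poly_partial t)+
    have "\<bar>T i j c\<bar> \<le> 2 * C * ?S\<^sup>2 * Vnorm \<phi>" for i j c
    proof -
      let ?\<eta> = "\<lambda>x. partial j \<phi> x $ c"
      have \<eta>: "l2norm ?\<eta> \<le> Vnorm \<phi>"
      proof -
        have "l2norm (partial j \<phi>) = l2norm (wd j \<phi>)"
          by (rule l2norm_cong_AE)
             (auto intro!: L2_measurable trig_poly_L2 trig_poly_partial t wd_L2 sobolev_trig
               eventually_mono[OF wd_trig[OF t, of j]])
        then show ?thesis
          using l2norm_nth_le[OF trig_poly_L2[OF trig_poly_partial[OF t]], of j c] l2norm_wd_le_Vnorm[of j \<phi>] by linarith
      qed
      have comp: "l2norm (\<lambda>x. wd i b x $ c) \<le> ?S" "l2norm (\<lambda>x. wd j (wd i b) x $ c) \<le> ?S"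
        using l2norm_nth_le[OF wd_L2[OF b1], of i c] l2norm_nth_le[OF wd_L2[OF bi], of j i c] n1[of i] n2[of j i] by linarith+
      have est: "\<bar>ip f (\<lambda>x. ?\<eta> x * h x)\<bar> \<le> C * ?S\<^sup>2 * Vnorm \<phi>"
        if f: "L2 f" "AE x in torus. \<bar>f x\<bar> \<le> C * ?S" and h: "L2 h" "l2norm h \<le> ?S" for f h :: "real^3 \<Rightarrow> real"
      proof -
        have "ip f (\<lambda>x. ?\<eta> x * h x) = ip (\<lambda>x. f x *\<^sub>R h x) ?\<eta>"
          by (simp add: ip_def mult_ac)
        moreover have "\<bar>ip (\<lambda>x. f x *\<^sub>R h x) ?\<eta>\<bar> \<le> l2norm (\<lambda>x. f x *\<^sub>R h x) * l2norm ?\<eta>"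
          by (intro ip_Cauchy_Schwarz L2_bounded_scaleR[OF h(1) L2_measurable[OF f(1)] f(2)] trig_poly_L2 tj)
        moreover have "l2norm (\<lambda>x. f x *\<^sub>R h x) * l2norm ?\<eta> \<le> (C * ?S * ?S) * Vnorm \<phi>"
        proof (intro mult_mono \<eta> l2norm_nonneg)
          have "l2norm (\<lambda>x. f x *\<^sub>R h x) \<le> \<bar>C * ?S\<bar> * l2norm h"
            by (rule L2_bounded_mult[OF h(1) L2_measurable[OF f(1)] f(2)])
          also have "\<dots> \<le> C * ?S * ?S"
            using h(2) C0 by (simp add: abs_mult mult_left_mono)
          finally show "l2norm (\<lambda>x. f x *\<^sub>R h x) \<le> C * ?S * ?S" .
        qed (use C0 in simp)
        ultimately show ?thesis by (simp add: power2_eq_square mult.assoc)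
      qed
      have "T i j c = - ip (\<lambda>x. wd j b x $ i) (\<lambda>x. ?\<eta> x * wd i b x $ c) - ip (\<lambda>x. b x $ i) (\<lambda>x. ?\<eta> x * wd j (wd i b) x $ c)"
        unfolding T_def
        by (rule weak_product_rule[OF b weak_partial_nth[OF wd_weak[OF bi]]]) (intro L2_nth wd_L2 b1 bi tj)+
      moreover have "\<bar>ip (\<lambda>x. wd j b x $ i) (\<lambda>x. ?\<eta> x * wd i b x $ c)\<bar> \<le> C * ?S\<^sup>2 * Vnorm \<phi>"
      proof (rule est)
        show "AE x in torus. \<bar>wd j b x $ i\<bar> \<le> C * ?S"
          using C(2)[OF b3] by eventually_elim (meson component_le_norm_cart order_trans)
      qed (intro L2_nth wd_L2 b1 comp)+
      moreover have "\<bar>ip (\<lambda>x. b x $ i) (\<lambda>x. ?\<eta> x * wd j (wd i b) x $ c)\<bar> \<le> C * ?S\<^sup>2 * Vnorm \<phi>"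
      proof (rule est)
        show "AE x in torus. \<bar>b x $ i\<bar> \<le> C * ?S"
          using C(1)[OF b3] by eventually_elim (meson component_le_norm_cart order_trans)
      qed (intro L2_nth wd_L2 bi Vspace_L2 b comp)+
      ultimately show ?thesis by linarith
    qed
    then have "(\<Sum>i\<in>UNIV. \<Sum>c\<in>UNIV. \<Sum>j\<in>UNIV. \<bar>T i j c\<bar>) \<le>
        (\<Sum>i\<in>(UNIV :: 3 set). \<Sum>c\<in>(UNIV :: 3 set). \<Sum>j\<in>(UNIV :: 3 set). 2 * C * ?S\<^sup>2 * Vnorm \<phi>)"
      by (intro sum_mono)
    moreover have "convect b b (\<lambda>x. \<Sum>j\<in>UNIV. partial j (partial j \<phi>) x) = (\<Sum>i\<in>UNIV. \<Sum>c\<in>UNIV. \<Sum>j\<in>UNIV. T i j c)"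
    proof -
      have eq: "b x $ i * (wd i b x \<bullet> (\<Sum>j\<in>UNIV. partial j (partial j \<phi>) x)) =
          (\<Sum>c\<in>UNIV. \<Sum>j\<in>UNIV. b x $ i * (partial j (\<lambda>x. partial j \<phi> x $ c) x * wd i b x $ c))" for x i
        by (simp add: inner_vec_def partial_nth[OF trig_poly_partial[OF t]] sum_distrib_left sum_distrib_right mult_ac)
      have int: "integrable torus (\<lambda>x. b x $ i * (partial j (\<lambda>x. partial j \<phi> x $ c) x * wd i b x $ c))" for i j c
        by (intro L2_mult_integrable bounded_trig_mult_L2 L2_nth wd_L2 Vspace_L2 b b1 tj)
      have "(LINT x|torus. b x $ i * (wd i b x \<bullet> (\<Sum>j\<in>UNIV. partial j (partial j \<phi>) x))) = (\<Sum>c\<in>UNIV. \<Sum>j\<in>UNIV. T i j c)" for i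
        unfolding eq T_def ip_def inner_real_def
        by (subst Bochner_Integration.integral_sum, intro Bochner_Integration.integrable_sum int,
            intro sum.cong refl, rule Bochner_Integration.integral_sum, rule int)
      then show ?thesis
        by (simp add: convect_sum[OF b b1 polys_Vspace[OF polys_laplacian[OF \<phi>]]])
    qed
    moreover have "\<bar>\<Sum>i\<in>UNIV. \<Sum>c\<in>UNIV. \<Sum>j\<in>UNIV. T i j c\<bar> \<le> (\<Sum>i\<in>UNIV. \<Sum>c\<in>UNIV. \<Sum>j\<in>UNIV. \<bar>T i j c\<bar>)"
      by (intro order_trans[OF sum_abs] sum_mono order_refl)
    ultimately show ?thesis by simp
  qed
  then show ?thesis using C0 by (intro exI[of _ "54 * C"]) auto
qed

section \<open>Continuous curves in \<open>V\<close>\<close>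

lemma C_into_Vspace: "C_into Vspace Vnorm I u \<Longrightarrow> t \<in> I \<Longrightarrow> u t \<in> Vspace"
  by (simp add: C_into_def)

lemma C_into_tendsto:
  "C_into Vspace Vnorm I u \<Longrightarrow> t \<in> I \<Longrightarrow> ((\<lambda>s. Vnorm (\<lambda>x. u s x - u t x)) \<longlongrightarrow> 0) (at t within I)"
  by (simp add: C_into_def continuous_in_norm_def)

lemma eventually_within_self: "(\<And>s. s \<in> I \<Longrightarrow> P s) \<Longrightarrow> eventually P (at t within I)"
  by (auto simp: eventually_at_filter)

lemma C_into_diff:
  assumes u: "C_into Vspace Vnorm I u" and v: "C_into Vspace Vnorm I v"
  shows "C_into Vspace Vnorm I (\<lambda>t x. u t x - v t x)"
  unfolding C_into_def continuous_in_norm_def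
proof (intro conjI ballI)
  fix t assume t: "t \<in> I"
  show "(\<lambda>x. u t x - v t x) \<in> Vspace" by (intro Vspace_diff C_into_Vspace[OF u t] C_into_Vspace[OF v t])
  show "((\<lambda>s. Vnorm (\<lambda>x. (u s x - v s x) - (u t x - v t x))) \<longlongrightarrow> 0) (at t within I)"
  proof (rule Lim_null_comparison)
    show "((\<lambda>s. Vnorm (\<lambda>x. u s x - u t x) + Vnorm (\<lambda>x. v s x - v t x)) \<longlongrightarrow> 0) (at t within I)"
      using tendsto_add[OF C_into_tendsto[OF u t] C_into_tendsto[OF v t]] by simp
    show "\<forall>\<^sub>F s in at t within I. norm (Vnorm (\<lambda>x. (u s x - v s x) - (u t x - v t x)))
        \<le> Vnorm (\<lambda>x. u s x - u t x) + Vnorm (\<lambda>x. v s x - v t x)"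
    proof (rule eventually_within_self)
      fix s assume s: "s \<in> I"
      have "Vnorm (\<lambda>x. (u s x - u t x) - (v s x - v t x)) \<le> Vnorm (\<lambda>x. u s x - u t x) + Vnorm (\<lambda>x. v s x - v t x)"
        by (intro Vnorm_diff_triangle sobolev_diff Vspace_sobolev C_into_Vspace[OF u] C_into_Vspace[OF v] s t)
      then show "norm (Vnorm (\<lambda>x. (u s x - v s x) - (u t x - v t x)))
        \<le> Vnorm (\<lambda>x. u s x - u t x) + Vnorm (\<lambda>x. v s x - v t x)" by (simp add: algebra_simps)
    qed
  qed
qed

lemma Vnorm_reverse_triangle:
  assumes "sobolev 1 u" "sobolev 1 v" shows "\<bar>Vnorm u - Vnorm v\<bar> \<le> Vnorm (\<lambda>x. u x - v x)"
  using Vnorm_triangle[OF sobolev_diff[OF assms] assms(2)]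
    Vnorm_triangle[OF sobolev_diff[OF assms(2,1)] assms(1)] Vnorm_diff_commute[OF assms] by simp

lemma l2norm_reverse_triangle:
  assumes "L2 u" "L2 v" shows "\<bar>l2norm u - l2norm v\<bar> \<le> l2norm (\<lambda>x. u x - v x)"
  using l2norm_triangle[OF L2_diff[OF assms] assms(2)] l2norm_triangle[OF L2_diff[OF assms(2,1)] assms(1)]
    l2norm_scaleR[of "-1" "\<lambda>x. u x - v x"] by simp

lemma continuous_on_of_increment:
  fixes f :: "real \<Rightarrow> real"
  assumes "\<And>t. t \<in> I \<Longrightarrow> (g t \<longlongrightarrow> 0) (at t within I)" "\<And>s t. s \<in> I \<Longrightarrow> t \<in> I \<Longrightarrow> \<bar>f s - f t\<bar> \<le> g t s"
  shows "continuous_on I f"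
  unfolding continuous_on_def
proof
  fix t assume t: "t \<in> I"
  have "((\<lambda>s. f s - f t) \<longlongrightarrow> 0) (at t within I)"
    by (rule Lim_null_comparison[OF eventually_within_self assms(1)[OF t]]) (use assms(2) t in simp)
  then show "(f \<longlongrightarrow> f t) (at t within I)" by (simp add: LIM_zero_iff)
qed

lemma continuous_on_Vnorm: assumes u: "C_into Vspace Vnorm I u" shows "continuous_on I (\<lambda>t. Vnorm (u t))"
proof (rule continuous_on_of_increment)
  fix s t assume "s \<in> I" "t \<in> I"
  then show "\<bar>Vnorm (u s) - Vnorm (u t)\<bar> \<le> Vnorm (\<lambda>x. u s x - u t x)"
    by (intro Vnorm_reverse_triangle Vspace_sobolev C_into_Vspace[OF u])
qed (rule C_into_tendsto[OF u])

lemma continuous_on_l2norm: assumes u: "C_into Vspace Vnorm I u" shows "continuous_on I (\<lambda>t. l2norm (u t))"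
proof (rule continuous_on_of_increment)
  fix s t assume st: "s \<in> I" "t \<in> I"
  have "\<bar>l2norm (u s) - l2norm (u t)\<bar> \<le> l2norm (\<lambda>x. u s x - u t x)"
    by (intro l2norm_reverse_triangle Vspace_L2 C_into_Vspace[OF u] st)
  also have "\<dots> \<le> Vnorm (\<lambda>x. u s x - u t x)"
    by (intro poincare Vspace_diff C_into_Vspace[OF u] st)
  finally show "\<bar>l2norm (u s) - l2norm (u t)\<bar> \<le> Vnorm (\<lambda>x. u s x - u t x)" .
qed (rule C_into_tendsto[OF u])

lemma Vnorm_bounded:
  assumes u: "C_into Vspace Vnorm {0..T} u" shows "\<exists>R\<ge>0. \<forall>t\<in>{0..T}. Vnorm (u t) \<le> R"
proof -
  have "bounded ((\<lambda>t. Vnorm (u t)) ` {0..T})"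
    by (intro compact_imp_bounded compact_continuous_image continuous_on_Vnorm u compact_Icc)
  then obtain R where "\<forall>t\<in>{0..T}. norm (Vnorm (u t)) \<le> R" unfolding bounded_iff by blast
  then show ?thesis by (intro exI[of _ "max R 0"]) (auto simp: le_max_iff_disj)
qed

lemma continuous_on_convect:
  assumes u: "C_into Vspace Vnorm I u" and v: "C_into Vspace Vnorm I v" and w: "w \<in> Vspace"
  shows "continuous_on I (\<lambda>t. convect (u t) (v t) w)"
proof -
  obtain K where K0: "0 \<le> K" and K: "\<And>u v w. u \<in> Vspace \<Longrightarrow> sobolev 1 v \<Longrightarrow> w \<in> Vspace \<Longrightarrow>
    \<bar>convect u v w\<bar> \<le> K * Vnorm u * Vnorm v * Vnorm w" using convect_bound by blast
  let ?du = "\<lambda>t s. Vnorm (\<lambda>x. u s x - u t x)" and ?dv = "\<lambda>t s. Vnorm (\<lambda>x. v s x - v t x)"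
  show ?thesis
  proof (rule continuous_on_of_increment)
    fix t assume t: "t \<in> I"
    have "((\<lambda>s. K * ?du t s * (Vnorm (v t) + ?dv t s) * Vnorm w + K * Vnorm (u t) * ?dv t s * Vnorm w)
        \<longlongrightarrow> K * 0 * (Vnorm (v t) + 0) * Vnorm w + K * Vnorm (u t) * 0 * Vnorm w) (at t within I)"
      by (intro tendsto_intros C_into_tendsto u v t)
    then show "((\<lambda>s. K * ?du t s * (Vnorm (v t) + ?dv t s) * Vnorm w + K * Vnorm (u t) * ?dv t s * Vnorm w) \<longlongrightarrow> 0) (at t within I)"
      by simp
  next
    fix s t assume s: "s \<in> I" and t: "t \<in> I"
    note V = C_into_Vspace[OF u s] C_into_Vspace[OF u t] C_into_Vspace[OF v s] C_into_Vspace[OF v t]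
    note S = V[THEN Vspace_sobolev]
    have "convect (u s) (v s) w - convect (u t) (v t) w =
        convect (\<lambda>x. u s x - u t x) (v s) w + convect (u t) (\<lambda>x. v s x - v t x) w"
      by (simp add: convect_diff1 convect_diff2 V S w)
    moreover have "\<bar>convect (\<lambda>x. u s x - u t x) (v s) w\<bar> \<le> K * ?du t s * Vnorm (v s) * Vnorm w"
      by (intro K Vspace_diff V S w)
    moreover have "K * ?du t s * Vnorm (v s) * Vnorm w \<le> K * ?du t s * (Vnorm (v t) + ?dv t s) * Vnorm w"
      using Vnorm_reverse_triangle[OF S(3,4)] K0 by (intro mult_left_mono mult_right_mono) auto
    moreover have "\<bar>convect (u t) (\<lambda>x. v s x - v t x) w\<bar> \<le> K * Vnorm (u t) * ?dv t s * Vnorm w"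
      by (intro K sobolev_diff V S w)
    ultimately show "\<bar>convect (u s) (v s) w - convect (u t) (v t) w\<bar> \<le>
        K * ?du t s * (Vnorm (v t) + ?dv t s) * Vnorm w + K * Vnorm (u t) * ?dv t s * Vnorm w" by linarith
  qed
qed

lemma continuous_on_stokes:
  assumes u: "C_into Vspace Vnorm I u" and w: "w \<in> Vspace"
  shows "continuous_on I (\<lambda>t. stokes (u t) w)"
proof (rule continuous_on_of_increment)
  fix t assume t: "t \<in> I"
  show "((\<lambda>s. Vnorm (\<lambda>x. u s x - u t x) * Vnorm w) \<longlongrightarrow> 0) (at t within I)"
    using tendsto_mult_right[OF C_into_tendsto[OF u t], of "Vnorm w"] by simp
  fix s assume s: "s \<in> I"
  note S = C_into_Vspace[OF u s, THEN Vspace_sobolev] C_into_Vspace[OF u t, THEN Vspace_sobolev]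
  have "stokes (u s) w - stokes (u t) w = stokes (\<lambda>x. u s x - u t x) w"
    by (simp add: stokes_diff_left S Vspace_sobolev[OF w])
  then show "\<bar>stokes (u s) w - stokes (u t) w\<bar> \<le> Vnorm (\<lambda>x. u s x - u t x) * Vnorm w"
    by (simp add: stokes_bound sobolev_diff S Vspace_sobolev[OF w])
qed

lemma continuous_on_ip:
  assumes u: "C_into Vspace Vnorm I u" and w: "w \<in> Vspace"
  shows "continuous_on I (\<lambda>t. ip (u t) w)"
proof (rule continuous_on_of_increment)
  fix t assume t: "t \<in> I"
  show "((\<lambda>s. Vnorm (\<lambda>x. u s x - u t x) * l2norm w) \<longlongrightarrow> 0) (at t within I)"
    using tendsto_mult_right[OF C_into_tendsto[OF u t], of "l2norm w"] by simp
  fix s assume s: "s \<in> I"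
  note V = C_into_Vspace[OF u s] C_into_Vspace[OF u t]
  have "ip (u s) w - ip (u t) w = ip (\<lambda>x. u s x - u t x) w"
    by (simp add: ip_diff_left V Vspace_L2 w)
  also have "\<bar>\<dots>\<bar> \<le> l2norm (\<lambda>x. u s x - u t x) * l2norm w"
    by (intro ip_Cauchy_Schwarz L2_diff Vspace_L2 V w)
  also have "\<dots> \<le> Vnorm (\<lambda>x. u s x - u t x) * l2norm w"
    by (intro mult_right_mono poincare Vspace_diff V l2norm_nonneg)
  finally show "\<bar>ip (u s) w - ip (u t) w\<bar> \<le> Vnorm (\<lambda>x. u s x - u t x) * l2norm w" .
qed

section \<open>The weak formulation common to both systems\<close>

text \<open>
  Tested with a fixed element of \<open>V\<close>, both systems hold with classical time derivatives, because
  the right-hand sides are continuous in time. The value \<open>\<alpha> = 0\<close> gives the MHD system.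
\<close>

definition weak_system :: "real \<Rightarrow> real \<Rightarrow> real \<Rightarrow> (real \<Rightarrow> field) \<Rightarrow> (real \<Rightarrow> field) \<Rightarrow> bool" where
  "weak_system \<alpha> \<mu> T u b \<longleftrightarrow>
     C_into Vspace Vnorm {0..T} u \<and> C_into Vspace Vnorm {0..T} b \<and>
     (\<forall>w\<in>Vspace. \<forall>t\<in>{0..T}.
        ((\<lambda>s. \<alpha>\<^sup>2 * stokes (u s) w + ip (u s) w) has_real_derivative
          convect (b t) (b t) w - convect (u t) (u t) w) (at t within {0..T}) \<and>
        ((\<lambda>s. ip (b s) w) has_real_derivative
          convect (b t) (u t) w - convect (u t) (b t) w - \<mu> * stokes (b t) w) (at t within {0..T}))"

text \<open>
  A primitive does not notice null sets, so that the continuous representative \<open>h\<close> of the integrand is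
  the derivative at every time.
\<close>

lemma has_derivative_of_AE_integrand:
  fixes f h \<Phi> :: "real \<Rightarrow> real"
  assumes int: "\<And>t. t \<in> {0..T} \<Longrightarrow> \<Phi> t = \<Phi> 0 + (LINT r|lebesgue_on {0..t}. f r)"
    and f: "f \<in> borel_measurable (lebesgue_on {0..T})" and h: "continuous_on {0..T} h"
    and eq: "AE r in lebesgue_on {0..T}. f r = h r" and t: "t \<in> {0..T}"
  shows "(\<Phi> has_real_derivative h t) (at t within {0..T})"
proof -
  have \<Phi>: "\<Phi> s = \<Phi> 0 + integral {0..s} h" if s: "s \<in> {0..T}" for s
  proof -
    have sub: "{0..s} \<subseteq> {0..T}" using s by auto
    have hs: "continuous_on {0..s} h" by (rule continuous_on_subset[OF h sub])
    have hi: "integrable (lebesgue_on {0..s}) h" by (rule continuous_imp_integrable_real[OF hs])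
    have "AE r in lebesgue. r \<in> {0..T} \<longrightarrow> f r = h r"
      using eq by (subst (asm) AE_restrict_space_iff) simp_all
    then have "AE r in lebesgue. r \<in> {0..s} \<longrightarrow> f r = h r"
      by (rule eventually_mono) (use sub in auto)
    then have "AE r in lebesgue_on {0..s}. f r = h r"
      by (subst AE_restrict_space_iff) simp_all
    moreover have "f \<in> borel_measurable (lebesgue_on {0..s})"
      by (rule measurable_restrict_mono[OF f sub])
    ultimately have "(LINT r|lebesgue_on {0..s}. f r) = (LINT r|lebesgue_on {0..s}. h r)"
      using hi by (intro integral_cong_AE) auto
    also have "\<dots> = integral {0..s} h" by (rule lebesgue_integral_eq_integral[OF hi]) simp
    finally show ?thesis using int[OF s] by simp
  qed
  have "((\<lambda>s. \<Phi> 0 + integral {0..s} h) has_real_derivative h t) (at t within {0..T})"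
    using DERIV_add[OF DERIV_const integral_has_real_derivative[OF h t], of "\<Phi> 0"] by simp
  then show ?thesis
    by (rule has_field_derivative_transform_within[OF _ zero_less_one t]) (rule \<Phi>[symmetric])
qed

text \<open>
  A functional that is bounded on \<open>V\<close> preserves the convergence of the difference quotients.
\<close>

lemma deriv_in_norm_functional:
  fixes G :: "field \<Rightarrow> real"
  assumes u: "C_into Vspace Vnorm I u" and u': "C_into Vspace Vnorm I u'" and d: "deriv_in_norm Vnorm I u u'"
    and diff: "\<And>v w. v \<in> Vspace \<Longrightarrow> w \<in> Vspace \<Longrightarrow> G (\<lambda>x. v x - w x) = G v - G w"
    and scale: "\<And>v c. v \<in> Vspace \<Longrightarrow> G (\<lambda>x. c *\<^sub>R v x) = c * G v"
    and bound: "\<And>v. v \<in> Vspace \<Longrightarrow> \<bar>G v\<bar> \<le> C * Vnorm v" and t: "t \<in> I"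
  shows "((\<lambda>s. G (u s)) has_real_derivative G (u' t)) (at t within I)"
proof -
  let ?q = "\<lambda>s x. (u s x - u t x) /\<^sub>R (s - t) - u' t x"
  have "((\<lambda>s. (G (u s) - G (u t)) / (s - t) - G (u' t)) \<longlongrightarrow> 0) (at t within I)"
  proof (rule Lim_null_comparison)
    show "((\<lambda>s. C * Vnorm (?q s)) \<longlongrightarrow> 0) (at t within I)"
      using d t tendsto_mult_left[of "\<lambda>s. Vnorm (?q s)" 0 _ C] by (simp add: deriv_in_norm_def)
    show "\<forall>\<^sub>F s in at t within I. norm ((G (u s) - G (u t)) / (s - t) - G (u' t)) \<le> C * Vnorm (?q s)"
    proof (rule eventually_within_self)
      fix s assume s: "s \<in> I"
      note V = C_into_Vspace[OF u s] C_into_Vspace[OF u t] C_into_Vspace[OF u' t]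
      have "G (?q s) = (G (u s) - G (u t)) / (s - t) - G (u' t)"
        by (simp add: diff scale Vspace_diff Vspace_scaleR V divide_inverse mult.commute)
      moreover have "\<bar>G (?q s)\<bar> \<le> C * Vnorm (?q s)"
        by (intro bound Vspace_diff Vspace_scaleR V)
      ultimately show "norm ((G (u s) - G (u t)) / (s - t) - G (u' t)) \<le> C * Vnorm (?q s)" by simp
    qed
  qed
  then show ?thesis unfolding has_field_derivative_iff by (simp add: LIM_zero_iff)
qed

lemma voigt_weak_system:
  assumes sol: "voigt_solution \<alpha> \<mu> T u0 b0 u b" and T: "0 < T"
  shows "weak_system \<alpha> \<mu> T u b"
proof -
  have u: "C_into Vspace Vnorm {0..T} u" and b: "C_into Vspace Vnorm {0..T} b"
    using sol by (auto simp: voigt_solution_def)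
  obtain u' b' where u': "C_into Vspace Vnorm {0..T} u'" and d: "deriv_in_norm Vnorm {0..T} u u'"
    and b': "L2_into Hspace l2norm T b'" "weak_time_deriv T b b'"
    and e1: "eq_Lp_dual (4/3) T (\<lambda>t w. \<alpha>\<^sup>2 * stokes (u' t) w + ip (u' t) w)
          (\<lambda>t w. convect (b t) (b t) w - convect (u t) (u t) w)"
    and e2: "eq_Lp_dual 2 T (\<lambda>t w. ip (b' t) w + \<mu> * stokes (b t) w)
          (\<lambda>t w. convect (b t) (u t) w - convect (u t) (b t) w)"
    using sol unfolding voigt_solution_def by blast
  show ?thesis
    unfolding weak_system_def
  proof (intro conjI u b ballI)
    fix w t assume w: "w \<in> Vspace" and t: "t \<in> {0..T}"
    let ?G = "\<lambda>v. \<alpha>\<^sup>2 * stokes v w + ip v w"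
    have cG: "continuous_on {0..T} (\<lambda>s. ?G (u' s))"
      by (intro continuous_intros continuous_on_stokes continuous_on_ip u' w)
    have dG: "((\<lambda>s. ?G (u s)) has_real_derivative ?G (u' s)) (at s within {0..T})" if "s \<in> {0..T}" for s
    proof (rule deriv_in_norm_functional[OF u u' d _ _ _ that])
      show "?G (\<lambda>x. v x - v' x) = ?G v - ?G v'" if "v \<in> Vspace" "v' \<in> Vspace" for v v'
        by (simp add: stokes_diff_left ip_diff_left that Vspace_sobolev Vspace_L2 w right_diff_distrib)
      show "?G (\<lambda>x. c *\<^sub>R v x) = c * ?G v" if "v \<in> Vspace" for v c
        by (simp add: stokes_scaleR_left ip_scaleR_left that Vspace_sobolev w distrib_left)
      show "\<bar>?G v\<bar> \<le> (\<alpha>\<^sup>2 * Vnorm w + l2norm w) * Vnorm v" if v: "v \<in> Vspace" for v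
      proof -
        have "\<bar>\<alpha>\<^sup>2 * stokes v w\<bar> \<le> \<alpha>\<^sup>2 * (Vnorm v * Vnorm w)"
          unfolding abs_mult by (simp add: mult_left_mono stokes_bound Vspace_sobolev v w)
        moreover have "\<bar>ip v w\<bar> \<le> l2norm v * l2norm w" by (intro ip_Cauchy_Schwarz Vspace_L2 v w)
        moreover have "l2norm v * l2norm w \<le> Vnorm v * l2norm w" by (intro mult_right_mono poincare v) simp
        ultimately show ?thesis by (simp add: algebra_simps)
      qed
    qed
    show "((\<lambda>s. ?G (u s)) has_real_derivative convect (b t) (b t) w - convect (u t) (u t) w) (at t within {0..T})"
    proof (rule has_derivative_of_AE_integrand[where f = "\<lambda>s. ?G (u' s)"])
      fix s assume s: "s \<in> {0..T}"
      have sub: "{0..s} \<subseteq> {0..T}" using s by auto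
      have c: "continuous_on {0..s} (\<lambda>s. ?G (u' s))" by (rule continuous_on_subset[OF cG sub])
      have "((\<lambda>r. ?G (u' r)) has_integral ?G (u s) - ?G (u 0)) {0..s}"
      proof (rule fundamental_theorem_of_calculus)
        show "((\<lambda>s. ?G (u s)) has_vector_derivative ?G (u' r)) (at r within {0..s})" if "r \<in> {0..s}" for r
          using DERIV_subset[OF dG sub] that sub unfolding has_real_derivative_iff_has_vector_derivative by blast
      qed (use s in auto)
      moreover have "(LINT r|lebesgue_on {0..s}. ?G (u' r)) = integral {0..s} (\<lambda>r. ?G (u' r))"
        by (rule lebesgue_integral_eq_integral[OF continuous_imp_integrable_real[OF c]]) simp
      ultimately show "?G (u s) = ?G (u 0) + (LINT r|lebesgue_on {0..s}. ?G (u' r))"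
        by (simp add: integral_unique)
    next
      show "(\<lambda>s. ?G (u' s)) \<in> borel_measurable (lebesgue_on {0..T})"
        by (rule borel_measurable_integrable[OF continuous_imp_integrable_real[OF cG]])
      show "continuous_on {0..T} (\<lambda>t. convect (b t) (b t) w - convect (u t) (u t) w)"
        by (intro continuous_intros continuous_on_convect u b w)
      show "AE r in lebesgue_on {0..T}. ?G (u' r) = convect (b r) (b r) w - convect (u r) (u r) w"
        using e1 w unfolding eq_Lp_dual_def by (auto elim: eventually_mono)
    qed (rule t)
    show "((\<lambda>s. ip (b s) w) has_real_derivative convect (b t) (u t) w - convect (u t) (b t) w - \<mu> * stokes (b t) w)
        (at t within {0..T})"
    proof (rule has_derivative_of_AE_integrand[where f = "\<lambda>s. ip (b' s) w"])
      show "ip (b s) w = ip (b 0) w + (LINT r|lebesgue_on {0..s}. ip (b' r) w)" if "s \<in> {0..T}" for s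
        using b'(2) that Vspace_L2[OF w] unfolding weak_time_deriv_def by blast
      show "(\<lambda>s. ip (b' s) w) \<in> borel_measurable (lebesgue_on {0..T})"
        using b'(1) Vspace_L2[OF w] unfolding L2_into_def by blast
      show "continuous_on {0..T} (\<lambda>t. convect (b t) (u t) w - convect (u t) (b t) w - \<mu> * stokes (b t) w)"
        by (intro continuous_intros continuous_on_convect continuous_on_stokes u b w)
      have "AE r in lebesgue_on {0..T}. \<forall>w\<in>Vspace. ip (b' r) w + \<mu> * stokes (b r) w = convect (b r) (u r) w - convect (u r) (b r) w"
        using e2 unfolding eq_Lp_dual_def by blast
      then show "AE r in lebesgue_on {0..T}. ip (b' r) w = convect (b r) (u r) w - convect (u r) (b r) w - \<mu> * stokes (b r) w"
        by (rule eventually_mono) (use w in \<open>auto simp: algebra_simps\<close>)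
    qed (rule t)
  qed
qed

lemma advect_L2:
  fixes u v :: field
  assumes u: "L2 u" "AE x in torus. norm (u x) \<le> M" and v: "sobolev 1 v" shows "L2 (advect u v)"
  unfolding advect_def[abs_def]
proof (intro L2_sum finite_class.finite_UNIV L2_bounded_scaleR wd_L2 v)
  fix i
  show "(\<lambda>x. u x $ i) \<in> borel_measurable torus" by (intro L2_measurable L2_nth u)
  show "AE x in torus. \<bar>u x $ i\<bar> \<le> M"
    using u(2) by (rule eventually_mono) (meson component_le_norm_cart order_trans)
qed

text \<open>Pairing a pointwise identity with a field in \<open>V\<close> removes the pressure gradient.\<close>

lemma momentum_tested:
  fixes f a c l :: field
  assumes f: "L2 f" and a: "L2 a" and c: "L2 c" and l: "L2 l" and p: "sobolev 1 p" and w: "w \<in> Vspace"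
    and eq: "AE x in torus. f x + a x - c x + grad p x = l x"
  shows "ip f w = ip c w - ip a w + ip l w"
proof -
  note g = grad_L2[OF p] and W = Vspace_L2[OF w]
  have "ip f w = ip (\<lambda>x. (c x - a x) + l x - grad p x) w"
  proof (rule ip_cong_AE)
    show "AE x in torus. f x = (c x - a x) + l x - grad p x"
      using eq by (rule eventually_mono) (simp add: algebra_simps)
  qed (intro L2_measurable L2_add L2_diff f a c l g W | simp)+
  also have "\<dots> = ip c w - ip a w + ip l w - ip (grad p) w"
    by (simp add: ip_add_left ip_diff_left L2_add L2_diff f a c l g W)
  finally show ?thesis by (simp add: grad_ip[OF p w])
qed

lemma sobnorm_curve_bounded:
  assumes u: "C_into {v \<in> Vspace. sobolev 3 v} (sobnorm 3) {0..<S} u" and T: "T < S"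
  shows "\<exists>R\<ge>0. \<forall>t\<in>{0..T}. sobnorm 3 (u t) \<le> R"
proof -
  have sub: "{0..T} \<subseteq> {0..<S}" using T by auto
  have "continuous_on {0..<S} (\<lambda>t. sobnorm 3 (u t))"
  proof (rule continuous_on_of_increment)
    show "((\<lambda>s. sobnorm 3 (\<lambda>x. u s x - u t x)) \<longlongrightarrow> 0) (at t within {0..<S})" if "t \<in> {0..<S}" for t
      using u that unfolding C_into_def continuous_in_norm_def by blast
    fix s t assume st: "s \<in> {0..<S}" "t \<in> {0..<S}"
    have s3: "sobolev 3 (u s)" "sobolev 3 (u t)" using u st by (auto simp: C_into_def)
    show "\<bar>sobnorm 3 (u s) - sobnorm 3 (u t)\<bar> \<le> sobnorm 3 (\<lambda>x. u s x - u t x)"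
      using sobnorm_triangle[OF sobolev_diff[OF s3] s3(2)] sobnorm_triangle[OF sobolev_diff[OF s3(2,1)] s3(1)]
        sobnorm_scaleR[OF sobolev_diff[OF s3], of "-1"] by simp
  qed
  then have "bounded ((\<lambda>t. sobnorm 3 (u t)) ` {0..T})"
    by (intro compact_imp_bounded compact_continuous_image compact_Icc) (rule continuous_on_subset[OF _ sub])
  then obtain R where "\<forall>t\<in>{0..T}. norm (sobnorm 3 (u t)) \<le> R" unfolding bounded_iff by blast
  then show ?thesis by (intro exI[of _ "max R 0"]) (auto simp: le_max_iff_disj)
qed

lemma C_into_sobolev_3_Vspace:
  assumes u: "C_into {v \<in> Vspace. sobolev 3 v} (sobnorm 3) {0..<S} u" and T: "T < S"
  shows "C_into Vspace Vnorm {0..T} u"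
  unfolding C_into_def continuous_in_norm_def
proof (intro conjI ballI)
  have sub: "{0..T} \<subseteq> {0..<S}" using T by auto
  fix t assume t: "t \<in> {0..T}"
  have V: "u s \<in> Vspace \<and> sobolev 3 (u s)" if "s \<in> {0..T}" for s using u sub that by (auto simp: C_into_def)
  then show "u t \<in> Vspace" using t by blast
  have "((\<lambda>s. sobnorm 3 (\<lambda>x. u s x - u t x)) \<longlongrightarrow> 0) (at t within {0..<S})"
    using u t sub unfolding C_into_def continuous_in_norm_def by blast
  then have lim: "((\<lambda>s. sobnorm 3 (\<lambda>x. u s x - u t x)) \<longlongrightarrow> 0) (at t within {0..T})"
    by (rule tendsto_within_subset[OF _ sub])
  show "((\<lambda>s. Vnorm (\<lambda>x. u s x - u t x)) \<longlongrightarrow> 0) (at t within {0..T})"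
    by (rule Lim_null_comparison[OF eventually_within_self lim])
       (use V t in \<open>simp add: Vnorm_le_sobnorm_3 sobolev_diff\<close>)
qed

lemma mhd_weak_system:
  assumes sol: "mhd_solution \<mu> S u0 b0 u b" and T: "0 < T" "T < S"
  shows "weak_system 0 \<mu> T u b"
proof -
  have u3: "C_into {v \<in> Vspace. sobolev 3 v} (sobnorm 3) {0..<S} u"
    and b3: "C_into {v \<in> Vspace. sobolev 3 v} (sobnorm 3) {0..<S} b"
    using sol by (auto simp: mhd_solution_def)
  note u = C_into_sobolev_3_Vspace[OF u3 T(2)] and b = C_into_sobolev_3_Vspace[OF b3 T(2)]
  obtain u' b' p q where
    ub': "L2_into {f. L2 f} l2norm T u'" "weak_time_deriv T u u'" "L2_into {f. L2 f} l2norm T b'" "weak_time_deriv T b b'"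
    and eq: "AE t in lebesgue_on {0..<S}.
           sobolev 1 (\<lambda>x. p t x + (norm (b t x))\<^sup>2 / 2) \<and> sobolev 1 (q t) \<and>
           (AE x in torus.
              u' t x + advect (u t) (u t) x + grad (\<lambda>y. p t y + (norm (b t y))\<^sup>2 / 2) x
              = advect (b t) (b t) x) \<and>
           (AE x in torus.
              b' t x + advect (u t) (b t) x - advect (b t) (u t) x + grad (q t) x
              = \<mu> *\<^sub>R laplacian (b t) x)"
    using sol T unfolding mhd_solution_def by blast
  have sub: "{0..T} \<subseteq> {0..<S}" using T by auto
  obtain C where C: "\<And>v :: field. sobolev 3 v \<Longrightarrow> AE x in torus. norm (v x) \<le> C * sobnorm 3 v"
    using sobolev_3_bounded by blast
  have "AE t in lebesgue. t \<in> {0..<S} \<longrightarrow> (sobolev 1 (\<lambda>x. p t x + (norm (b t x))\<^sup>2 / 2) \<and> sobolev 1 (q t) \<and>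
           (AE x in torus.
              u' t x + advect (u t) (u t) x + grad (\<lambda>y. p t y + (norm (b t y))\<^sup>2 / 2) x
              = advect (b t) (b t) x) \<and>
           (AE x in torus.
              b' t x + advect (u t) (b t) x - advect (b t) (u t) x + grad (q t) x
              = \<mu> *\<^sub>R laplacian (b t) x))"
    using eq by (subst (asm) AE_restrict_space_iff) simp_all
  moreover have "AE t in lebesgue. t \<in> {0..T} \<longrightarrow> L2 (u' t) \<and> L2 (b' t)"
  proof -
    have "AE t in lebesgue_on {0..T}. L2 (u' t) \<and> L2 (b' t)"
      using ub'(1,3) unfolding L2_into_def by (auto elim: eventually_elim2)
    then show ?thesis by (subst (asm) AE_restrict_space_iff) simp_all
  qed
  ultimately have "AE t in lebesgue. t \<in> {0..T} \<longrightarrow> (\<forall>w\<in>Vspace.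
      ip (u' t) w = convect (b t) (b t) w - convect (u t) (u t) w \<and>
      ip (b' t) w = convect (b t) (u t) w - convect (u t) (b t) w - \<mu> * stokes (b t) w)"
  proof eventually_elim
    case (elim t)
    show ?case
    proof (intro impI ballI)
      fix w assume t: "t \<in> {0..T}" and w: "w \<in> Vspace"
      have tS: "t \<in> {0..<S}" using t sub by blast
      note V = C_into_Vspace[OF u t] C_into_Vspace[OF b t]
      have s3: "sobolev 3 (u t)" "sobolev 3 (b t)" using u3 b3 tS by (auto simp: C_into_def)
      note s = V[THEN Vspace_sobolev]
      have A: "L2 (advect (u t) v)" "L2 (advect (b t) v)" if "sobolev 1 v" for v
        using advect_L2[OF Vspace_L2[OF V(1)] C[OF s3(1)] that] advect_L2[OF Vspace_L2[OF V(2)] C[OF s3(2)] that] by auto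
      have lap: "L2 (laplacian (b t))" by (rule laplacian_L2[OF sobolev_3_2[OF s3(2)]])
      have "ip (u' t) w = ip (advect (b t) (b t)) w - ip (advect (u t) (u t)) w + ip (\<lambda>x. 0) w"
      proof (rule momentum_tested)
        show "AE x in torus. u' t x + advect (u t) (u t) x - advect (b t) (b t) x +
            grad (\<lambda>y. p t y + (norm (b t y))\<^sup>2 / 2) x = 0"
          using elim tS by (auto simp: algebra_simps elim: eventually_mono)
      qed (use elim t tS A s w L2_zero in auto)
      moreover have "ip (b' t) w = ip (advect (b t) (u t)) w - ip (advect (u t) (b t)) w + ip (\<lambda>x. \<mu> *\<^sub>R laplacian (b t) x) w"
        by (rule momentum_tested[where p = "q t"]) (use elim t tS A s w L2_scaleR[OF lap] in auto)
      moreover have "ip (\<lambda>x. \<mu> *\<^sub>R laplacian (b t) x) w = - \<mu> * stokes (b t) w"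
        by (simp add: ip_scaleR_left laplacian_ip[OF sobolev_3_2[OF s3(2)] w])
      ultimately show "ip (u' t) w = convect (b t) (b t) w - convect (u t) (u t) w \<and>
          ip (b' t) w = convect (b t) (u t) w - convect (u t) (b t) w - \<mu> * stokes (b t) w"
        by (simp add: convect_def ip_def[of "\<lambda>x. 0"])
    qed
  qed
  then have ae: "AE t in lebesgue_on {0..T}. \<forall>w\<in>Vspace.
      ip (u' t) w = convect (b t) (b t) w - convect (u t) (u t) w \<and>
      ip (b' t) w = convect (b t) (u t) w - convect (u t) (b t) w - \<mu> * stokes (b t) w"
    by (subst AE_restrict_space_iff) simp_all
  show ?thesis
    unfolding weak_system_def
  proof (intro conjI u b ballI)
    fix w t assume w: "w \<in> Vspace" and t: "t \<in> {0..T}"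
    have "((\<lambda>s. ip (u s) w) has_real_derivative convect (b t) (b t) w - convect (u t) (u t) w) (at t within {0..T})"
    proof (rule has_derivative_of_AE_integrand[where f = "\<lambda>s. ip (u' s) w"])
      show "ip (u s) w = ip (u 0) w + (LINT r|lebesgue_on {0..s}. ip (u' r) w)" if "s \<in> {0..T}" for s
        using ub'(2) that Vspace_L2[OF w] unfolding weak_time_deriv_def by blast
      show "(\<lambda>s. ip (u' s) w) \<in> borel_measurable (lebesgue_on {0..T})"
        using ub'(1) Vspace_L2[OF w] unfolding L2_into_def by blast
      show "continuous_on {0..T} (\<lambda>t. convect (b t) (b t) w - convect (u t) (u t) w)"
        by (intro continuous_intros continuous_on_convect u b w)
      show "AE r in lebesgue_on {0..T}. ip (u' r) w = convect (b r) (b r) w - convect (u r) (u r) w"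
        using ae by (rule eventually_mono) (use w in auto)
    qed (rule t)
    then show "((\<lambda>s. 0\<^sup>2 * stokes (u s) w + ip (u s) w) has_real_derivative
        convect (b t) (b t) w - convect (u t) (u t) w) (at t within {0..T})" by simp
    show "((\<lambda>s. ip (b s) w) has_real_derivative convect (b t) (u t) w - convect (u t) (b t) w - \<mu> * stokes (b t) w)
        (at t within {0..T})"
    proof (rule has_derivative_of_AE_integrand[where f = "\<lambda>s. ip (b' s) w"])
      show "ip (b s) w = ip (b 0) w + (LINT r|lebesgue_on {0..s}. ip (b' r) w)" if "s \<in> {0..T}" for s
        using ub'(4) that Vspace_L2[OF w] unfolding weak_time_deriv_def by blast
      show "(\<lambda>s. ip (b' s) w) \<in> borel_measurable (lebesgue_on {0..T})"
        using ub'(3) Vspace_L2[OF w] unfolding L2_into_def by blast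
      show "continuous_on {0..T} (\<lambda>t. convect (b t) (u t) w - convect (u t) (b t) w - \<mu> * stokes (b t) w)"
        by (intro continuous_intros continuous_on_convect continuous_on_stokes u b w)
      show "AE r in lebesgue_on {0..T}. ip (b' r) w = convect (b r) (u r) w - convect (u r) (b r) w - \<mu> * stokes (b r) w"
        using ae by (rule eventually_mono) (use w in auto)
    qed (rule t)
  qed
qed

section \<open>Lipschitz continuity of the regular solution in \<open>V\<close>\<close>

lemma weak_system_ip_derivative:
  assumes "weak_system 0 \<mu> T u b" "w \<in> Vspace" "t \<in> {0..T}"
  shows "((\<lambda>s. ip (u s) w) has_real_derivative convect (b t) (b t) w - convect (u t) (u t) w) (at t within {0..T})"
proof -
  have "((\<lambda>s. 0\<^sup>2 * stokes (u s) w + ip (u s) w) has_real_derivative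
          convect (b t) (b t) w - convect (u t) (u t) w) (at t within {0..T})"
    using assms unfolding weak_system_def by blast
  then show ?thesis by simp
qed

lemma mvt_within:
  fixes f :: "real \<Rightarrow> real"
  assumes "s < t" "{s..t} \<subseteq> S" "\<And>r. r \<in> S \<Longrightarrow> (f has_real_derivative f' r) (at r within S)"
  shows "\<exists>r\<in>{s<..<t}. f t - f s = f' r * (t - s)"
proof (rule mvt_simple[OF assms(1)])
  fix r assume "s \<le> r" "r \<le> t"
  then have "(f has_real_derivative f' r) (at r within {s..t})"
    using DERIV_subset[OF assms(3) assms(2)] assms(2) by auto
  then show "(f has_derivative (*) (f' r)) (at r within {s..t})" by (simp add: has_field_derivative_def)
qed

text \<open>
  The time derivative of \<open>u\<close> belongs to \<open>H\<^sup>1\<close> uniformly in time. Testing with \<open>\<triangle>\<phi>\<close> for polynomials \<open>\<phi>\<close> shows this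
  for the increments, without constructing the derivative.
\<close>

lemma regular_solution_Lipschitz:
  assumes sys: "weak_system 0 \<mu> T u b"
    and u3: "\<And>t. t \<in> {0..T} \<Longrightarrow> sobolev 3 (u t) \<and> sobnorm 3 (u t) \<le> R"
    and b3: "\<And>t. t \<in> {0..T} \<Longrightarrow> sobolev 3 (b t) \<and> sobnorm 3 (b t) \<le> R"
  shows "\<exists>L\<ge>0. \<forall>s t w. 0 \<le> s \<and> s \<le> t \<and> t \<le> T \<and> w \<in> Vspace \<longrightarrow>
    \<bar>stokes (\<lambda>x. u t x - u s x) w\<bar> \<le> L * (t - s) * Vnorm w"
proof -
  have u: "C_into Vspace Vnorm {0..T} u" and b: "C_into Vspace Vnorm {0..T} b"
    using sys by (auto simp: weak_system_def)
  obtain K where K0: "0 \<le> K" and K: "\<And>b \<phi>. b \<in> Vspace \<Longrightarrow> sobolev 3 b \<Longrightarrow> \<phi> \<in> solenoidal_polys \<Longrightarrow>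
    \<bar>convect b b (\<lambda>x. \<Sum>j\<in>UNIV. partial j (partial j \<phi>) x)\<bar> \<le> K * (sobnorm 3 b)\<^sup>2 * Vnorm \<phi>"
    using convect_laplacian_bound by blast
  define L where "L = 2 * K * R\<^sup>2"
  have L0: "0 \<le> L" using K0 by (simp add: L_def)
  have polys: "\<bar>stokes (\<lambda>x. u t x - u s x) \<phi>\<bar> \<le> L * (t - s) * Vnorm \<phi>"
    if st: "0 \<le> s" "s < t" "t \<le> T" and \<phi>: "\<phi> \<in> solenoidal_polys" for s t \<phi>
  proof -
    let ?w = "\<lambda>x. \<Sum>j\<in>UNIV. partial j (partial j \<phi>) x"
    note w = polys_Vspace[OF polys_laplacian[OF \<phi>]]
    have V: "u s \<in> Vspace" "u t \<in> Vspace" using C_into_Vspace[OF u] st by auto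
    obtain r where r: "r \<in> {s<..<t}"
      and mv: "ip (u t) ?w - ip (u s) ?w = (convect (b r) (b r) ?w - convect (u r) (u r) ?w) * (t - s)"
      using mvt_within[OF st(2) _ weak_system_ip_derivative[OF sys w]] st by auto
    have rT: "r \<in> {0..T}" using r st by auto
    have bound: "\<bar>convect v v ?w\<bar> \<le> K * R\<^sup>2 * Vnorm \<phi>" if v: "v \<in> Vspace" "sobolev 3 v \<and> sobnorm 3 v \<le> R" for v
    proof -
      have "(sobnorm 3 v)\<^sup>2 \<le> R\<^sup>2" using v(2) by (intro power_mono) auto
      then have "K * (sobnorm 3 v)\<^sup>2 * Vnorm \<phi> \<le> K * R\<^sup>2 * Vnorm \<phi>"
        using K0 by (intro mult_right_mono mult_left_mono) auto
      then show ?thesis using K[OF v(1) _ \<phi>] v(2) by fastforce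
    qed
    have "\<bar>convect (b r) (b r) ?w - convect (u r) (u r) ?w\<bar> \<le> L * Vnorm \<phi>"
      using bound[OF C_into_Vspace[OF u rT] u3[OF rT]] bound[OF C_into_Vspace[OF b rT] b3[OF rT]]
      unfolding L_def by (simp add: algebra_simps)
    then have "\<bar>ip (u t) ?w - ip (u s) ?w\<bar> \<le> L * Vnorm \<phi> * (t - s)"
      unfolding mv abs_mult using st by (intro mult_mono) auto
    moreover have "stokes (\<lambda>x. u t x - u s x) \<phi> = - (ip (u t) ?w - ip (u s) ?w)"
      using stokes_polys[OF polys_trig[OF \<phi>] Vspace_sobolev[OF Vspace_diff[OF V(2,1)]]]
      by (simp add: ip_diff_left Vspace_L2 V w)
    ultimately show ?thesis by (simp add: mult_ac abs_minus_commute)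
  qed
  have "\<bar>stokes (\<lambda>x. u t x - u s x) w\<bar> \<le> L * (t - s) * Vnorm w"
    if st: "0 \<le> s" "s < t" "t \<le> T" and w: "w \<in> Vspace" for s t w
  proof (rule field_le_epsilon)
    fix e :: real assume e: "0 < e"
    let ?d = "\<lambda>x. u t x - u s x"
    have V: "u s \<in> Vspace" "u t \<in> Vspace" using C_into_Vspace[OF u] st by auto
    have d: "?d \<in> Vspace" by (intro Vspace_diff V)
    let ?c = "L * (t - s) + Vnorm ?d + 1"
    have c: "0 < ?c" using L0 st by (intro add_nonneg_pos add_nonneg_nonneg mult_nonneg_nonneg) auto
    define \<delta> where "\<delta> = e / ?c"
    have ec: "0 < \<delta>" using e c by (simp add: \<delta>_def)
    obtain \<phi> where \<phi>: "\<phi> \<in> solenoidal_polys" "Vnorm (\<lambda>x. w x - \<phi> x) < \<delta>"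
      by (rule Vspace_L2_approx[OF w ec])
    note P = polys_Vspace[OF \<phi>(1)]
    note s = Vspace_sobolev[OF d] Vspace_sobolev[OF w] Vspace_sobolev[OF P]
    have "stokes ?d w = stokes ?d \<phi> + stokes ?d (\<lambda>x. w x - \<phi> x)"
      by (simp add: stokes_diff_right s)
    moreover have "\<bar>stokes ?d (\<lambda>x. w x - \<phi> x)\<bar> \<le> Vnorm ?d * Vnorm (\<lambda>x. w x - \<phi> x)"
      by (intro stokes_bound sobolev_diff s)
    moreover have "Vnorm ?d * Vnorm (\<lambda>x. w x - \<phi> x) \<le> Vnorm ?d * \<delta>"
      using \<phi>(2) by (intro mult_left_mono) auto
    moreover have "Vnorm \<phi> \<le> Vnorm w + \<delta>"
      using Vnorm_reverse_triangle[OF s(2,3)] \<phi>(2) by linarith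
    then have "L * (t - s) * Vnorm \<phi> \<le> L * (t - s) * (Vnorm w + \<delta>)"
      using L0 st by (intro mult_left_mono) auto
    moreover have "Vnorm ?d * \<delta> + L * (t - s) * (Vnorm w + \<delta>) \<le> L * (t - s) * Vnorm w + e"
    proof -
      have "(L * (t - s) + Vnorm ?d) * \<delta> \<le> ?c * \<delta>"
        using ec by (intro mult_right_mono) auto
      also have "\<dots> = e" using c by (simp add: \<delta>_def)
      finally show ?thesis by (simp add: algebra_simps)
    qed
    ultimately show "\<bar>stokes ?d w\<bar> \<le> L * (t - s) * Vnorm w + e"
      using polys[OF st \<phi>(1)] by linarith
  qed
  moreover have "\<bar>stokes (\<lambda>x. u t x - u t x) w\<bar> \<le> L * (t - t) * Vnorm w"
    if "t \<in> {0..T}" "w \<in> Vspace" for t w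
    using stokes_diff_left[OF Vspace_sobolev Vspace_sobolev Vspace_sobolev, OF C_into_Vspace[OF u that(1)]
        C_into_Vspace[OF u that(1)] that(2)] by simp
  ultimately have "\<bar>stokes (\<lambda>x. u t x - u s x) w\<bar> \<le> L * (t - s) * Vnorm w"
    if "0 \<le> s" "s \<le> t" "t \<le> T" "w \<in> Vspace" for s t w
    using that by (cases "s = t") auto
  then show ?thesis using L0 by blast
qed

section \<open>The energy of the difference\<close>

lemma stokes_add_left:
  assumes "sobolev 1 u" "sobolev 1 v" "sobolev 1 w"
  shows "stokes (\<lambda>x. u x + v x) w = stokes u w + stokes v w"
  using stokes_diff_left[OF assms(1) sobolev_scaleR[OF assms(2)] assms(3), of "-1"]
    stokes_scaleR_left[OF assms(2,3), of "-1"] by simp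

lemma stokes_add_right:
  assumes "sobolev 1 u" "sobolev 1 v" "sobolev 1 w"
  shows "stokes w (\<lambda>x. u x + v x) = stokes w u + stokes w v"
  using stokes_add_left[OF assms] by (simp add: stokes_commute)

lemma stokes_square_diff:
  assumes "sobolev 1 u" "sobolev 1 v"
  shows "(Vnorm u)\<^sup>2 - (Vnorm v)\<^sup>2 = stokes (\<lambda>x. u x - v x) (\<lambda>x. u x + v x)"
  by (simp add: stokes_diff_left stokes_add_right sobolev_add assms stokes_commute[of v u] flip: stokes_self)

lemma ip_square_diff:
  assumes "L2 u" "L2 v" shows "(l2norm u)\<^sup>2 - (l2norm v)\<^sup>2 = ip (\<lambda>x. u x - v x) (\<lambda>x. u x + v x)"
  by (simp add: ip_diff_left ip_add_right L2_add assms ip_commute[of v u] l2norm_square)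

text \<open>
  The contribution of the quadratic terms to the growth of the energy of the difference; the test
  fields are \<open>w\<close> and \<open>z\<close>.
\<close>

definition nonlin :: "field \<Rightarrow> field \<Rightarrow> field \<Rightarrow> field \<Rightarrow> field \<Rightarrow> field \<Rightarrow> real" where
  "nonlin ua ba u b w z =
     (convect ba ba w - convect ua ua w) - (convect b b w - convect u u w)
   + (convect ba ua z - convect ua ba z) - (convect b u z - convect u b z)"

lemma nonlin_eq:
  assumes V: "ua \<in> Vspace" "ba \<in> Vspace" "u \<in> Vspace" "b \<in> Vspace" "w \<in> Vspace" "z \<in> Vspace"
  defines "U \<equiv> \<lambda>x. ua x - u x" and "W \<equiv> \<lambda>x. ba x - b x"
  shows "nonlin ua ba u b w z = convect ba W w + convect W b w - convect ua U w - convect U u w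
    + convect ba U z + convect W u z - convect ua W z - convect U b z"
  unfolding nonlin_def U_def W_def
  by (simp add: convect_diff1 convect_diff2 V Vspace_sobolev)

lemma nonlin_split:
  assumes V: "ua \<in> Vspace" "ba \<in> Vspace" "u \<in> Vspace" "b \<in> Vspace" "w \<in> Vspace" "z \<in> Vspace"
    "w' \<in> Vspace" "z' \<in> Vspace"
  shows "nonlin ua ba u b w z = 2 * nonlin ua ba u b w' z' + nonlin ua ba u b (\<lambda>x. w x - 2 *\<^sub>R w' x) (\<lambda>x. z x - 2 *\<^sub>R z' x)"
  unfolding nonlin_def
  by (simp add: convect_diff3 convect_scaleR3 V Vspace_scaleR Vspace_sobolev algebra_simps)

text \<open>
  Tested with \<open>(U, W)\<close> itself, the terms in which \<open>ua\<close> or \<open>ba\<close> transports cancel by antisymmetry,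
  and the others contain the gradient of the regular solution only.
\<close>

lemma nonlin_diagonal:
  assumes V: "ua \<in> Vspace" "ba \<in> Vspace" "u \<in> Vspace" "b \<in> Vspace" and G0: "0 \<le> G"
    and Gu: "AE x in torus. \<forall>i. norm (wd i u x) \<le> G" and Gb: "AE x in torus. \<forall>i. norm (wd i b x) \<le> G"
  defines "U \<equiv> \<lambda>x. ua x - u x" and "W \<equiv> \<lambda>x. ba x - b x"
  shows "nonlin ua ba u b U W \<le> 6 * G * ((l2norm U)\<^sup>2 + (l2norm W)\<^sup>2)"
proof -
  have U: "U \<in> Vspace" and W: "W \<in> Vspace" unfolding U_def W_def by (intro Vspace_diff V)+
  have self: "convect v w w = 0" if "v \<in> Vspace" "w \<in> Vspace" for v w
    using convect_antisym[OF that that(2)] by simp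
  have "nonlin ua ba u b U W = convect W b U - convect U u U + convect W u W - convect U b W"
    using nonlin_eq[OF V U W] convect_antisym[OF V(2) W U] self[OF V(1) U] self[OF V(1) W]
    by (simp add: U_def W_def)
  also have "\<dots> \<le> 3 * G * l2norm W * l2norm U + 3 * G * l2norm U * l2norm U + 3 * G * l2norm W * l2norm W
      + 3 * G * l2norm U * l2norm W"
    using convect_gradient_bounded[OF W Vspace_sobolev[OF V(4)] U Gb G0]
      convect_gradient_bounded[OF U Vspace_sobolev[OF V(3)] U Gu G0]
      convect_gradient_bounded[OF W Vspace_sobolev[OF V(3)] W Gu G0]
      convect_gradient_bounded[OF U Vspace_sobolev[OF V(4)] W Gb G0] by linarith
  also have "\<dots> = 3 * G * (l2norm U + l2norm W)\<^sup>2" by (simp add: power2_sum power2_eq_square algebra_simps)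
  also have "\<dots> \<le> 3 * G * (2 * ((l2norm U)\<^sup>2 + (l2norm W)\<^sup>2))"
  proof (intro mult_left_mono)
    have "0 \<le> (l2norm U - l2norm W)\<^sup>2" by simp
    then show "(l2norm U + l2norm W)\<^sup>2 \<le> 2 * ((l2norm U)\<^sup>2 + (l2norm W)\<^sup>2)"
      by (simp add: power2_eq_square algebra_simps)
  qed (use G0 in simp)
  finally show ?thesis by (simp add: algebra_simps)
qed

lemma nonlin_bound:
  "\<exists>K\<ge>0. \<forall>ua\<in>Vspace. \<forall>ba\<in>Vspace. \<forall>u\<in>Vspace. \<forall>b\<in>Vspace. \<forall>w\<in>Vspace. \<forall>z\<in>Vspace. \<forall>R\<ge>0.
     Vnorm ua \<le> R \<and> Vnorm ba \<le> R \<and> Vnorm u \<le> R \<and> Vnorm b \<le> R \<longrightarrow>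
     \<bar>nonlin ua ba u b w z\<bar> \<le> K * R\<^sup>2 * (Vnorm w + Vnorm z)"
proof -
  obtain K where K0: "0 \<le> K" and K: "\<And>u v w. u \<in> Vspace \<Longrightarrow> sobolev 1 v \<Longrightarrow> w \<in> Vspace \<Longrightarrow>
    \<bar>convect u v w\<bar> \<le> K * Vnorm u * Vnorm v * Vnorm w" using convect_bound by blast
  have "\<bar>nonlin ua ba u b w z\<bar> \<le> 4 * K * R\<^sup>2 * (Vnorm w + Vnorm z)"
    if V: "ua \<in> Vspace" "ba \<in> Vspace" "u \<in> Vspace" "b \<in> Vspace" "w \<in> Vspace" "z \<in> Vspace" and R: "0 \<le> R"
      and le: "Vnorm ua \<le> R" "Vnorm ba \<le> R" "Vnorm u \<le> R" "Vnorm b \<le> R" for ua ba u b w z R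
  proof -
    have c: "\<bar>convect v v' y\<bar> \<le> K * R\<^sup>2 * Vnorm y"
      if "v \<in> Vspace" "v' \<in> Vspace" "Vnorm v \<le> R" "Vnorm v' \<le> R" "y \<in> Vspace" for v v' y
    proof -
      have "K * (Vnorm v * Vnorm v') * Vnorm y \<le> K * (R * R) * Vnorm y"
        using that R K0 by (intro mult_right_mono mult_left_mono mult_mono) auto
      then show ?thesis
        using K[OF that(1) Vspace_sobolev[OF that(2)] that(5)] by (simp add: power2_eq_square mult.assoc)
    qed
    show ?thesis
      unfolding nonlin_def
      using c[OF V(2,2) le(2,2) V(5)] c[OF V(1,1) le(1,1) V(5)] c[OF V(4,4) le(4,4) V(5)] c[OF V(3,3) le(3,3) V(5)]
        c[OF V(2,1) le(2,1) V(6)] c[OF V(1,2) le(1,2) V(6)] c[OF V(4,3) le(4,3) V(6)] c[OF V(3,4) le(3,4) V(6)]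
      by (simp add: algebra_simps)
  qed
  then show ?thesis using K0 by (intro exI[of _ "4 * K"]) auto
qed

lemma C_into_local:
  assumes u: "C_into Vspace Vnorm I u" and x: "x \<in> I" and e: "0 < e"
  shows "\<exists>d>0. \<forall>r\<in>I. \<bar>r - x\<bar> < d \<longrightarrow> Vnorm (\<lambda>y. u r y - u x y) < e"
proof -
  have "eventually (\<lambda>r. Vnorm (\<lambda>y. u r y - u x y) < e) (at x within I)"
    by (rule order_tendstoD(2)[OF C_into_tendsto[OF u x] e])
  then obtain d where d: "0 < d" "\<And>r. r \<in> I \<Longrightarrow> r \<noteq> x \<Longrightarrow> dist r x < d \<Longrightarrow> Vnorm (\<lambda>y. u r y - u x y) < e"
    unfolding eventually_at by blast
  have "Vnorm (\<lambda>y. u x y - u x y) = 0"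
    using Vnorm_scaleR[OF Vspace_sobolev[OF C_into_Vspace[OF u x]], of 0] by simp
  then have "Vnorm (\<lambda>y. u r y - u x y) < e" if "r \<in> I" "\<bar>r - x\<bar> < d" for r
    using d(2)[of r] that e by (cases "r = x") (auto simp: dist_real_def)
  then show ?thesis using d(1) by blast
qed

text \<open>For \<open>\<mu> = 0\<close> this is the conserved energy of the Voigt system, evaluated at the difference.\<close>

definition energy :: "real \<Rightarrow> (real \<Rightarrow> field) \<Rightarrow> (real \<Rightarrow> field) \<Rightarrow> real \<Rightarrow> real" where
  "energy \<alpha> U W t = \<alpha>\<^sup>2 * (Vnorm (U t))\<^sup>2 + (l2norm (U t))\<^sup>2 + (l2norm (W t))\<^sup>2"

text \<open>
  The increment of the energy from \<open>s\<close> to \<open>t\<close> is the increment of the pairing of the difference with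
  the fixed fields \<open>w = U t + U s\<close> and \<open>z = W t + W s\<close>. Apart from the Voigt term of \<open>u\<close>, which the
  Lipschitz bound controls, it equals \<open>t - s\<close> times the difference of the equations at some time \<open>r\<close> in
  between, tested with \<open>(w, z)\<close>, by the mean value theorem. Near \<open>x\<close> these fields
  are close to \<open>(2 U r, 2 W r)\<close> in \<open>V\<close>, for which the cancellations are available, and the error is small
  because the trilinear form is bounded on \<open>V\<close>. The bounds \<open>R\<close> of the Voigt solution may depend on \<open>\<alpha>\<close>,
  as they enter only into the choice of \<open>d\<close>.
\<close>

lemma energy_increment:
  assumes sysa: "weak_system \<alpha> \<mu> T ua ba" and sys: "weak_system 0 \<mu> T u b" and \<mu>: "0 \<le> \<mu>" and G0: "0 \<le> G"
    and G: "\<And>t. t \<in> {0..T} \<Longrightarrow> (AE x in torus. \<forall>i. norm (wd i (u t) x) \<le> G) \<and> (AE x in torus. \<forall>i. norm (wd i (b t) x) \<le> G)"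
    and L0: "0 \<le> L"
    and L: "\<And>s t w. 0 \<le> s \<Longrightarrow> s \<le> t \<Longrightarrow> t \<le> T \<Longrightarrow> w \<in> Vspace \<Longrightarrow>
      \<bar>stokes (\<lambda>x. u t x - u s x) w\<bar> \<le> L * (t - s) * Vnorm w"
    and x: "x \<in> {0..T}" and \<epsilon>: "0 < \<epsilon>"
  defines "U \<equiv> \<lambda>t x. ua t x - u t x" and "W \<equiv> \<lambda>t x. ba t x - b t x"
  defines "e \<equiv> energy \<alpha> U W"
  shows "\<exists>d>0. \<forall>s t. 0 \<le> s \<and> s \<le> x \<and> x \<le> t \<and> t \<le> T \<and> t - s < d \<longrightarrow>
    e t - e s \<le> (t - s) * ((12 * G + 1) * e s + (\<alpha>\<^sup>2 * L\<^sup>2 + \<epsilon>))"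
proof -
  let ?I = "{0..T}"
  have ua: "C_into Vspace Vnorm ?I ua" and ba: "C_into Vspace Vnorm ?I ba"
    and u: "C_into Vspace Vnorm ?I u" and b: "C_into Vspace Vnorm ?I b"
    using sysa sys by (auto simp: weak_system_def)
  have U: "C_into Vspace Vnorm ?I U" and W: "C_into Vspace Vnorm ?I W"
    unfolding U_def W_def by (intro C_into_diff ua ba u b)+
  obtain R1 R2 R3 R4 R5 where R': "\<And>t. t \<in> ?I \<Longrightarrow> Vnorm (ua t) \<le> R1" "\<And>t. t \<in> ?I \<Longrightarrow> Vnorm (ba t) \<le> R2"
    "\<And>t. t \<in> ?I \<Longrightarrow> Vnorm (u t) \<le> R3" "\<And>t. t \<in> ?I \<Longrightarrow> Vnorm (b t) \<le> R4" "\<And>t. t \<in> ?I \<Longrightarrow> Vnorm (W t) \<le> R5"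
    and R0': "0 \<le> R1" "0 \<le> R2" "0 \<le> R3" "0 \<le> R4" "0 \<le> R5"
    using Vnorm_bounded[OF ua] Vnorm_bounded[OF ba] Vnorm_bounded[OF u] Vnorm_bounded[OF b] Vnorm_bounded[OF W] by blast
  define R where "R = R1 + R2 + R3 + R4 + R5"
  have R0: "0 \<le> R" using R0' by (simp add: R_def)
  have R: "Vnorm (ua t) \<le> R" "Vnorm (ba t) \<le> R" "Vnorm (u t) \<le> R" "Vnorm (b t) \<le> R" "Vnorm (W t) \<le> R"
    if "t \<in> ?I" for t using R'[OF that] R0' unfolding R_def by linarith+
  obtain K where K0: "0 \<le> K" and K: "\<And>ua ba u b w z R. ua \<in> Vspace \<Longrightarrow> ba \<in> Vspace \<Longrightarrow> u \<in> Vspace \<Longrightarrow> b \<in> Vspace \<Longrightarrow>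
     w \<in> Vspace \<Longrightarrow> z \<in> Vspace \<Longrightarrow> 0 \<le> R \<Longrightarrow> Vnorm ua \<le> R \<Longrightarrow> Vnorm ba \<le> R \<Longrightarrow> Vnorm u \<le> R \<Longrightarrow> Vnorm b \<le> R \<Longrightarrow>
     \<bar>nonlin ua ba u b w z\<bar> \<le> K * R\<^sup>2 * (Vnorm w + Vnorm z)"
    using nonlin_bound by blast
  \<comment> \<open>\<open>c * \<eta>\<close> collects all errors made by replacing \<open>(w, z)\<close> with \<open>(2 U r, 2 W r)\<close>, \<open>e r\<close>
      with \<open>e s\<close>, and \<open>w\<close> with \<open>2 U s\<close> in the Voigt term.\<close>
  define c where "c = 8 * (K * R\<^sup>2 + \<mu> * R) + 24 * G + 2 * (\<alpha>\<^sup>2 * L)"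
  have c0: "0 \<le> c" unfolding c_def using K0 R0 \<mu> G0 L0 by (intro add_nonneg_nonneg mult_nonneg_nonneg) auto
  define \<eta> where "\<eta> = \<epsilon> / (c + 1)"
  have \<eta>: "0 < \<eta>" using c0 \<epsilon> by (simp add: \<eta>_def)
  have c\<eta>: "c * \<eta> \<le> \<epsilon>"
  proof -
    have "c * \<eta> \<le> (c + 1) * \<eta>" using \<eta> by simp
    also have "\<dots> = \<epsilon>" using c0 by (simp add: \<eta>_def)
    finally show ?thesis .
  qed
  obtain d1 where d1: "0 < d1" "\<And>r. r \<in> ?I \<Longrightarrow> \<bar>r - x\<bar> < d1 \<Longrightarrow> Vnorm (\<lambda>y. U r y - U x y) < \<eta>"
    using C_into_local[OF U x \<eta>] by blast
  obtain d2 where d2: "0 < d2" "\<And>r. r \<in> ?I \<Longrightarrow> \<bar>r - x\<bar> < d2 \<Longrightarrow> Vnorm (\<lambda>y. W r y - W x y) < \<eta>"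
    using C_into_local[OF W x \<eta>] by blast
  have "continuous_on ?I e"
    unfolding e_def energy_def by (intro continuous_intros continuous_on_Vnorm continuous_on_l2norm U W)
  then obtain d3 where d3: "0 < d3" "\<And>r. r \<in> ?I \<Longrightarrow> \<bar>r - x\<bar> < d3 \<Longrightarrow> \<bar>e r - e x\<bar> < \<eta>"
    using x \<eta> unfolding continuous_on_iff dist_real_def by blast
  define d where "d = min d1 (min d2 d3)"
  have d0: "0 < d" using d1(1) d2(1) d3(1) by (simp add: d_def)
  have "e t - e s \<le> (t - s) * ((12 * G + 1) * e s + (\<alpha>\<^sup>2 * L\<^sup>2 + \<epsilon>))"
    if st: "0 \<le> s" "s \<le> x" "x \<le> t" "t \<le> T" "t - s < d" for s t
  proof (cases "s = t")
    case False
    then have lt: "s < t" using st by simp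
    have near: "r \<in> ?I" "\<bar>r - x\<bar> < d" if "r \<in> {s..t}" for r using that st by auto
    have close: "Vnorm (\<lambda>y. C r y - C r' y) \<le> 2 * \<eta>"
      if C: "C_into Vspace Vnorm ?I C" and cl: "\<And>r. r \<in> {s..t} \<Longrightarrow> Vnorm (\<lambda>y. C r y - C x y) < \<eta>"
        and r: "r \<in> {s..t}" "r' \<in> {s..t}" for C r r'
    proof -
      have V: "C r \<in> Vspace" "C r' \<in> Vspace" "C x \<in> Vspace"
        using C_into_Vspace[OF C] near(1) r x by auto
      have "Vnorm (\<lambda>y. (C r y - C x y) - (C r' y - C x y)) \<le> Vnorm (\<lambda>y. C r y - C x y) + Vnorm (\<lambda>y. C r' y - C x y)"
        by (intro Vnorm_diff_triangle Vspace_sobolev Vspace_diff V)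
      then show ?thesis using cl[OF r(1)] cl[OF r(2)] by simp
    qed
    have clU: "Vnorm (\<lambda>y. U r y - U r' y) \<le> 2 * \<eta>" and clW: "Vnorm (\<lambda>y. W r y - W r' y) \<le> 2 * \<eta>"
      if "r \<in> {s..t}" "r' \<in> {s..t}" for r r'
      by (rule close[OF U _ that], rule d1(2), use near d_def in auto)
         (rule close[OF W _ that], rule d2(2), use near d_def in auto)
    have sI: "s \<in> ?I" and tI: "t \<in> ?I" using near(1) lt by auto
    define w where "w = (\<lambda>y. U t y + U s y)"
    define z where "z = (\<lambda>y. W t y + W s y)"
    have Us: "U r \<in> Vspace" "W r \<in> Vspace" "ua r \<in> Vspace" "ba r \<in> Vspace" "u r \<in> Vspace" "b r \<in> Vspace"
      if "r \<in> ?I" for r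
      using that C_into_Vspace[OF U] C_into_Vspace[OF W] C_into_Vspace[OF ua] C_into_Vspace[OF ba]
        C_into_Vspace[OF u] C_into_Vspace[OF b] by auto
    have w: "w \<in> Vspace" and z: "z \<in> Vspace" unfolding w_def z_def by (intro Vspace_add Us sI tI)+
    define \<Phi> where "\<Phi> r = (\<alpha>\<^sup>2 * stokes (ua r) w + ip (ua r) w) - ip (u r) w + (ip (ba r) z - ip (b r) z)" for r
    define D where "D r = nonlin (ua r) (ba r) (u r) (b r) w z - \<mu> * stokes (W r) z" for r
    have D: "(\<Phi> has_real_derivative D r) (at r within ?I)" if r: "r \<in> ?I" for r
    proof -
      have "(\<Phi> has_real_derivative
        (convect (ba r) (ba r) w - convect (ua r) (ua r) w) - (convect (b r) (b r) w - convect (u r) (u r) w)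
        + ((convect (ba r) (ua r) z - convect (ua r) (ba r) z - \<mu> * stokes (ba r) z) -
           (convect (b r) (u r) z - convect (u r) (b r) z - \<mu> * stokes (b r) z))) (at r within ?I)"
        unfolding \<Phi>_def
        by (intro DERIV_add DERIV_diff weak_system_ip_derivative[OF sys w r])
           (use sysa sys w z r in \<open>auto simp: weak_system_def\<close>)
      moreover have "D r = (convect (ba r) (ba r) w - convect (ua r) (ua r) w) - (convect (b r) (b r) w - convect (u r) (u r) w)
        + ((convect (ba r) (ua r) z - convect (ua r) (ba r) z - \<mu> * stokes (ba r) z) -
           (convect (b r) (u r) z - convect (u r) (b r) z - \<mu> * stokes (b r) z))"
      proof -
        have "stokes (W r) z = stokes (ba r) z - stokes (b r) z"
          unfolding W_def by (intro stokes_diff_left Vspace_sobolev Us z r)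
        then have "\<mu> * stokes (W r) z = \<mu> * stokes (ba r) z - \<mu> * stokes (b r) z"
          by (simp add: right_diff_distrib)
        then show ?thesis unfolding D_def nonlin_def by linarith
      qed
      ultimately show ?thesis by simp
    qed
    obtain r where r: "r \<in> {s<..<t}" and mv: "\<Phi> t - \<Phi> s = D r * (t - s)"
      using mvt_within[OF lt _ D] near(1) by (meson subsetI)
    have rst: "r \<in> {s..t}" "s \<in> {s..t}" "t \<in> {s..t}" using r lt by auto
    note rI = near(1)[OF rst(1)]
    have es: "e r \<le> e s + 2 * \<eta>"
      using d3(2)[OF near(1)[OF rst(1)]] d3(2)[OF near(1)[OF rst(2)]] near(2)[OF rst(1)] near(2)[OF rst(2)]
      unfolding d_def by auto
    have dw: "Vnorm (\<lambda>y. w y - 2 *\<^sub>R U r y) \<le> 4 * \<eta>" and dz: "Vnorm (\<lambda>y. z y - 2 *\<^sub>R W r y) \<le> 4 * \<eta>"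
    proof -
      have "(\<lambda>y. w y - 2 *\<^sub>R U r y) = (\<lambda>y. (U t y - U r y) + (U s y - U r y))"
        by (simp add: w_def scaleR_2 algebra_simps)
      moreover have "Vnorm (\<lambda>y. (U t y - U r y) + (U s y - U r y)) \<le> Vnorm (\<lambda>y. U t y - U r y) + Vnorm (\<lambda>y. U s y - U r y)"
        by (intro Vnorm_triangle Vspace_sobolev Vspace_diff Us sI tI rI)
      ultimately show "Vnorm (\<lambda>y. w y - 2 *\<^sub>R U r y) \<le> 4 * \<eta>"
        using clU[OF rst(3,1)] clU[OF rst(2,1)] by simp
      have "(\<lambda>y. z y - 2 *\<^sub>R W r y) = (\<lambda>y. (W t y - W r y) + (W s y - W r y))"
        by (simp add: z_def scaleR_2 algebra_simps)
      moreover have "Vnorm (\<lambda>y. (W t y - W r y) + (W s y - W r y)) \<le> Vnorm (\<lambda>y. W t y - W r y) + Vnorm (\<lambda>y. W s y - W r y)"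
        by (intro Vnorm_triangle Vspace_sobolev Vspace_diff Us sI tI rI)
      ultimately show "Vnorm (\<lambda>y. z y - 2 *\<^sub>R W r y) \<le> 4 * \<eta>"
        using clW[OF rst(3,1)] clW[OF rst(2,1)] by simp
    qed
    have dV: "(\<lambda>y. w y - 2 *\<^sub>R U r y) \<in> Vspace" "(\<lambda>y. z y - 2 *\<^sub>R W r y) \<in> Vspace"
      by (intro Vspace_diff Vspace_scaleR w z Us rI)+
    have Dr: "D r \<le> 12 * G * e r + (K * R\<^sup>2 + \<mu> * R) * (8 * \<eta>)"
    proof -
      have "nonlin (ua r) (ba r) (u r) (b r) w z = 2 * nonlin (ua r) (ba r) (u r) (b r) (U r) (W r)
          + nonlin (ua r) (ba r) (u r) (b r) (\<lambda>y. w y - 2 *\<^sub>R U r y) (\<lambda>y. z y - 2 *\<^sub>R W r y)"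
        by (rule nonlin_split) (intro Us rI w z)+
      moreover have "nonlin (ua r) (ba r) (u r) (b r) (U r) (W r) \<le> 6 * G * ((l2norm (U r))\<^sup>2 + (l2norm (W r))\<^sup>2)"
        unfolding U_def W_def using G[OF rI] by (intro nonlin_diagonal Us rI G0) auto
      moreover have "6 * G * ((l2norm (U r))\<^sup>2 + (l2norm (W r))\<^sup>2) \<le> 6 * G * e r"
        using G0 by (intro mult_left_mono) (simp_all add: e_def energy_def)
      moreover have "\<bar>nonlin (ua r) (ba r) (u r) (b r) (\<lambda>y. w y - 2 *\<^sub>R U r y) (\<lambda>y. z y - 2 *\<^sub>R W r y)\<bar>
          \<le> K * R\<^sup>2 * (Vnorm (\<lambda>y. w y - 2 *\<^sub>R U r y) + Vnorm (\<lambda>y. z y - 2 *\<^sub>R W r y))"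
        by (intro K Us rI dV R0 R)
      moreover have "K * R\<^sup>2 * (Vnorm (\<lambda>y. w y - 2 *\<^sub>R U r y) + Vnorm (\<lambda>y. z y - 2 *\<^sub>R W r y)) \<le> K * R\<^sup>2 * (8 * \<eta>)"
        using dw dz K0 by (intro mult_left_mono) auto
      moreover have "- (\<mu> * stokes (W r) z) \<le> \<mu> * R * (8 * \<eta>)"
      proof -
        have "stokes (W r) (\<lambda>y. z y - 2 *\<^sub>R W r y) = stokes (W r) z - stokes (W r) (\<lambda>y. 2 *\<^sub>R W r y)"
          by (intro stokes_diff_right Vspace_sobolev Vspace_scaleR Us rI z)
        also have "stokes (W r) (\<lambda>y. 2 *\<^sub>R W r y) = 2 * (Vnorm (W r))\<^sup>2"
          unfolding stokes_commute[of "W r" "\<lambda>y. 2 *\<^sub>R W r y"] stokes_self[symmetric]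
          by (intro stokes_scaleR_left Vspace_sobolev Us rI)
        finally have "stokes (W r) (\<lambda>y. z y - 2 *\<^sub>R W r y) = stokes (W r) z - 2 * (Vnorm (W r))\<^sup>2" .
        moreover have "\<bar>stokes (W r) (\<lambda>y. z y - 2 *\<^sub>R W r y)\<bar> \<le> Vnorm (W r) * Vnorm (\<lambda>y. z y - 2 *\<^sub>R W r y)"
          by (intro stokes_bound Vspace_sobolev Us rI dV)
        moreover have "Vnorm (W r) * Vnorm (\<lambda>y. z y - 2 *\<^sub>R W r y) \<le> R * (8 * \<eta>)"
          using dz R(5)[OF rI] R0 \<eta> by (intro mult_mono) auto
        moreover have "0 \<le> (Vnorm (W r))\<^sup>2" by simp
        ultimately have "- stokes (W r) z \<le> R * (8 * \<eta>)" by linarith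
        then show ?thesis using mult_left_mono[OF _ \<mu>] by fastforce
      qed
      ultimately have "D r \<le> 2 * (6 * G * e r) + K * R\<^sup>2 * (8 * \<eta>) + \<mu> * R * (8 * \<eta>)"
        unfolding D_def by linarith
      then show ?thesis by (simp add: distrib_right)
    qed
    have split: "e t - e s = (\<Phi> t - \<Phi> s) - \<alpha>\<^sup>2 * stokes (\<lambda>y. u t y - u s y) w"
    proof -
      have "(Vnorm (U t))\<^sup>2 - (Vnorm (U s))\<^sup>2 = stokes (\<lambda>y. U t y - U s y) w"
        unfolding w_def by (intro stokes_square_diff Vspace_sobolev Us sI tI)
      also have "(\<lambda>y. U t y - U s y) = (\<lambda>y. (ua t y - ua s y) - (u t y - u s y))"
        by (simp add: U_def algebra_simps)
      also have "stokes \<dots> w = stokes (ua t) w - stokes (ua s) w - stokes (\<lambda>y. u t y - u s y) w"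
      proof -
        have S: "sobolev 1 (ua s)" "sobolev 1 (ua t)" "sobolev 1 (u s)" "sobolev 1 (u t)" "sobolev 1 w"
          by (intro Vspace_sobolev Us sI tI w)+
        show ?thesis by (simp add: stokes_diff_left[OF _ _ S(5)] sobolev_diff S)
      qed
      finally have 1: "(Vnorm (U t))\<^sup>2 - (Vnorm (U s))\<^sup>2 =
          stokes (ua t) w - stokes (ua s) w - stokes (\<lambda>y. u t y - u s y) w" .
      have "(l2norm (U t))\<^sup>2 - (l2norm (U s))\<^sup>2 = ip (\<lambda>y. U t y - U s y) w"
        unfolding w_def by (intro ip_square_diff Vspace_L2 Us sI tI)
      also have "\<dots> = ip (ua t) w - ip (ua s) w - (ip (u t) w - ip (u s) w)"
      proof -
        have S: "L2 (ua s)" "L2 (ua t)" "L2 (u s)" "L2 (u t)" "L2 w"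
          by (intro Vspace_L2 Us sI tI w)+
        show ?thesis unfolding U_def by (simp add: ip_diff_left[OF _ _ S(5)] L2_diff S)
      qed
      finally have 2: "(l2norm (U t))\<^sup>2 - (l2norm (U s))\<^sup>2 = ip (ua t) w - ip (ua s) w - (ip (u t) w - ip (u s) w)" .
      have "(l2norm (W t))\<^sup>2 - (l2norm (W s))\<^sup>2 = ip (\<lambda>y. W t y - W s y) z"
        unfolding z_def by (intro ip_square_diff Vspace_L2 Us sI tI)
      also have "\<dots> = ip (ba t) z - ip (ba s) z - (ip (b t) z - ip (b s) z)"
      proof -
        have S: "L2 (ba s)" "L2 (ba t)" "L2 (b s)" "L2 (b t)" "L2 z"
          by (intro Vspace_L2 Us sI tI z)+
        show ?thesis unfolding W_def by (simp add: ip_diff_left[OF _ _ S(5)] L2_diff S)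
      qed
      finally have 3: "(l2norm (W t))\<^sup>2 - (l2norm (W s))\<^sup>2 = ip (ba t) z - ip (ba s) z - (ip (b t) z - ip (b s) z)" .
      have "e t - e s = \<alpha>\<^sup>2 * ((Vnorm (U t))\<^sup>2 - (Vnorm (U s))\<^sup>2) + ((l2norm (U t))\<^sup>2 - (l2norm (U s))\<^sup>2)
          + ((l2norm (W t))\<^sup>2 - (l2norm (W s))\<^sup>2)"
        by (simp add: e_def energy_def algebra_simps)
      then show ?thesis unfolding 1 2 3 \<Phi>_def by (simp add: algebra_simps)
    qed
    \<comment> \<open>The Voigt term of the regular solution, split by Young's inequality after the Lipschitz bound.\<close>
    have corr: "- (\<alpha>\<^sup>2 * stokes (\<lambda>y. u t y - u s y) w) \<le> (t - s) * (e s + \<alpha>\<^sup>2 * L\<^sup>2 + 2 * (\<alpha>\<^sup>2 * L) * \<eta>)"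
    proof -
      have "w = (\<lambda>y. 2 *\<^sub>R U s y + (U t y - U s y))" by (simp add: w_def scaleR_2 add.commute)
      then have "Vnorm w \<le> Vnorm (\<lambda>y. 2 *\<^sub>R U s y) + Vnorm (\<lambda>y. U t y - U s y)"
        using Vnorm_triangle[OF Vspace_sobolev[OF Vspace_scaleR[OF Us(1)[OF sI], of 2]]
            Vspace_sobolev[OF Vspace_diff[OF Us(1)[OF tI] Us(1)[OF sI]]]] by simp
      then have Vw: "Vnorm w \<le> 2 * Vnorm (U s) + 2 * \<eta>"
        using clU[OF rst(3,2)] Vnorm_scaleR[OF Vspace_sobolev[OF Us(1)[OF sI]], of 2] by simp
      have "- stokes (\<lambda>y. u t y - u s y) w \<le> L * (t - s) * Vnorm w"
        using L[OF st(1) less_imp_le[OF lt] st(4) w] by linarith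
      also have "\<dots> \<le> L * (t - s) * (2 * Vnorm (U s) + 2 * \<eta>)"
        using Vw L0 lt by (intro mult_left_mono) auto
      also have "\<dots> = (t - s) * (2 * L * Vnorm (U s) + 2 * L * \<eta>)" by (simp add: algebra_simps)
      also have "\<dots> \<le> (t - s) * ((Vnorm (U s))\<^sup>2 + L\<^sup>2 + 2 * L * \<eta>)"
      proof (intro mult_left_mono)
        have "0 \<le> (Vnorm (U s) - L)\<^sup>2" by simp
        then show "2 * L * Vnorm (U s) + 2 * L * \<eta> \<le> (Vnorm (U s))\<^sup>2 + L\<^sup>2 + 2 * L * \<eta>"
          by (simp add: power2_diff mult_ac)
      qed (use lt in simp)
      finally have "\<alpha>\<^sup>2 * - stokes (\<lambda>y. u t y - u s y) w \<le> \<alpha>\<^sup>2 * ((t - s) * ((Vnorm (U s))\<^sup>2 + L\<^sup>2 + 2 * L * \<eta>))"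
        by (rule mult_left_mono) simp
      also have "\<dots> = (t - s) * (\<alpha>\<^sup>2 * (Vnorm (U s))\<^sup>2 + \<alpha>\<^sup>2 * L\<^sup>2 + 2 * (\<alpha>\<^sup>2 * L) * \<eta>)" by (simp add: algebra_simps)
      also have "\<dots> \<le> (t - s) * (e s + \<alpha>\<^sup>2 * L\<^sup>2 + 2 * (\<alpha>\<^sup>2 * L) * \<eta>)"
        using lt by (intro mult_left_mono) (simp_all add: e_def energy_def)
      finally show ?thesis by simp
    qed
    have "D r * (t - s) \<le> (t - s) * (12 * G * (e s + 2 * \<eta>) + (K * R\<^sup>2 + \<mu> * R) * (8 * \<eta>))"
    proof -
      have "12 * G * e r \<le> 12 * G * (e s + 2 * \<eta>)" using es G0 by (intro mult_left_mono) auto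
      then have "D r \<le> 12 * G * (e s + 2 * \<eta>) + (K * R\<^sup>2 + \<mu> * R) * (8 * \<eta>)" using Dr by linarith
      then show ?thesis using lt by (subst mult.commute) (intro mult_left_mono, auto)
    qed
    then have "e t - e s \<le> (t - s) * (12 * G * (e s + 2 * \<eta>) + (K * R\<^sup>2 + \<mu> * R) * (8 * \<eta>))
        + (t - s) * (e s + \<alpha>\<^sup>2 * L\<^sup>2 + 2 * (\<alpha>\<^sup>2 * L) * \<eta>)"
      using split mv corr by linarith
    also have "\<dots> = (t - s) * ((12 * G + 1) * e s + \<alpha>\<^sup>2 * L\<^sup>2 + c * \<eta>)"
      unfolding c_def by (simp add: algebra_simps)
    also have "\<dots> \<le> (t - s) * ((12 * G + 1) * e s + (\<alpha>\<^sup>2 * L\<^sup>2 + \<epsilon>))"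
      using lt c\<eta> by (intro mult_left_mono) auto
    finally show ?thesis .
  qed simp
  then show ?thesis using d0 by blast
qed

section \<open>Gronwall's inequality and the criterion\<close>

text \<open>
  On short intervals the estimate follows from \<open>1 + y \<le> exp y\<close>, and it survives the concatenation of
  intervals. Bisection then gives it on the whole interval.
\<close>

lemma gronwall_local:
  fixes e :: "real \<Rightarrow> real"
  assumes M: "0 \<le> M" and c: "0 \<le> c" and e0: "\<And>t. t \<in> {0..T} \<Longrightarrow> 0 \<le> e t"
    and loc: "\<And>x. x \<in> {0..T} \<Longrightarrow> \<exists>d>0. \<forall>s t. 0 \<le> s \<and> s \<le> x \<and> x \<le> t \<and> t \<le> T \<and> t - s < d \<longrightarrow>
      e t - e s \<le> (t - s) * (M * e s + c)" and t: "t \<in> {0..T}"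
  shows "e t \<le> exp (M * t) * (e 0 + c * t)"
proof -
  define P where "P a b \<longleftrightarrow> (0 \<le> a \<and> a \<le> b \<and> b \<le> T \<longrightarrow> e b \<le> exp (M * (b - a)) * (e a + c * (b - a)))" for a b
  have "P 0 t"
  proof (rule Bolzano)
    show "0 \<le> t" using t by simp
    fix a b d assume P: "P a b" "P b d" and ab: "a \<le> b" "b \<le> d"
    show "P a d"
      unfolding P_def
    proof
      assume r: "0 \<le> a \<and> a \<le> d \<and> d \<le> T"
      have "e d \<le> exp (M * (d - b)) * (e b + c * (d - b))" using P(2) ab r by (simp add: P_def)
      also have "\<dots> \<le> exp (M * (d - b)) * (exp (M * (b - a)) * (e a + c * (b - a)) + exp (M * (b - a)) * (c * (d - b)))"
      proof (intro mult_left_mono add_mono)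
        show "e b \<le> exp (M * (b - a)) * (e a + c * (b - a))" using P(1) ab r by (simp add: P_def)
        have "1 \<le> exp (M * (b - a))" using M ab by simp
        then show "c * (d - b) \<le> exp (M * (b - a)) * (c * (d - b))"
          using mult_right_mono[of 1 "exp (M * (b - a))" "c * (d - b)"] c ab by simp
      qed simp
      also have "\<dots> = (exp (M * (d - b)) * exp (M * (b - a))) * (e a + c * (d - a))" by (simp add: algebra_simps)
      also have "exp (M * (d - b)) * exp (M * (b - a)) = exp (M * (d - a))"
        by (simp add: algebra_simps flip: exp_add)
      finally show "e d \<le> exp (M * (d - a)) * (e a + c * (d - a))" .
    qed
  next
    fix x assume "0 \<le> x" "x \<le> t"
    then have "x \<in> {0..T}" using t by auto
    from loc[OF this] obtain d where d: "0 < d" "\<And>s t. 0 \<le> s \<Longrightarrow> s \<le> x \<Longrightarrow> x \<le> t \<Longrightarrow> t \<le> T \<Longrightarrow> t - s < d \<Longrightarrow>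
      e t - e s \<le> (t - s) * (M * e s + c)" by blast
    have "P a b" if "a \<le> x \<and> x \<le> b \<and> b - a < d" for a b
      unfolding P_def
    proof
      assume r: "0 \<le> a \<and> a \<le> b \<and> b \<le> T"
      have ea: "0 \<le> e a" using e0 r by simp
      have "e b \<le> e a + (b - a) * (M * e a + c)" using d(2)[of a b] that r by simp
      also have "\<dots> = (1 + M * (b - a)) * e a + 1 * (c * (b - a))" by (simp add: algebra_simps)
      also have "\<dots> \<le> exp (M * (b - a)) * e a + exp (M * (b - a)) * (c * (b - a))"
        using ea r c M by (intro add_mono mult_right_mono exp_ge_add_one_self) auto
      finally show "e b \<le> exp (M * (b - a)) * (e a + c * (b - a))" by (simp add: distrib_left)
    qed
    then show "\<exists>d>0. \<forall>a b. a \<le> x \<and> x \<le> b \<and> b - a < d \<longrightarrow> P a b" using d(1) by blast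
  qed
  then show ?thesis using t by (simp add: P_def)
qed

lemma norms_zero_AE:
  assumes u: "u \<in> Vspace" and zero: "AE x in torus. u x = 0" shows "Vnorm u = 0" "l2norm u = 0"
proof -
  have "sobolev 1 (\<lambda>x. 0 :: real^3)" by (rule sobolev_trig[OF trig_poly_const])
  then have "Vnorm (\<lambda>x. 0 :: real^3) = 0" using Vnorm_scaleR[of "\<lambda>x. 0" 0] by simp
  then show "Vnorm u = 0" using Vnorm_cong_AE[OF Vspace_sobolev[OF u] zero] by simp
  show "l2norm u = 0" by (rule l2norm_zero_AE[OF zero L2_measurable[OF Vspace_L2[OF u]]])
qed

text \<open>
  As long as the regular solution exists, the Voigt solutions stay bounded in \<open>V\<close> as \<open>\<alpha>\<close> tends to
  zero: the energy of the difference is of order \<open>\<alpha>\<^sup>2\<close>.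
\<close>

lemma voigt_bounded_in_V:
  assumes \<mu>: "0 \<le> \<mu>" and sol: "mhd_solution \<mu> S u0 b0 u b" and T: "0 < T" "T < S"
  shows "\<exists>C. \<forall>\<alpha> ua ba t. 0 < \<alpha> \<and> voigt_solution \<alpha> \<mu> T u0 b0 ua ba \<and> t \<in> {0..T} \<longrightarrow> Vnorm (ua t) \<le> C"
proof -
  have u3: "C_into {v \<in> Vspace. sobolev 3 v} (sobnorm 3) {0..<S} u"
    and b3: "C_into {v \<in> Vspace. sobolev 3 v} (sobnorm 3) {0..<S} b"
    and u0: "AE x in torus. u 0 x = u0 x" and b0: "AE x in torus. b 0 x = b0 x"
    using sol by (auto simp: mhd_solution_def)
  have sys: "weak_system 0 \<mu> T u b" by (rule mhd_weak_system[OF sol T])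
  then have u: "C_into Vspace Vnorm {0..T} u" and b: "C_into Vspace Vnorm {0..T} b"
    by (auto simp: weak_system_def)
  obtain R1 R2 where R1: "0 \<le> R1" "\<And>t. t \<in> {0..T} \<Longrightarrow> sobnorm 3 (u t) \<le> R1"
    and R2: "0 \<le> R2" "\<And>t. t \<in> {0..T} \<Longrightarrow> sobnorm 3 (b t) \<le> R2"
    using sobnorm_curve_bounded[OF u3 T(2)] sobnorm_curve_bounded[OF b3 T(2)] by blast
  define R where "R = max R1 R2"
  have reg: "sobolev 3 (u t) \<and> sobnorm 3 (u t) \<le> R" "sobolev 3 (b t) \<and> sobnorm 3 (b t) \<le> R" if "t \<in> {0..T}" for t
    using u3 b3 R1(2)[OF that] R2(2)[OF that] that T by (auto simp: C_into_def R_def)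
  obtain L where L0: "0 \<le> L" and L: "\<And>s t w. 0 \<le> s \<Longrightarrow> s \<le> t \<Longrightarrow> t \<le> T \<Longrightarrow> w \<in> Vspace \<Longrightarrow>
      \<bar>stokes (\<lambda>x. u t x - u s x) w\<bar> \<le> L * (t - s) * Vnorm w"
    using regular_solution_Lipschitz[OF sys reg] by blast
  obtain C where C0: "0 \<le> C" and C: "\<And>v :: field. sobolev 3 v \<Longrightarrow> AE x in torus. \<forall>i. norm (wd i v x) \<le> C * sobnorm 3 v"
    using sobolev_3_bounded by blast
  define G where "G = C * R"
  have G0: "0 \<le> G" using C0 R1(1) by (simp add: G_def R_def)
  have G: "(AE x in torus. \<forall>i. norm (wd i (u t) x) \<le> G) \<and> (AE x in torus. \<forall>i. norm (wd i (b t) x) \<le> G)"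
    if t: "t \<in> {0..T}" for t
  proof -
    have "AE x in torus. \<forall>i. norm (wd i v x) \<le> G" if v: "sobolev 3 v \<and> sobnorm 3 v \<le> R" for v :: field
    proof -
      have "C * sobnorm 3 v \<le> G" unfolding G_def using v C0 by (intro mult_left_mono) auto
      then show ?thesis using C[of v] v by (auto elim!: eventually_mono intro: order_trans)
    qed
    then show ?thesis using reg[OF t] by blast
  qed
  obtain RV where RV: "\<And>t. t \<in> {0..T} \<Longrightarrow> Vnorm (u t) \<le> RV" using Vnorm_bounded[OF u] by blast
  define Q where "Q = exp ((12 * G + 1) * T) * ((L\<^sup>2 + 1) * T)"
  have "Vnorm (ua t) \<le> RV + sqrt Q"
    if \<alpha>: "0 < \<alpha>" and sola: "voigt_solution \<alpha> \<mu> T u0 b0 ua ba" and t: "t \<in> {0..T}" for \<alpha> ua ba t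
  proof -
    have sysa: "weak_system \<alpha> \<mu> T ua ba" by (rule voigt_weak_system[OF sola T(1)])
    have ua: "C_into Vspace Vnorm {0..T} ua" and ba: "C_into Vspace Vnorm {0..T} ba"
      using sysa by (auto simp: weak_system_def)
    let ?U = "\<lambda>t x. ua t x - u t x" and ?W = "\<lambda>t x. ba t x - b t x"
    let ?e = "energy \<alpha> ?U ?W"
    have U: "C_into Vspace Vnorm {0..T} ?U" and W: "C_into Vspace Vnorm {0..T} ?W"
      by (intro C_into_diff ua ba u b)+
    \<comment> \<open>The arbitrary \<open>\<epsilon>\<close> is chosen as \<open>\<alpha>\<^sup>2\<close>, which keeps the right-hand side of order \<open>\<alpha>\<^sup>2\<close>.\<close>
    have "?e t \<le> exp ((12 * G + 1) * t) * (?e 0 + (\<alpha>\<^sup>2 * L\<^sup>2 + \<alpha>\<^sup>2) * t)"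
    proof (rule gronwall_local[OF _ _ _ _ t])
      show "\<exists>d>0. \<forall>s t. 0 \<le> s \<and> s \<le> x \<and> x \<le> t \<and> t \<le> T \<and> t - s < d \<longrightarrow>
        ?e t - ?e s \<le> (t - s) * ((12 * G + 1) * ?e s + (\<alpha>\<^sup>2 * L\<^sup>2 + \<alpha>\<^sup>2))" if "x \<in> {0..T}" for x
        using \<alpha> by (intro energy_increment[OF sysa sys \<mu> G0 G L0 L that]) auto
    qed (use G0 in \<open>auto simp: energy_def\<close>)
    moreover have "?e 0 = 0"
    proof -
      have z: "(0::real) \<in> {0..T}" using T by simp
      have "AE x in torus. ?U 0 x = 0" "AE x in torus. ?W 0 x = 0"
        using sola u0 b0 by (auto simp: voigt_solution_def elim: eventually_elim2)
      then show ?thesis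
        using norms_zero_AE[OF C_into_Vspace[OF U z]] norms_zero_AE[OF C_into_Vspace[OF W z]] by (simp add: energy_def)
    qed
    moreover have "exp ((12 * G + 1) * t) * ((\<alpha>\<^sup>2 * L\<^sup>2 + \<alpha>\<^sup>2) * t) \<le> exp ((12 * G + 1) * T) * ((\<alpha>\<^sup>2 * L\<^sup>2 + \<alpha>\<^sup>2) * T)"
      using t G0 by (intro mult_mono mult_left_mono) auto
    ultimately have "?e t \<le> \<alpha>\<^sup>2 * Q" by (simp add: Q_def algebra_simps)
    moreover have "\<alpha>\<^sup>2 * (Vnorm (?U t))\<^sup>2 \<le> ?e t" by (simp add: energy_def)
    ultimately have "\<alpha>\<^sup>2 * (Vnorm (?U t))\<^sup>2 \<le> \<alpha>\<^sup>2 * Q" by linarith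
    then have "(Vnorm (?U t))\<^sup>2 \<le> Q" using \<alpha> by simp
    then have "Vnorm (?U t) \<le> sqrt Q" by (rule real_le_rsqrt)
    moreover have "\<bar>Vnorm (ua t) - Vnorm (u t)\<bar> \<le> Vnorm (?U t)"
      by (intro Vnorm_reverse_triangle Vspace_sobolev C_into_Vspace[OF ua t] C_into_Vspace[OF u t])
    ultimately show ?thesis using RV[OF t] by linarith
  qed
  then show ?thesis by blast
qed

theorem theorem5p3:
  fixes \<mu> Tstar :: real
    and u0 b0 :: field
    and ua ba :: "real \<Rightarrow> real \<Rightarrow> field"
  assumes "\<mu> \<ge> 0"
    and "u0 \<in> Vspace" and "sobolev 3 u0"
    and "b0 \<in> Vspace" and "sobolev 3 b0"
    and "0 < Tstar"
    and "\<And>\<alpha> T. 0 < \<alpha> \<Longrightarrow> 0 < T \<Longrightarrow> T < Tstar \<Longrightarrow>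
           voigt_solution \<alpha> \<mu> T u0 b0 (ua \<alpha>) (ba \<alpha>)"
    and "(SUP t\<in>{0..<Tstar}.
           Limsup (at_right 0) (\<lambda>\<alpha>. ereal (\<alpha>\<^sup>2 * (Vnorm (ua \<alpha> t))\<^sup>2))) > 0"
  shows "\<not> (\<exists>u b. mhd_solution \<mu> Tstar u0 b0 u b)"
proof
  assume "\<exists>u b. mhd_solution \<mu> Tstar u0 b0 u b"
  then obtain u b where sol: "mhd_solution \<mu> Tstar u0 b0 u b" by blast
  obtain t where t: "t \<in> {0..<Tstar}"
    and pos: "0 < Limsup (at_right 0) (\<lambda>\<alpha>. ereal (\<alpha>\<^sup>2 * (Vnorm (ua \<alpha> t))\<^sup>2))"
    using assms(8) unfolding less_SUP_iff by blast
  define T where "T = (t + Tstar) / 2"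
  have T: "0 < T" "T < Tstar" "t \<in> {0..T}" using t by (auto simp: T_def)
  obtain C where C: "\<And>\<alpha>. 0 < \<alpha> \<Longrightarrow> Vnorm (ua \<alpha> t) \<le> C"
    using voigt_bounded_in_V[OF assms(1) sol T(1,2)] assms(7)[OF _ T(1,2)] T(3) by blast
  have "Limsup (at_right 0) (\<lambda>\<alpha>. ereal (\<alpha>\<^sup>2 * (Vnorm (ua \<alpha> t))\<^sup>2)) \<le> Limsup (at_right 0) (\<lambda>\<alpha>. ereal (\<alpha>\<^sup>2 * C\<^sup>2))"
  proof (rule Limsup_mono)
    show "\<forall>\<^sub>F \<alpha> in at_right 0. ereal (\<alpha>\<^sup>2 * (Vnorm (ua \<alpha> t))\<^sup>2) \<le> ereal (\<alpha>\<^sup>2 * C\<^sup>2)"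
      unfolding eventually_at_filter
      by (rule always_eventually) (auto intro!: mult_left_mono power_mono C)
  qed
  also have "\<dots> = ereal (0\<^sup>2 * C\<^sup>2)"
    by (intro lim_imp_Limsup tendsto_intros) auto
  finally show False using pos by (simp add: leD flip: zero_ereal_def)
qed

end
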